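(* Let $X$ be a path-connected space having the homotopy type of a simplicial complex, let $n\geq 1$ and let $\Gamma\subset\mathfrak S_n$ be a subgroup. Let $r$ be the number of orbits of size at least $2$ of the action of $\Gamma$ on $\{1,\ldots,n\}$, and let $k_1,\ldots,k_r$ be the sizes of these orbits. Then $$\pi_1\big(\Gamma P^n(X)\big)\cong \pi_1(X)^{\,n-\sum_{i=1}^r k_i}\times H_1(X;\mathbb Z)^r.$$ In particular, if $n\geq 2$ and $\Gamma$ acts transitively on $\{1,\ldots,n\}$, then $\pi_1(\Gamma P^n(X))\cong H_1(X;\mathbb Z)$.
   Context: For a subgroup $\Gamma$ of the symmetric group $\mathfrak S_n$, the permutation product $\Gamma P^n(X)$ is the quotient $X^n/\Gamma$ of $X^n$ by the action of $\Gamma$ permuting coordinates. *)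

theory Defs
  imports "HOL-Analysis.Analysis" "HOL-Algebra.Sym_Groups" "HOL-Algebra.Product_Groups"
    "HOL-Algebra.Free_Abelian_Groups"
begin

definition path_homotopic :: "'a topology \<Rightarrow> (real \<Rightarrow> 'a) \<Rightarrow> (real \<Rightarrow> 'a) \<Rightarrow> bool" where
  "path_homotopic X p q \<longleftrightarrow>
     (\<exists>h. continuous_map (prod_topology (top_of_set {0..1::real}) (top_of_set {0..1::real})) X h \<and>
          (\<forall>s\<in>{0..1}. h (0, s) = p s \<and> h (1, s) = q s) \<and>
          (\<forall>t\<in>{0..1}. h (t, 0) = p 0 \<and> h (t, 1) = p 1))"

definition loops_at :: "'a topology \<Rightarrow> 'a \<Rightarrow> (real \<Rightarrow> 'a) set" where
  "loops_at X b = {p. pathin X p \<and> p 0 = b \<and> p 1 = b}"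

definition path_class :: "'a topology \<Rightarrow> (real \<Rightarrow> 'a) \<Rightarrow> (real \<Rightarrow> 'a) set" where
  "path_class X p = {q. pathin X q \<and> path_homotopic X p q}"

definition path_join :: "(real \<Rightarrow> 'a) \<Rightarrow> (real \<Rightarrow> 'a) \<Rightarrow> real \<Rightarrow> 'a" where
  "path_join p q = (\<lambda>t. if t \<le> 1/2 then p (2 * t) else q (2 * t - 1))"

definition fundamental_group :: "'a topology \<Rightarrow> 'a \<Rightarrow> (real \<Rightarrow> 'a) set monoid" where
  "fundamental_group X b =
     \<lparr> carrier = path_class X ` loops_at X b,
       mult = (\<lambda>A B. \<Union>{path_class X (path_join p q) | p q. p \<in> A \<and> q \<in> B}),
       one = path_class X (\<lambda>_. b) \<rparr>"

text \<open>Singular 1-simplices are identified with paths on [0,1] (Delta^1 = [0,1], vertex e0 = 0, e1 = 1);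
 the standard 2-simplex has vertices e0 = (0,0), e1 = (1,0), e2 = (0,1).\<close>

definition std_simplex2 :: "(real \<times> real) set" where
  "std_simplex2 = {(s, t). 0 \<le> s \<and> 0 \<le> t \<and> s + t \<le> 1}"

definition sing1 :: "'a topology \<Rightarrow> (real \<Rightarrow> 'a) set" where
  "sing1 X = {p. pathin X p \<and> p \<in> extensional {0..1}}"

definition sing2 :: "'a topology \<Rightarrow> (real \<times> real \<Rightarrow> 'a) set" where
  "sing2 X = {\<sigma>. continuous_map (top_of_set std_simplex2) X \<sigma> \<and> \<sigma> \<in> extensional std_simplex2}"

definition face2 :: "nat \<Rightarrow> (real \<times> real \<Rightarrow> 'a) \<Rightarrow> real \<Rightarrow> 'a" where
  "face2 i \<sigma> = restrict (\<lambda>t. \<sigma> (if i = 0 then (1 - t, t) else if i = 1 then (0, t) else (t, 0))) {0..1}"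

definition bd1 :: "((real \<Rightarrow> 'a) \<Rightarrow>\<^sub>0 int) \<Rightarrow> ('a \<Rightarrow>\<^sub>0 int)" where
  "bd1 = frag_extend (\<lambda>p. frag_of (p 1) - frag_of (p 0))"

definition bd2 :: "((real \<times> real \<Rightarrow> 'a) \<Rightarrow>\<^sub>0 int) \<Rightarrow> ((real \<Rightarrow> 'a) \<Rightarrow>\<^sub>0 int)" where
  "bd2 = frag_extend (\<lambda>\<sigma>. frag_of (face2 0 \<sigma>) - frag_of (face2 1 \<sigma>) + frag_of (face2 2 \<sigma>))"

definition cycles1 :: "'a topology \<Rightarrow> ((real \<Rightarrow> 'a) \<Rightarrow>\<^sub>0 int) set" where
  "cycles1 X = {c \<in> carrier (free_Abelian_group (sing1 X)). bd1 c = 0}"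

definition boundaries1 :: "'a topology \<Rightarrow> ((real \<Rightarrow> 'a) \<Rightarrow>\<^sub>0 int) set" where
  "boundaries1 X = bd2 ` carrier (free_Abelian_group (sing2 X))"

definition H1 :: "'a topology \<Rightarrow> ((real \<Rightarrow> 'a) \<Rightarrow>\<^sub>0 int) set monoid" where
  "H1 X = ((free_Abelian_group (sing1 X)) \<lparr>carrier := cycles1 X\<rparr>) Mod (boundaries1 X)"

definition abs_simplicial_complex :: "'v set set \<Rightarrow> bool" where
  "abs_simplicial_complex K \<longleftrightarrow>
     (\<forall>\<sigma>\<in>K. finite \<sigma> \<and> \<sigma> \<noteq> {}) \<and> (\<forall>\<sigma>\<in>K. \<forall>\<tau>. \<tau> \<subseteq> \<sigma> \<and> \<tau> \<noteq> {} \<longrightarrow> \<tau> \<in> K)"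

definition geom_simplex :: "'v set \<Rightarrow> ('v \<Rightarrow> real) set" where
  "geom_simplex \<sigma> = {f. (\<forall>v. 0 \<le> f v) \<and> (\<forall>v. v \<notin> \<sigma> \<longrightarrow> f v = 0) \<and> sum f \<sigma> = 1}"

definition geom_realization :: "'v set set \<Rightarrow> ('v \<Rightarrow> real) set" where
  "geom_realization K = (\<Union>\<sigma>\<in>K. geom_simplex \<sigma>)"

definition is_realization_topology :: "'v set set \<Rightarrow> ('v \<Rightarrow> real) topology \<Rightarrow> bool" where
  "is_realization_topology K T \<longleftrightarrow>
     (\<forall>U. openin T U \<longleftrightarrow> U \<subseteq> geom_realization K \<and>
        (\<forall>\<sigma>\<in>K. openin (subtopology (powertop_real UNIV) (geom_simplex \<sigma>)) (U \<inter> geom_simplex \<sigma>)))"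

definition has_simplicial_homotopy_type :: "'a topology \<Rightarrow> 'v itself \<Rightarrow> bool" where
  "has_simplicial_homotopy_type X _ \<longleftrightarrow>
     (\<exists>(K::'v set set) T. abs_simplicial_complex K \<and> is_realization_topology K T \<and>
        X homotopy_equivalent_space T)"

definition perm_orbit :: "(nat \<Rightarrow> nat) set \<Rightarrow> nat \<Rightarrow> nat set" where
  "perm_orbit \<Gamma> i = (\<lambda>\<sigma>. \<sigma> i) ` \<Gamma>"

definition big_orbits :: "nat \<Rightarrow> (nat \<Rightarrow> nat) set \<Rightarrow> nat set set" where
  "big_orbits n \<Gamma> = {B. \<exists>i\<in>{1..n}. B = perm_orbit \<Gamma> i \<and> 2 \<le> card B}"

end

theory Submission
  imports Defs
begin

text \<open>
  Write \<open>q\<close> for the projection \<open>X\<^sup>n \<rightarrow> Q\<close>. The proof compares two homomorphisms out of \<open>\<pi>\<^sub>1(X)\<^sup>n\<close>: the one induced by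
  \<open>q\<close>, and the one that keeps the coordinates fixed by \<open>\<Gamma>\<close> and sums the Hurewicz images over each
  larger orbit. Both are onto, and they have the same kernel.

  By the homotopy equivalence with a simplicial complex, every finite subset of \<open>X\<close> lies in an open set
  that deforms in \<open>X\<close> onto finitely many points (pull back small open stars, contracted linearly). The induced
  deformations of open subsets of \<open>Q\<close> show that paths lift to \<open>X\<^sup>n\<close> up to homotopy, so the first map is onto.
  The tracks of the deformations, summed over an orbit, are symmetric, hence define local potentials
  on \<open>Q\<close> with values in 1-chains modulo boundaries. Their integral along paths is a homotopy invariant whose value on
  \<open>q \<circ> (p\<^sub>1, \<dots>, p\<^sub>n)\<close> is \<open>\<Sum>[p\<^sub>i]\<close>, so the kernel of the first map is contained in that of the second.
  Conversely, all coordinate inclusions of one orbit induce the same homomorphism \<open>\<pi>\<^sub>1(X) \<rightarrow> \<pi>\<^sub>1(Q)\<close>; if the orbit has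
  at least two elements its image is commutative, so it factors through homology.
\<close>

text \<open>The action on X^n is not free, so q is no covering: lifts are not unique, and a
  null-homotopy in Q does not lift in general, since the kernel is nontrivial in general. This
  shapes the proof. Surjectivity needs just one lift of each path up to homotopy; with a base point
  on the diagonal, which \<Gamma> fixes, the lift of a loop is again a loop. The kernel needs
  control over homotopies in Q, and gets it from an invariant living on Q itself: the potentials act
  as a closed 1-form with coefficients in an abelian group. Abelian coefficients lose nothing on an
  orbit with two or more elements, but would lose information at a fixed coordinate; there the
  projection X^n \<rightarrow> X factors through Q and sees the class in the fundamental group
  itself. Only the homotopy type of X is given, so points of X may lack contractible neighbourhoods.
  Hence a deformation starts on an open set U but moves through all of X, and its final map is
  merely locally constant, because the finitely many points that U must contain are spread over
  several stars.\<close>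

abbreviation "unit_interval \<equiv> top_of_set {0..1::real}"

abbreviation "unit_square \<equiv> prod_topology unit_interval unit_interval"

section \<open>Homotopies of paths\<close>

lemma continuous_map_compose_on:
  assumes "continuous_map (top_of_set S) X P" "continuous_on A g" "g \<in> A \<rightarrow> S"
  shows "continuous_map (top_of_set A) X (\<lambda>z. P (g z))"
proof -
  have "continuous_map (top_of_set A) (top_of_set S) g"
    using assms by auto
  from continuous_map_compose[OF this assms(1)] show ?thesis by (simp add: o_def)
qed

lemma prod_top_of_set: "prod_topology (top_of_set A) (top_of_set B) = top_of_set (A \<times> B)"
  by simp

lemma continuous_map_cong: "continuous_map X Y f \<Longrightarrow> (\<And>x. x \<in> topspace X \<Longrightarrow> f x = g x) \<Longrightarrow> continuous_map X Y g"
  using continuous_map_eq by blast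

text \<open>The parameter space \<open>Y\<close> is arbitrary because it is a point when paths are
  joined, the interval when homotopies are joined, and an open subset of \<open>X\<close> when the
  deformations of the cover are assembled.\<close>

lemma continuous_map_join_homotopy:
  assumes f: "continuous_map (prod_topology unit_interval Y) X f"
    and g: "continuous_map (prod_topology unit_interval Y) X g"
    and fg: "\<And>y. y \<in> topspace Y \<Longrightarrow> f (1, y) = g (0, y)"
  shows "continuous_map (prod_topology unit_interval Y) X
           (\<lambda>z. if fst z \<le> 1/2 then f (2 * fst z, snd z) else g (2 * fst z - 1, snd z))"
proof -
  let ?P = "prod_topology unit_interval Y"
  have c1: "continuous_map ?P euclideanreal fst"
    using continuous_map_fst[of unit_interval Y] by (rule continuous_map_into_fulltopology)
  have c2: "continuous_map ?P Y snd" by (rule continuous_map_snd)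
  show ?thesis
  proof (rule continuous_map_cases_le[OF c1])
    show "continuous_map ?P euclideanreal (\<lambda>x. 1 / 2)" by simp
    let ?S = "{x. x \<in> topspace ?P \<and> fst x \<le> 1 / 2}"
    have "continuous_map (subtopology ?P ?S) ?P (\<lambda>z. (2 * fst z, snd z))"
      apply (subst continuous_map_pairwise)
      apply (auto simp: o_def continuous_map_in_subtopology intro!: continuous_map_real_mult
         continuous_map_from_subtopology c1 c2)
      done
    from continuous_map_compose[OF this f] show "continuous_map (subtopology ?P ?S) X (\<lambda>z. f (2 * fst z, snd z))"
      by (simp add: o_def)
    let ?S = "{x. x \<in> topspace ?P \<and> 1/2 \<le> fst x}"
    have "continuous_map (subtopology ?P ?S) ?P (\<lambda>z. (2 * fst z - 1, snd z))"
      apply (subst continuous_map_pairwise)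
      apply (auto simp: o_def continuous_map_in_subtopology intro!: continuous_map_real_mult continuous_map_diff
         continuous_map_from_subtopology c1 c2)
      done
    from continuous_map_compose[OF this g] show "continuous_map (subtopology ?P ?S) X (\<lambda>z. g (2 * fst z - 1, snd z))"
      by (simp add: o_def)
    show "f (2 * fst x, snd x) = g (2 * fst x - 1, snd x)" if "x \<in> topspace ?P" "fst x = 1/2" for x
    proof -
      have "2 * fst x = 1" "2 * fst x - 1 = 0" "snd x \<in> topspace Y" using that by auto
      then show ?thesis using fg by (simp only:)
    qed
  qed
qed

text \<open>The straight-line homotopy from \<open>\<phi>\<close> to \<open>\<psi>\<close> inside
  \<open>S\<close>, pushed forward by \<open>P\<close>. Every reparametrisation below is an
  instance: the group laws with \<open>S\<close> the interval, the boundaries of a triangle and of a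
  square with \<open>S\<close> in the plane. Since paths are total functions, \<open>p\<close> and
  \<open>q\<close> are compared with \<open>P\<close> only on the interval.\<close>

lemma path_homotopic_convex:
  fixes S :: "'c::real_normed_vector set"
  assumes "convex S" and P: "continuous_map (top_of_set S) X P"
    and "continuous_on {0..1} \<phi>" "continuous_on {0..1} \<psi>"
    and "\<phi> \<in> {0..1} \<rightarrow> S" "\<psi> \<in> {0..1} \<rightarrow> S"
    and "\<phi> 0 = \<psi> 0" "\<phi> 1 = \<psi> 1"
    and p: "\<And>t. 0 \<le> t \<Longrightarrow> t \<le> 1 \<Longrightarrow> p t = P (\<phi> t)"
    and q: "\<And>t. 0 \<le> t \<Longrightarrow> t \<le> 1 \<Longrightarrow> q t = P (\<psi> t)"
  shows "path_homotopic X p q"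
  unfolding path_homotopic_def
proof (intro exI conjI)
  let ?g = "\<lambda>z. (1 - fst z) *\<^sub>R \<phi> (snd z) + fst z *\<^sub>R \<psi> (snd z)"
  show "continuous_map unit_square X (\<lambda>z. P (?g z))"
    unfolding prod_top_of_set
  proof (rule continuous_map_compose_on[OF P])
    show "continuous_on ({0..1} \<times> {0..1}) ?g"
      by (intro continuous_intros continuous_on_compose2[OF assms(3)] continuous_on_compose2[OF assms(4)]) auto
    show "?g \<in> {0..1} \<times> {0..1} \<rightarrow> S"
      using assms(5,6) \<open>convex S\<close> unfolding convex_def by (fastforce simp: Pi_iff)
  qed
qed (auto simp: assms p q simp flip: scaleR_left_distrib)

text \<open>\<open>path_homotopic\<close> does not ask that its arguments be paths; two opposite
  edges of the square show that they are.\<close>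

lemma path_homotopic_imp_pathin:
  assumes "path_homotopic X p q" shows "pathin X p" "pathin X q"
proof -
  obtain h where h: "continuous_map unit_square X h"
    and e: "\<And>s. s\<in>{0..1} \<Longrightarrow> h (0, s) = p s" "\<And>s. s\<in>{0..1} \<Longrightarrow> h (1, s) = q s"
    using assms unfolding path_homotopic_def by blast
  have *: "continuous_map unit_interval X (\<lambda>s. h (c, s))" if "c \<in> {0..1}" for c
    by (rule continuous_map_compose_on[OF h[unfolded prod_top_of_set]]) (use that in \<open>auto intro!: continuous_intros\<close>)
  show "pathin X p" unfolding pathin_def
    by (rule continuous_map_cong[OF *[of 0]]) (auto simp: e)
  show "pathin X q" unfolding pathin_def
    by (rule continuous_map_cong[OF *[of 1]]) (auto simp: e)
qed

lemma path_homotopic_imp_ends: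
  fixes X :: "'a topology"
  assumes "path_homotopic X p q" shows "p 0 = q 0" "p 1 = q 1"
proof -
  obtain h :: "real \<times> real \<Rightarrow> 'a" where e: "\<And>s. s\<in>{0..1} \<Longrightarrow> h (0, s) = p s \<and> h (1, s) = q s"
     "\<And>t. t\<in>{0..1} \<Longrightarrow> h (t, 0) = p 0 \<and> h (t, 1) = p 1"
    using assms unfolding path_homotopic_def by blast
  show "p 0 = q 0" using e(1)[of 0] e(2)[of 1] by auto
  show "p 1 = q 1" using e(1)[of 1] e(2)[of 1] by auto
qed

lemma path_homotopic_eqI:
  assumes "pathin X p" "\<And>t. 0 \<le> t \<Longrightarrow> t \<le> 1 \<Longrightarrow> p t = q t"
  shows "path_homotopic X p q"
proof (rule path_homotopic_convex[where S="{0..1}" and P=p and \<phi>="\<lambda>t. t" and \<psi>="\<lambda>t. t"])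
  show "continuous_map unit_interval X p" using assms by (simp add: pathin_def)
  show "q t = p t" if "0 \<le> t" "t \<le> 1" for t using assms(2)[OF that] by simp
qed auto

lemma path_homotopic_refl: "pathin X p \<Longrightarrow> path_homotopic X p p"
  by (rule path_homotopic_eqI) auto

lemma path_homotopic_sym:
  assumes "path_homotopic X p q" shows "path_homotopic X q p"
proof -
  obtain h where h: "continuous_map unit_square X h"
    and e: "\<forall>s\<in>{0..1}. h (0, s) = p s \<and> h (1, s) = q s" "\<forall>t\<in>{0..1}. h (t, 0) = p 0 \<and> h (t, 1) = p 1"
    using assms unfolding path_homotopic_def by blast
  show ?thesis unfolding path_homotopic_def
  proof (intro exI conjI)
    show "continuous_map unit_square X (\<lambda>z. h (1 - fst z, snd z))"
      unfolding prod_top_of_set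
      by (rule continuous_map_compose_on[OF h[unfolded prod_top_of_set]]) (auto intro!: continuous_intros)
  qed (use e path_homotopic_imp_ends[OF assms] in auto)
qed

lemma path_homotopic_trans [trans]:
  assumes "path_homotopic X p q" "path_homotopic X q r" shows "path_homotopic X p r"
proof -
  obtain h where h: "continuous_map unit_square X h"
    and e: "\<forall>s\<in>{0..1}. h (0, s) = p s \<and> h (1, s) = q s" "\<forall>t\<in>{0..1}. h (t, 0) = p 0 \<and> h (t, 1) = p 1"
    using assms(1) unfolding path_homotopic_def by blast
  obtain k where k: "continuous_map unit_square X k"
    and e': "\<And>s. s\<in>{0..1} \<Longrightarrow> k (0, s) = q s \<and> k (1, s) = r s"
     "\<And>t. t\<in>{0..1} \<Longrightarrow> k (t, 0) = q 0 \<and> k (t, 1) = q 1"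
    using assms(2) unfolding path_homotopic_def by blast
  show ?thesis unfolding path_homotopic_def
    by (rule exI, intro conjI, rule continuous_map_join_homotopy[OF h k])
       (use e e' path_homotopic_imp_ends[OF assms(1)] in auto)
qed

lemma pathin_join:
  assumes "pathin X p" "pathin X q" "p 1 = q 0" shows "pathin X (path_join p q)"
proof -
  let ?Y = "top_of_set {0::real}"
  have *: "continuous_map (prod_topology unit_interval ?Y) X (\<lambda>z. p (fst z))" if "pathin X p" for p
    unfolding prod_top_of_set
    by (rule continuous_map_compose_on[OF that[unfolded pathin_def]]) (auto intro!: continuous_intros)
  have "continuous_map (top_of_set ({0..1} \<times> {0})) X (\<lambda>z::real\<times>real. if fst z \<le> 1/2 then p (2 * fst z) else q (2 * fst z - 1))"
    using continuous_map_join_homotopy[OF *[OF assms(1)] *[OF assms(2)]] assms(3) by (simp cong: if_cong)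
  then have "continuous_map unit_interval X (\<lambda>t. (\<lambda>z::real\<times>real. if fst z \<le> 1/2 then p (2 * fst z) else q (2 * fst z - 1)) (t, 0))"
    by (rule continuous_map_compose_on) (auto intro!: continuous_intros)
  then show ?thesis by (simp add: pathin_def path_join_def cong: if_cong)
qed

lemma path_join_ends [simp]: "path_join p q 0 = p 0" "path_join p q 1 = q 1"
  by (auto simp: path_join_def)

lemma path_homotopic_join:
  assumes "path_homotopic X p p'" "path_homotopic X q q'" "p 1 = q 0"
  shows "path_homotopic X (path_join p q) (path_join p' q')"
proof -
  obtain h where h: "continuous_map unit_square X h"
    and e: "\<forall>s\<in>{0..1}. h (0, s) = p s \<and> h (1, s) = p' s" "\<forall>t\<in>{0..1}. h (t, 0) = p 0 \<and> h (t, 1) = p 1"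
    using assms(1) unfolding path_homotopic_def by blast
  obtain k where k: "continuous_map unit_square X k"
    and e': "\<And>s. s\<in>{0..1} \<Longrightarrow> k (0, s) = q s \<and> k (1, s) = q' s"
     "\<And>t. t\<in>{0..1} \<Longrightarrow> k (t, 0) = q 0 \<and> k (t, 1) = q 1"
    using assms(2) unfolding path_homotopic_def by blast
  have sw: "continuous_map unit_square X (\<lambda>z. h (snd z, fst z))"
    if "continuous_map unit_square X h" for h
    unfolding prod_top_of_set
    by (rule continuous_map_compose_on[OF that[unfolded prod_top_of_set]]) (auto intro!: continuous_intros)
  have "continuous_map unit_square X
     (\<lambda>z. if fst z \<le> 1/2 then h (snd z, 2 * fst z) else k (snd z, 2 * fst z - 1))"
    using continuous_map_join_homotopy[OF sw[OF h] sw[OF k]] e(2) e'(2) assms(3) by (simp cong: if_cong)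
  from sw[OF this]
  show ?thesis unfolding path_homotopic_def
    by (intro exI conjI, assumption) (use e e' assms(3) in \<open>auto simp: path_join_def\<close>)
qed

lemma path_homotopic_compose:
  assumes "path_homotopic X p q" "continuous_map X Y f"
  shows "path_homotopic Y (\<lambda>t. f (p t)) (\<lambda>t. f (q t))"
proof -
  obtain h where h: "continuous_map unit_square X h"
    and e: "\<forall>s\<in>{0..1}. h (0, s) = p s \<and> h (1, s) = q s" "\<forall>t\<in>{0..1}. h (t, 0) = p 0 \<and> h (t, 1) = p 1"
    using assms unfolding path_homotopic_def by blast
  show ?thesis unfolding path_homotopic_def
    by (rule exI, intro conjI, rule continuous_map_compose[OF h assms(2)]) (use e in auto)
qed

lemma path_homotopic_product:
  assumes "\<And>i. i \<in> I \<Longrightarrow> path_homotopic (Xs i) (\<lambda>t. p t i) (\<lambda>t. q t i)"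
    and "\<And>t. p t \<in> extensional I" "\<And>t. q t \<in> extensional I"
  shows "path_homotopic (product_topology Xs I) p q"
proof -
  have "\<forall>i\<in>I. \<exists>h. continuous_map unit_square (Xs i) h \<and>
     (\<forall>s\<in>{0..1}. h (0, s) = p s i \<and> h (1, s) = q s i) \<and>
          (\<forall>t\<in>{0..1}. h (t, 0) = p 0 i \<and> h (t, 1) = p 1 i)"
    using assms unfolding path_homotopic_def by auto
  then obtain h where h: "\<And>i. i \<in> I \<Longrightarrow> continuous_map unit_square (Xs i) (h i)"
     "\<And>i s. i \<in> I \<Longrightarrow> s \<in> {0..1} \<Longrightarrow> h i (0, s) = p s i \<and> h i (1, s) = q s i"
     "\<And>i t. i \<in> I \<Longrightarrow> t \<in> {0..1} \<Longrightarrow> h i (t, 0) = p 0 i \<and> h i (t, 1) = p 1 i"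
    by metis
  show ?thesis unfolding path_homotopic_def
    by (rule exI[where x="\<lambda>z. \<lambda>i\<in>I. h i z"])
       (use h assms(2,3) in \<open>auto simp: continuous_map_componentwise fun_eq_iff extensional_def\<close>)
qed

definition path_rev :: "(real \<Rightarrow> 'a) \<Rightarrow> real \<Rightarrow> 'a" where
  "path_rev p = (\<lambda>t. p (1 - t))"

lemma path_rev_ends [simp]: "path_rev p 0 = p 1" "path_rev p 1 = p 0"
  by (auto simp: path_rev_def)

lemma pathin_subpath:
  assumes "pathin X p" "continuous_on {0..1} g" "g \<in> {0..1} \<rightarrow> {0..1}"
  shows "pathin X (\<lambda>t. p (g t))"
  using continuous_map_compose_on[OF assms(1)[unfolded pathin_def] assms(2,3)] by (simp add: pathin_def)

lemma pathin_rev: "pathin X p \<Longrightarrow> pathin X (path_rev p)"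
  unfolding path_rev_def by (rule pathin_subpath) (auto intro!: continuous_intros)

lemma path_homotopic_rev: 
  assumes "path_homotopic X p q" shows "path_homotopic X (path_rev p) (path_rev q)"
proof -
  obtain h where h: "continuous_map unit_square X h"
    and e: "\<forall>s\<in>{0..1}. h (0, s) = p s \<and> h (1, s) = q s" "\<forall>t\<in>{0..1}. h (t, 0) = p 0 \<and> h (t, 1) = p 1"
    using assms unfolding path_homotopic_def by blast
  have "continuous_map unit_square X (\<lambda>z. h (fst z, 1 - snd z))"
    unfolding prod_top_of_set
    by (rule continuous_map_compose_on[OF h[unfolded prod_top_of_set]]) (auto intro!: continuous_intros)
  then show ?thesis unfolding path_homotopic_def
    by (intro exI conjI, assumption) (use e in \<open>auto simp: path_rev_def\<close>)
qed

lemma continuous_on_piecewise3: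
  fixes a b c :: "real \<Rightarrow> real"
  assumes "continuous_on UNIV a" "continuous_on UNIV b" "continuous_on UNIV c" "a u = b u" "b v = c v" "u \<le> v"
  shows "continuous_on UNIV (\<lambda>t. if t \<le> u then a t else if t \<le> v then b t else c t)"
proof -
  have 1: "continuous_on UNIV (\<lambda>t. if t \<le> v then b t else c t)"
    by (rule continuous_on_cases_le[where h="\<lambda>t. t"]) (use assms continuous_on_subset in \<open>auto\<close>)
  show ?thesis
    by (rule continuous_on_cases_le[where h="\<lambda>t. t"]) (use assms 1 continuous_on_subset in \<open>auto\<close>)
qed

lemma path_homotopic_assoc:
  assumes "pathin X p" "pathin X q" "pathin X r" "p 1 = q 0" "q 1 = r 0"
  shows "path_homotopic X (path_join (path_join p q) r) (path_join p (path_join q r))"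
\<comment> \<open>On the left \<open>p\<close>, \<open>q\<close>, \<open>r\<close> occupy [0,1/4],
  [1/4,1/2], [1/2,1]; on the right [0,1/2], [1/2,3/4], [3/4,1]. \<open>\<phi>\<close> maps the
  former intervals linearly onto the latter.\<close>
proof (rule path_homotopic_convex[where S="{0..1}" and P="path_join p (path_join q r)" and \<psi>="\<lambda>t. t"
     and \<phi>="\<lambda>t. if t \<le> 1/4 then 2 * t else if t \<le> 1/2 then t + 1/4 else t / 2 + 1/2"])
  show "continuous_map unit_interval X (path_join p (path_join q r))"
    using assms by (auto simp flip: pathin_def intro!: pathin_join)
  show "continuous_on {0..1} (\<lambda>t. if t \<le> 1/4 then 2 * t else if t \<le> 1/2 then t + 1/4 else t / 2 + (1/2::real))"
    by (rule continuous_on_subset[OF continuous_on_piecewise3]) (auto intro!: continuous_intros)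
qed (auto simp: path_join_def field_simps intro: arg_cong[where f=r] arg_cong[where f=p] arg_cong[where f=q] assms)

lemma path_homotopic_rid:
  assumes "pathin X p" "p 1 = b" shows "path_homotopic X (path_join p (\<lambda>_. b)) p"
proof (rule path_homotopic_convex[where S="{0..1}" and P=p and \<psi>="\<lambda>t. t" and \<phi>="\<lambda>t. min 1 (2 * t)"])
  show "continuous_on {0..1} (\<lambda>t. min 1 (2 * t) :: real)" by (intro continuous_intros)
  show "path_join p (\<lambda>_. b) t = p (min 1 (2 * t))" for t
    using assms by (cases "t \<le> 1/2") (auto simp: path_join_def min_def intro: arg_cong[where f=p])
qed (use assms in \<open>auto simp: pathin_def\<close>)

lemma path_homotopic_lid:
  assumes "pathin X p" "p 0 = b" shows "path_homotopic X (path_join (\<lambda>_. b) p) p"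
proof (rule path_homotopic_convex[where S="{0..1}" and P=p and \<psi>="\<lambda>t. t" and \<phi>="\<lambda>t. max 0 (2 * t - 1)"])
  show "continuous_on {0..1} (\<lambda>t. max 0 (2 * t - 1) :: real)" by (intro continuous_intros)
  show "path_join (\<lambda>_. b) p t = p (max 0 (2 * t - 1))" for t
    using assms by (cases "t \<le> 1/2") (auto simp: path_join_def max_def intro: arg_cong[where f=p])
qed (use assms in \<open>auto simp: pathin_def\<close>)

lemma path_homotopic_rinv:
  assumes "pathin X p" "p 0 = b" shows "path_homotopic X (path_join p (path_rev p)) (\<lambda>_. b)"
\<comment> \<open>The parameter of \<open>p\<close> climbs to 1 and returns; shrinking this tent
  function linearly to 0 contracts the loop.\<close>
proof (rule path_homotopic_convex[where S="{0..1}" and P=p and \<psi>="\<lambda>t. 0" and \<phi>="\<lambda>t. min (2 * t) (2 - 2 * t)"])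
  show "continuous_on {0..1} (\<lambda>t. min (2 * t) (2 - 2 * t) :: real)" by (intro continuous_intros)
  show "path_join p (path_rev p) t = p (min (2 * t) (2 - 2 * t))" for t
    by (cases "t \<le> 1/2") (auto simp: path_join_def path_rev_def min_def intro: arg_cong[where f=p])
qed (use assms in \<open>auto simp: pathin_def min_def\<close>)

lemma path_homotopic_linv:
  assumes "pathin X p" "p 1 = b" shows "path_homotopic X (path_join (path_rev p) p) (\<lambda>_. b)"
  using path_homotopic_rinv[OF pathin_rev[OF assms(1)], of b] assms(2) by (simp add: path_rev_def)

section \<open>Homotopy classes of loops as a group\<close>

lemma in_path_class [simp]: "q \<in> path_class X p \<longleftrightarrow> path_homotopic X p q"
  by (auto simp: path_class_def dest: path_homotopic_imp_pathin)

lemma path_class_eqI: "path_homotopic X p q \<Longrightarrow> path_class X p = path_class X q"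
  unfolding set_eq_iff in_path_class by (meson path_homotopic_trans path_homotopic_sym)

text \<open>The assumption excludes functions that are not paths: all of these have the empty class
  without being homotopic to anything.\<close>

lemma path_class_eq_iff:
  "pathin X p \<Longrightarrow> path_class X p = path_class X q \<longleftrightarrow> path_homotopic X p q"
  by (metis in_path_class path_class_eqI path_homotopic_refl path_homotopic_sym)

lemma loops_atD: "p \<in> loops_at X b \<Longrightarrow> pathin X p" "p \<in> loops_at X b \<Longrightarrow> p 0 = b" "p \<in> loops_at X b \<Longrightarrow> p 1 = b"
  by (auto simp: loops_at_def)

lemma loops_at_join: "p \<in> loops_at X b \<Longrightarrow> q \<in> loops_at X b \<Longrightarrow> path_join p q \<in> loops_at X b"
  by (auto simp: loops_at_def pathin_join)

lemma loops_at_rev: "p \<in> loops_at X b \<Longrightarrow> path_rev p \<in> loops_at X b"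
  by (auto simp: loops_at_def pathin_rev)

lemma loops_at_const: "b \<in> topspace X \<Longrightarrow> (\<lambda>_. b) \<in> loops_at X b"
  by (auto simp: loops_at_def)

lemma carrier_fundamental_group: "carrier (fundamental_group X b) = path_class X ` loops_at X b"
  by (simp add: fundamental_group_def)

lemma fundamental_group_carrierE:
  assumes "A \<in> carrier (fundamental_group X b)"
  obtains p where "p \<in> loops_at X b" "A = path_class X p"
  using assms unfolding carrier_fundamental_group by blast

lemma path_class_in_carrier: "p \<in> loops_at X b \<Longrightarrow> path_class X p \<in> carrier (fundamental_group X b)"
  by (simp add: carrier_fundamental_group)

lemma one_fundamental_group: "\<one>\<^bsub>fundamental_group X b\<^esub> = path_class X (\<lambda>_. b)"
  by (simp add: fundamental_group_def)

text \<open>The product is defined as a union over all pairs of representatives. Joining respects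
  homotopy, so only one class occurs in that union.\<close>

lemma mult_fundamental_group:
  assumes "p \<in> loops_at X b" "q \<in> loops_at X b"
  shows "path_class X p \<otimes>\<^bsub>fundamental_group X b\<^esub> path_class X q = path_class X (path_join p q)"
proof -
  have "path_class X (path_join p' q') = path_class X (path_join p q)"
    if "path_homotopic X p p'" "path_homotopic X q q'" for p' q'
    by (rule path_class_eqI[symmetric], rule path_homotopic_join[OF that]) (use assms in \<open>auto simp: loops_at_def\<close>)
  moreover have "path_homotopic X p p" "path_homotopic X q q"
    using assms by (auto intro!: path_homotopic_refl dest: loops_atD)
  ultimately have "{path_class X (path_join p' q') | p' q'. p' \<in> path_class X p \<and> q' \<in> path_class X q}
      = {path_class X (path_join p q)}"
    unfolding in_path_class by blast
  then show ?thesis by (simp add: fundamental_group_def)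
qed

lemma path_class_linv:
  assumes "p \<in> loops_at X b"
  shows "path_class X (path_rev p) \<otimes>\<^bsub>fundamental_group X b\<^esub> path_class X p = \<one>\<^bsub>fundamental_group X b\<^esub>"
  unfolding mult_fundamental_group[OF loops_at_rev[OF assms] assms] one_fundamental_group
  by (intro path_class_eqI path_homotopic_linv loops_atD[OF assms])

lemma group_fundamental_group:
  assumes "b \<in> topspace X" shows "group (fundamental_group X b)"
proof (rule groupI)
  let ?G = "fundamental_group X b"
  fix x y z assume xyz: "x \<in> carrier ?G" "y \<in> carrier ?G" "z \<in> carrier ?G"
  obtain p q r where p: "p \<in> loops_at X b" "x = path_class X p" and q: "q \<in> loops_at X b" "y = path_class X q"
     and r: "r \<in> loops_at X b" "z = path_class X r"
    using xyz by (elim fundamental_group_carrierE)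
  note l = p(1) q(1) r(1)
  show "x \<otimes>\<^bsub>?G\<^esub> y \<otimes>\<^bsub>?G\<^esub> z = x \<otimes>\<^bsub>?G\<^esub> (y \<otimes>\<^bsub>?G\<^esub> z)"
    unfolding p(2) q(2) r(2) mult_fundamental_group[OF l(1,2)] mult_fundamental_group[OF l(2,3)]
      mult_fundamental_group[OF loops_at_join[OF l(1,2)] l(3)] mult_fundamental_group[OF l(1) loops_at_join[OF l(2,3)]]
    by (rule path_class_eqI, rule path_homotopic_assoc) (simp_all add: loops_atD[OF l(1)] loops_atD[OF l(2)] loops_atD[OF l(3)])
next
  let ?G = "fundamental_group X b"
  fix x y assume xy: "x \<in> carrier ?G" "y \<in> carrier ?G"
  obtain p q where p: "p \<in> loops_at X b" "x = path_class X p" and q: "q \<in> loops_at X b" "y = path_class X q"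
    using xy by (elim fundamental_group_carrierE)
  show "x \<otimes>\<^bsub>?G\<^esub> y \<in> carrier ?G"
    unfolding p(2) q(2) mult_fundamental_group[OF p(1) q(1)]
    by (intro path_class_in_carrier loops_at_join p q)
  show "\<one>\<^bsub>?G\<^esub> \<otimes>\<^bsub>?G\<^esub> x = x"
    unfolding p(2) one_fundamental_group mult_fundamental_group[OF loops_at_const[OF assms] p(1)]
    by (intro path_class_eqI path_homotopic_lid loops_atD[OF p(1)])
  show "\<exists>y\<in>carrier ?G. y \<otimes>\<^bsub>?G\<^esub> x = \<one>\<^bsub>?G\<^esub>"
    unfolding p(2) by (rule bexI, rule path_class_linv[OF p(1)]) (intro path_class_in_carrier loops_at_rev p)
qed (simp add: one_fundamental_group path_class_in_carrier loops_at_const assms)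

section \<open>Conjugation by paths and change of base point\<close>

lemma path_homotopic_cancel_left:
  assumes "pathin X \<tau>" "pathin X p" "\<tau> 1 = p 0"
  shows "path_homotopic X (path_join (path_rev \<tau>) (path_join \<tau> p)) p"
proof -
  have "path_homotopic X (path_join (path_rev \<tau>) (path_join \<tau> p)) (path_join (path_join (path_rev \<tau>) \<tau>) p)"
    by (rule path_homotopic_sym, rule path_homotopic_assoc) (use assms in \<open>auto simp: pathin_rev\<close>)
  also have "path_homotopic X (path_join (path_join (path_rev \<tau>) \<tau>) p) (path_join (\<lambda>_. p 0) p)"
    by (intro path_homotopic_join path_homotopic_linv path_homotopic_refl) (use assms in auto)
  also have "path_homotopic X (path_join (\<lambda>_. p 0) p) p"
    by (rule path_homotopic_lid) (use assms in auto)
  finally show ?thesis .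
qed

lemma path_homotopic_cancel_right:
  assumes "pathin X \<tau>" "pathin X p" "p 1 = \<tau> 1"
  shows "path_homotopic X (path_join (path_join p (path_rev \<tau>)) \<tau>) p"
proof -
  have "path_homotopic X (path_join (path_join p (path_rev \<tau>)) \<tau>) (path_join p (path_join (path_rev \<tau>) \<tau>))"
    by (rule path_homotopic_assoc) (use assms in \<open>auto simp: pathin_rev\<close>)
  also have "path_homotopic X (path_join p (path_join (path_rev \<tau>) \<tau>)) (path_join p (\<lambda>_. p 1))"
    by (intro path_homotopic_join path_homotopic_linv path_homotopic_refl) (use assms in auto)
  also have "path_homotopic X (path_join p (\<lambda>_. p 1)) p"
    by (rule path_homotopic_rid) (use assms in auto)
  finally show ?thesis .
qed

lemma path_rev_rev [simp]: "path_rev (path_rev p) = p"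
  by (simp add: path_rev_def)

lemma path_homotopic_join_cancel_middle:
  assumes "pathin X p" "pathin X \<tau>" "pathin X q" "p 1 = \<tau> 1" "q 0 = \<tau> 1"
  shows "path_homotopic X (path_join (path_join p (path_rev \<tau>)) (path_join \<tau> q)) (path_join p q)"
proof -
  have "path_homotopic X (path_join (path_join p (path_rev \<tau>)) (path_join \<tau> q))
     (path_join p (path_join (path_rev \<tau>) (path_join \<tau> q)))"
    by (rule path_homotopic_assoc) (use assms in \<open>auto simp: pathin_rev pathin_join\<close>)
  also have "path_homotopic X \<dots> (path_join p q)"
    by (intro path_homotopic_join path_homotopic_cancel_left path_homotopic_refl) (use assms in auto)
  finally show ?thesis .
qed

text \<open>Two separate legs are allowed so that a path with different ends can be closed up to a
  loop; equal legs give the usual change of base point.\<close>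

definition path_conj :: "(real \<Rightarrow> 'a) \<Rightarrow> (real \<Rightarrow> 'a) \<Rightarrow> (real \<Rightarrow> 'a) \<Rightarrow> real \<Rightarrow> 'a" where
  "path_conj \<tau> p \<upsilon> = path_join (path_join \<tau> p) (path_rev \<upsilon>)"

lemma path_conj_ends [simp]: "path_conj \<tau> p \<upsilon> 0 = \<tau> 0" "path_conj \<tau> p \<upsilon> 1 = \<upsilon> 0"
  by (auto simp: path_conj_def)

lemma pathin_conj:
  "pathin X \<tau> \<Longrightarrow> pathin X p \<Longrightarrow> pathin X \<upsilon> \<Longrightarrow> \<tau> 1 = p 0 \<Longrightarrow> p 1 = \<upsilon> 1 \<Longrightarrow> pathin X (path_conj \<tau> p \<upsilon>)"
  by (auto simp: path_conj_def intro!: pathin_join pathin_rev)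

lemma path_homotopic_conj:
  "pathin X \<tau> \<Longrightarrow> path_homotopic X p q \<Longrightarrow> pathin X \<upsilon> \<Longrightarrow> \<tau> 1 = p 0 \<Longrightarrow> p 1 = \<upsilon> 1
    \<Longrightarrow> path_homotopic X (path_conj \<tau> p \<upsilon>) (path_conj \<tau> q \<upsilon>)"
  by (auto simp: path_conj_def intro!: path_homotopic_join path_homotopic_refl pathin_rev)

text \<open>The leg \<open>\<upsilon>\<close> is run backwards and then forwards in the middle and
  cancels. This gives multiplicativity both for the change of base point and for closing up paths
  with chosen legs.\<close>

lemma path_homotopic_conj_join:
  assumes "pathin X \<tau>" "pathin X \<upsilon>" "pathin X \<omega>" "pathin X p" "pathin X q"
     "\<tau> 1 = p 0" "p 1 = \<upsilon> 1" "\<upsilon> 1 = q 0" "q 1 = \<omega> 1"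
  shows "path_homotopic X (path_join (path_conj \<tau> p \<upsilon>) (path_conj \<upsilon> q \<omega>)) (path_conj \<tau> (path_join p q) \<omega>)"
proof -
  have "path_homotopic X (path_conj \<upsilon> q \<omega>) (path_join \<upsilon> (path_join q (path_rev \<omega>)))"
    unfolding path_conj_def by (rule path_homotopic_assoc) (use assms in \<open>auto simp: pathin_rev\<close>)
  then have "path_homotopic X (path_join (path_conj \<tau> p \<upsilon>) (path_conj \<upsilon> q \<omega>))
     (path_join (path_conj \<tau> p \<upsilon>) (path_join \<upsilon> (path_join q (path_rev \<omega>))))"
    by (intro path_homotopic_join path_homotopic_refl pathin_conj) (use assms in auto)
  also have "path_homotopic X \<dots> (path_join (path_join \<tau> p) (path_join q (path_rev \<omega>)))"
    unfolding path_conj_def by (rule path_homotopic_join_cancel_middle)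
       (use assms in \<open>auto intro!: pathin_join pathin_rev\<close>)
  also have "path_homotopic X \<dots> (path_join (path_join (path_join \<tau> p) q) (path_rev \<omega>))"
    by (rule path_homotopic_sym, rule path_homotopic_assoc) (use assms in \<open>auto intro!: pathin_join pathin_rev\<close>)
  also have "path_homotopic X \<dots> (path_conj \<tau> (path_join p q) \<omega>)"
    unfolding path_conj_def
    by (intro path_homotopic_join path_homotopic_assoc path_homotopic_refl) (use assms in \<open>auto intro!: pathin_rev\<close>)
  finally show ?thesis .
qed

lemma path_homotopic_conj_conj:
  assumes "pathin X \<tau>" "pathin X p" "\<tau> 1 = p 0" "p 1 = \<tau> 1"
  shows "path_homotopic X (path_conj (path_rev \<tau>) (path_conj \<tau> p \<tau>) (path_rev \<tau>)) p"
proof -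
  let ?r = "path_rev \<tau>"
  have "path_homotopic X (path_join ?r (path_conj \<tau> p \<tau>)) (path_join (path_join ?r (path_join \<tau> p)) ?r)"
    unfolding path_conj_def by (rule path_homotopic_sym, rule path_homotopic_assoc) (use assms in \<open>auto intro!: pathin_rev pathin_join\<close>)
  also have "path_homotopic X \<dots> (path_join p ?r)"
    by (intro path_homotopic_join path_homotopic_cancel_left path_homotopic_refl) (use assms in \<open>auto intro!: pathin_rev\<close>)
  finally have "path_homotopic X (path_conj ?r (path_conj \<tau> p \<tau>) ?r) (path_join (path_join p ?r) \<tau>)"
    unfolding path_conj_def[of "path_rev \<tau>"] path_rev_rev
    by (rule path_homotopic_join[OF _ path_homotopic_refl]) (use assms in auto)
  also have "path_homotopic X \<dots> p"
    by (rule path_homotopic_cancel_right) (use assms in auto)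
  finally show ?thesis .
qed

text \<open>Conjugation by the reversed path is the inverse. Therefore \<open>h\<close> and its
  properties are stated for all \<open>\<tau>\<close>: used for \<open>\<tau>\<close> and for
  \<open>path_rev \<tau>\<close>, the fact \<open>hh\<close> yields both halves of the
  bijection.\<close>

lemma fundamental_group_base_change:
  assumes t: "pathin X \<tau>"
  shows "fundamental_group X (\<tau> 1) \<cong> fundamental_group X (\<tau> 0)"
proof -
  define h where "h \<tau> A = path_class X (path_conj \<tau> (SOME p. A = path_class X p \<and> pathin X p) \<tau>)" for \<tau> A
  have h: "h \<tau> (path_class X p) = path_class X (path_conj \<tau> p \<tau>)"
    if "p \<in> loops_at X (\<tau> 1)" "pathin X \<tau>" for p \<tau>
  proof -
    have p: "pathin X p" "p 0 = \<tau> 1" "p 1 = \<tau> 1" using that by (auto simp: loops_at_def)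
    let ?q = "SOME q. path_class X p = path_class X q \<and> pathin X q"
    have "path_class X p = path_class X ?q \<and> pathin X ?q" by (rule someI[of _ p]) (use p in auto)
    then have "path_homotopic X p ?q" using path_class_eq_iff p(1) by blast
    then show ?thesis unfolding h_def
      by (intro path_class_eqI path_homotopic_sym[OF path_homotopic_conj]) (use p that in auto)
  qed
  have cl: "path_conj \<tau> p \<tau> \<in> loops_at X (\<tau> 0)" if "p \<in> loops_at X (\<tau> 1)" "pathin X \<tau>" for p \<tau>
    using that by (auto simp: loops_at_def pathin_conj)
  have hh: "h (path_rev \<tau>) (h \<tau> A) = A" if A: "A \<in> carrier (fundamental_group X (\<tau> 1))" and t: "pathin X \<tau>" for A \<tau>
  proof -
    obtain p where p: "p \<in> loops_at X (\<tau> 1)" "A = path_class X p"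
      by (rule fundamental_group_carrierE[OF A])
    have "h (path_rev \<tau>) (h \<tau> A) = path_class X (path_conj (path_rev \<tau>) (path_conj \<tau> p \<tau>) (path_rev \<tau>))"
      using p t cl by (simp add: h pathin_rev)
    also have "\<dots> = A" unfolding p(2)
      by (rule path_class_eqI, rule path_homotopic_conj_conj) (use p t in \<open>auto simp: loops_at_def\<close>)
    finally show ?thesis .
  qed
  have hc: "h \<tau> A \<in> carrier (fundamental_group X (\<tau> 0))" if "A \<in> carrier (fundamental_group X (\<tau> 1))" "pathin X \<tau>" for A \<tau>
    using that cl by (auto simp: carrier_fundamental_group h)
  have "h \<tau> \<in> iso (fundamental_group X (\<tau> 1)) (fundamental_group X (\<tau> 0))"
  proof (rule isoI)
    show "h \<tau> \<in> hom (fundamental_group X (\<tau> 1)) (fundamental_group X (\<tau> 0))"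
    proof (rule homI)
      fix A B assume "A \<in> carrier (fundamental_group X (\<tau> 1))" "B \<in> carrier (fundamental_group X (\<tau> 1))"
      then obtain p q where *: "A = path_class X p" "B = path_class X q" "p \<in> loops_at X (\<tau> 1)" "q \<in> loops_at X (\<tau> 1)"
        by (elim fundamental_group_carrierE)
      show "h \<tau> (A \<otimes>\<^bsub>fundamental_group X (\<tau> 1)\<^esub> B) = h \<tau> A \<otimes>\<^bsub>fundamental_group X (\<tau> 0)\<^esub> h \<tau> B"
        unfolding *(1,2) mult_fundamental_group[OF *(3,4)] h[OF *(3) t] h[OF *(4) t] h[OF loops_at_join[OF *(3,4)] t]
          mult_fundamental_group[OF cl[OF *(3) t] cl[OF *(4) t]]
        by (rule path_class_eqI, rule path_homotopic_sym, rule path_homotopic_conj_join)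
           (simp_all add: t loops_atD[OF *(3)] loops_atD[OF *(4)])
    qed (use hc t in auto)
    have "bij_betw (h \<tau>) (carrier (fundamental_group X (\<tau> 1))) (carrier (fundamental_group X (\<tau> 0)))"
      by (rule bij_betwI[where g="h (path_rev \<tau>)"])
         (use hc[of _ \<tau>] hc[of _ "path_rev \<tau>"] hh[of _ \<tau>] hh[of _ "path_rev \<tau>"] t in \<open>auto simp: pathin_rev\<close>)
    then show "bij_betw (h \<tau>) (carrier (fundamental_group X (\<tau> 1))) (carrier (fundamental_group X (\<tau> 0)))" .
  qed
  then show ?thesis by (auto simp: is_iso_def)
qed

section \<open>Singular one-chains\<close>

text \<open>Members of \<open>sing1\<close> are extensional, whereas paths are arbitrary total
  functions; restriction makes chains depend only on the values on the interval.\<close>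

definition path_chain :: "(real \<Rightarrow> 'a) \<Rightarrow> (real \<Rightarrow> 'a) \<Rightarrow>\<^sub>0 int" where
  "path_chain p = frag_of (restrict p {0..1})"

lemma path_chain_cong: "(\<And>t. 0 \<le> t \<Longrightarrow> t \<le> 1 \<Longrightarrow> p t = q t) \<Longrightarrow> path_chain p = path_chain q"
  unfolding path_chain_def by (rule arg_cong[where f=frag_of]) auto

lemma restrict_in_sing1: "pathin X p \<Longrightarrow> restrict p {0..1} \<in> sing1 X"
  unfolding sing1_def pathin_def by (auto intro: continuous_map_cong)

lemma sing1_eq_path_chain: "\<sigma> \<in> sing1 X \<Longrightarrow> frag_of \<sigma> = path_chain \<sigma>"
  by (auto simp: sing1_def path_chain_def extensional_restrict)

lemma path_chain_carrier: "pathin X p \<Longrightarrow> path_chain p \<in> carrier (free_Abelian_group (sing1 X))"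
  by (auto simp: path_chain_def restrict_in_sing1)

lemma bd1_path_chain [simp]: "bd1 (path_chain p) = frag_of (p 1) - frag_of (p 0)"
  by (simp add: bd1_def path_chain_def)

lemma bd1_simps [simp]: "bd1 0 = 0" "bd1 (c + d) = bd1 c + bd1 d" "bd1 (c - d) = bd1 c - bd1 d" "bd1 (- c) = - bd1 c"
  by (simp_all add: bd1_def frag_extend_add frag_extend_diff frag_extend_minus)

lemma bd2_simps [simp]: "bd2 0 = 0" "bd2 (c + d) = bd2 c + bd2 d" "bd2 (c - d) = bd2 c - bd2 d" "bd2 (- c) = - bd2 c"
  by (simp_all add: bd2_def frag_extend_add frag_extend_diff frag_extend_minus)

lemma boundaries1_zero [simp]: "0 \<in> boundaries1 X"
  unfolding boundaries1_def by (rule image_eqI[where x=0]) auto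

lemma boundaries1_add: "c \<in> boundaries1 X \<Longrightarrow> d \<in> boundaries1 X \<Longrightarrow> c + d \<in> boundaries1 X"
  unfolding boundaries1_def by clarify (rule image_eqI[where x="x + y" for x y], auto dest: subsetD[OF keys_add])

lemma boundaries1_uminus: "c \<in> boundaries1 X \<Longrightarrow> - c \<in> boundaries1 X"
  unfolding boundaries1_def by clarify (rule image_eqI[where x="- x" for x], auto)

lemma boundaries1_diff: "c \<in> boundaries1 X \<Longrightarrow> d \<in> boundaries1 X \<Longrightarrow> c - d \<in> boundaries1 X"
  using boundaries1_add[OF _ boundaries1_uminus] by fastforce

lemma boundaries1_sum: "(\<And>i. i \<in> I \<Longrightarrow> f i \<in> boundaries1 X) \<Longrightarrow> sum f I \<in> boundaries1 X"
  by (induction I rule: infinite_finite_induct) (auto intro: boundaries1_add)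

text \<open>The affine 2-simplex with vertices \<open>a\<close>, \<open>b\<close>, \<open>c\<close>,
  pushed forward by \<open>P\<close>. It is the source of the homology relations that follow:
  constants are degenerate triangles, a square is two triangles, and a join is the triangle with
  vertices 0, 1/2, 1 in the interval.\<close>

lemma boundaries1_triangle:
  fixes S :: "'c::real_normed_vector set"
  assumes P: "continuous_map (top_of_set S) X P" and S: "convex S" "a \<in> S" "b \<in> S" "c \<in> S"
  shows "path_chain (\<lambda>t. P (linepath a b t)) + path_chain (\<lambda>t. P (linepath b c t))
       - path_chain (\<lambda>t. P (linepath a c t)) \<in> boundaries1 X"
proof -
  define g where "g z = (1 - fst z - snd z) *\<^sub>R a + fst z *\<^sub>R b + snd z *\<^sub>R c" for z :: "real \<times> real"
  define \<sigma> where "\<sigma> = restrict (\<lambda>z. P (g z)) std_simplex2"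
  have "continuous_map (top_of_set std_simplex2) X (\<lambda>z. P (g z))"
  proof (rule continuous_map_compose_on[OF P])
    show "continuous_on std_simplex2 g" unfolding g_def by (intro continuous_intros)
    have "u *\<^sub>R a + v *\<^sub>R b + w *\<^sub>R c \<in> S" if "u \<ge> 0" "v \<ge> 0" "w \<ge> 0" "u + v + w = 1" for u v w
    proof -
      have "u *\<^sub>R a + v *\<^sub>R b + w *\<^sub>R c \<in> convex hull {a, b, c}"
        unfolding convex_hull_3 using that by blast
      moreover have "convex hull {a, b, c} \<subseteq> S"
        by (intro hull_minimal) (use S in auto)
      ultimately show ?thesis by blast
    qed
    then show "g \<in> std_simplex2 \<rightarrow> S" unfolding g_def std_simplex2_def by auto
  qed
  then have "\<sigma> \<in> sing2 X" unfolding \<sigma>_def sing2_def by (auto intro: continuous_map_cong)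
  then have "bd2 (frag_of \<sigma>) \<in> boundaries1 X" unfolding boundaries1_def by (auto intro!: imageI)
  moreover have "frag_of (face2 0 \<sigma>) = path_chain (\<lambda>t. P (linepath b c t))"
    unfolding face2_def path_chain_def \<sigma>_def
    by (rule arg_cong[where f=frag_of]) (auto simp: fun_eq_iff std_simplex2_def g_def linepath_def)
  moreover have "frag_of (face2 1 \<sigma>) = path_chain (\<lambda>t. P (linepath a c t))"
    unfolding face2_def path_chain_def \<sigma>_def
    by (rule arg_cong[where f=frag_of]) (auto simp: fun_eq_iff std_simplex2_def g_def linepath_def)
  moreover have "frag_of (face2 2 \<sigma>) = path_chain (\<lambda>t. P (linepath a b t))"
    unfolding face2_def path_chain_def \<sigma>_def
    by (rule arg_cong[where f=frag_of]) (auto simp: fun_eq_iff std_simplex2_def g_def linepath_def)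
  ultimately show ?thesis by (simp add: bd2_def algebra_simps)
qed

text \<open>All three edges of the degenerate triangle are the same constant simplex c, and c + c -
  c = c.\<close>

lemma boundaries1_const: "a \<in> topspace X \<Longrightarrow> path_chain (\<lambda>_. a) \<in> boundaries1 X"
  using boundaries1_triangle[of "{0::real}" X "\<lambda>_. a" 0 0 0] by simp

text \<open>The diagonal cuts the square into two triangles; it cancels in the difference of their
  boundaries.\<close>

lemma boundaries1_square:
  assumes h: "continuous_map unit_square X h"
  shows "path_chain (\<lambda>t. h (t, 0)) + path_chain (\<lambda>t. h (1, t)) - path_chain (\<lambda>t. h (0, t)) - path_chain (\<lambda>t. h (t, 1))
    \<in> boundaries1 X"
proof -
  note T = boundaries1_triangle[OF h[unfolded prod_top_of_set]]
  have "convex ({0..1} \<times> {0..1} :: (real \<times> real) set)" by (intro convex_Times) auto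
  from boundaries1_diff[OF T[OF this, of "(0,0)" "(1,0)" "(1,1)"] T[OF this, of "(0,0)" "(0,1)" "(1,1)"]]
  show ?thesis by (simp add: linepath_def algebra_simps)
qed

lemma path_homotopic_imp_homologous:
  assumes "path_homotopic X p q" shows "path_chain p - path_chain q \<in> boundaries1 X"
proof -
  obtain h where h: "continuous_map unit_square X h"
    and e: "\<forall>s\<in>{0..1}. h (0, s) = p s \<and> h (1, s) = q s" "\<forall>t\<in>{0..1}. h (t, 0) = p 0 \<and> h (t, 1) = p 1"
    using assms unfolding path_homotopic_def by blast
  have "path_chain (\<lambda>t. h (t, 0)) = path_chain (\<lambda>_. p 0)" "path_chain (\<lambda>t. h (t, 1)) = path_chain (\<lambda>_. p 1)"
    "path_chain (\<lambda>t. h (0, t)) = path_chain p" "path_chain (\<lambda>t. h (1, t)) = path_chain q"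
    using e by (auto intro!: path_chain_cong)
  with boundaries1_square[OF h] have sq: "path_chain (\<lambda>_. p 0) + path_chain q - path_chain p - path_chain (\<lambda>_. p 1) \<in> boundaries1 X"
    by simp
  have c: "path_chain (\<lambda>_. p 0) \<in> boundaries1 X" "path_chain (\<lambda>_. p 1) \<in> boundaries1 X"
    using path_homotopic_imp_pathin(1)[OF assms]
    by (intro boundaries1_const; metis path_start_in_topspace path_finish_in_topspace)+
  from boundaries1_diff[OF boundaries1_diff[OF c(1) sq] c(2)] show ?thesis by (simp add: algebra_simps)
qed

lemma path_chain_join:
  assumes "pathin X p" "pathin X q" "p 1 = q 0"
  shows "path_chain p + path_chain q - path_chain (path_join p q) \<in> boundaries1 X"
proof -
  have "path_chain (\<lambda>t. path_join p q (linepath 0 (1/2) t)) = path_chain p"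
    by (rule path_chain_cong) (auto simp: path_join_def linepath_def)
  moreover have "path_chain (\<lambda>t. path_join p q (linepath (1/2) 1 t)) = path_chain q"
  proof (rule path_chain_cong)
    fix t :: real assume t: "0 \<le> t" "t \<le> 1"
    have "linepath (1/2) 1 t = (1 + t) / 2" by (simp add: linepath_def field_simps)
    moreover have "2 * ((1 + t) / 2) - 1 = t" by (simp add: field_simps)
    \<comment> \<open>At \<open>t = 0\<close> the join is evaluated at 1/2 and still follows
      \<open>p\<close>, so this point needs the assumption that \<open>p\<close> ends where
      \<open>q\<close> starts.\<close>
    ultimately show "path_join p q (linepath (1/2) 1 t) = q t"
      using assms(3) t by (cases "t = 0") (simp_all only: path_join_def, simp_all)
  qed
  moreover have "path_chain (\<lambda>t. path_join p q (linepath 0 1 t)) = path_chain (path_join p q)"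
    by (rule path_chain_cong) (auto simp: linepath_def)
  ultimately show ?thesis
    using boundaries1_triangle[OF pathin_join[OF assms, unfolded pathin_def], of 0 "1/2" 1] by simp
qed

lemma path_chain_rev:
  assumes "pathin X p" shows "path_chain p + path_chain (path_rev p) \<in> boundaries1 X"
proof -
  have "path_chain p + path_chain (path_rev p) - path_chain (path_join p (path_rev p)) \<in> boundaries1 X"
    by (rule path_chain_join) (use assms in \<open>auto simp: pathin_rev\<close>)
  moreover have "path_chain (path_join p (path_rev p)) - path_chain (\<lambda>_. p 0) \<in> boundaries1 X"
    by (rule path_homotopic_imp_homologous[OF path_homotopic_rinv]) (use assms in auto)
  moreover have "path_chain (\<lambda>_. p 0) \<in> boundaries1 X"
    by (intro boundaries1_const path_start_in_topspace assms)
  ultimately have "(path_chain p + path_chain (path_rev p) - path_chain (path_join p (path_rev p))) +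
     ((path_chain (path_join p (path_rev p)) - path_chain (\<lambda>_. p 0)) + path_chain (\<lambda>_. p 0)) \<in> boundaries1 X"
    by (intro boundaries1_add)
  then show ?thesis by simp
qed


lemma homologous_trans:
  "c - d \<in> boundaries1 X \<Longrightarrow> d - e \<in> boundaries1 X \<Longrightarrow> c - e \<in> boundaries1 X"
  using boundaries1_add by fastforce

lemma homologous_sym: "c - d \<in> boundaries1 X \<Longrightarrow> d - c \<in> boundaries1 X"
  using boundaries1_uminus by fastforce

section \<open>First homology as a group of cosets\<close>

abbreviation "cycle_group X \<equiv> (free_Abelian_group (sing1 X)) \<lparr>carrier := cycles1 X\<rparr>"

definition h1_class :: "'a topology \<Rightarrow> ((real \<Rightarrow> 'a) \<Rightarrow>\<^sub>0 int) \<Rightarrow> ((real \<Rightarrow> 'a) \<Rightarrow>\<^sub>0 int) set" where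
  "h1_class X c = boundaries1 X #>\<^bsub>cycle_group X\<^esub> c"

lemma mem_h1_class: "d \<in> h1_class X c \<longleftrightarrow> d - c \<in> boundaries1 X"
proof -
  have "d = (d - c) + c" by simp
  then show ?thesis unfolding h1_class_def r_coset_def by (auto intro!: bexI[where x="d - c"])
qed

lemma h1_class_eq_iff: "h1_class X c = h1_class X d \<longleftrightarrow> c - d \<in> boundaries1 X"
proof
  assume "h1_class X c = h1_class X d"
  then show "c - d \<in> boundaries1 X" using mem_h1_class[of c X c] mem_h1_class[of c X d] by simp
next
  assume "c - d \<in> boundaries1 X"
  then show "h1_class X c = h1_class X d"
    unfolding set_eq_iff mem_h1_class using homologous_trans homologous_sym by blast
qed

lemma bd1_bd2: "bd1 (bd2 c) = 0"
proof (rule frag_induction[of c UNIV])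
  fix \<sigma> :: "real \<times> real \<Rightarrow> 'a"
  have *: "bd1 (frag_of (restrict f {0..1})) = frag_of (f 1) - frag_of (f 0)" for f :: "real \<Rightarrow> 'a"
    using bd1_path_chain[of f] by (simp add: path_chain_def)
  show "bd1 (bd2 (frag_of \<sigma>)) = 0" by (simp add: bd2_def face2_def *)
qed auto

lemma face2_in_sing1:
  assumes "\<sigma> \<in> sing2 X" shows "face2 i \<sigma> \<in> sing1 X"
proof -
  let ?g = "\<lambda>t::real. if i = 0 then (1 - t, t) else if i = 1 then (0, t) else (t, 0)"
  have s: "continuous_map (top_of_set std_simplex2) X \<sigma>" using assms by (simp add: sing2_def)
  have "continuous_on {0..1} ?g"
    by (cases "i = 0"; cases "i = 1") (auto intro!: continuous_intros)
  moreover have "?g \<in> {0..1} \<rightarrow> std_simplex2" by (auto simp: std_simplex2_def)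
  ultimately have "pathin X (\<lambda>t. \<sigma> (?g t))"
    unfolding pathin_def by (rule continuous_map_compose_on[OF s])
  from restrict_in_sing1[OF this] show ?thesis by (simp add: face2_def)
qed

lemma boundaries1_subset_cycles1: "boundaries1 X \<subseteq> cycles1 X"
proof -
  have "bd2 c \<in> carrier (free_Abelian_group (sing1 X))" if "c \<in> carrier (free_Abelian_group (sing2 X))" for c
  proof (rule frag_induction[of c "sing2 X"])
    show "Poly_Mapping.keys c \<subseteq> sing2 X" using that by simp
    show "bd2 (a - b) \<in> carrier (free_Abelian_group (sing1 X))"
      if "bd2 a \<in> carrier (free_Abelian_group (sing1 X))" "bd2 b \<in> carrier (free_Abelian_group (sing1 X))" for a b :: "(real \<times> real \<Rightarrow> 'a) \<Rightarrow>\<^sub>0 int"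
      using that keys_diff[of "bd2 a" "bd2 b"] by auto
    show "bd2 (frag_of \<sigma>) \<in> carrier (free_Abelian_group (sing1 X))" if "\<sigma> \<in> sing2 X" for \<sigma>
      using face2_in_sing1[OF that] keys_diff[of "frag_of (face2 0 \<sigma>)" "frag_of (face2 1 \<sigma>)"]
        keys_add[of "frag_of (face2 0 \<sigma>) - frag_of (face2 1 \<sigma>)" "frag_of (face2 2 \<sigma>)"]
      by (auto simp: bd2_def)
  qed auto
  then show ?thesis unfolding boundaries1_def cycles1_def using bd1_bd2 by blast
qed

lemma subgroup_cycles1: "subgroup (cycles1 X) (free_Abelian_group (sing1 X))"
  by (rule group.subgroupI) (auto simp: cycles1_def keys_minus dest: subsetD[OF keys_add])

lemma comm_group_cycle_group: "comm_group (cycle_group X)"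
  by (rule group.group_comm_groupI[OF subgroup.subgroup_is_group[OF subgroup_cycles1]]) auto

lemma subgroup_boundaries1: "subgroup (boundaries1 X) (cycle_group X)"
proof (rule group.subgroupI)
  show "group (cycle_group X)" using comm_group_cycle_group comm_group.axioms by blast
  show "boundaries1 X \<noteq> {}" using boundaries1_zero by blast
  show "inv\<^bsub>cycle_group X\<^esub> a \<in> boundaries1 X" if a: "a \<in> boundaries1 X" for a
  proof -
    have "inv\<^bsub>cycle_group X\<^esub> a = - a"
      by (rule group.inv_equality[OF \<open>group (cycle_group X)\<close>])
         (use boundaries1_subset_cycles1 boundaries1_uminus[OF a] a in auto)
    then show ?thesis using boundaries1_uminus[OF a] by simp
  qed
qed (use boundaries1_subset_cycles1 boundaries1_add in auto)

lemma normal_boundaries1: "boundaries1 X \<lhd> cycle_group X"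
  by (rule comm_group.subgroup_imp_normal[OF comm_group_cycle_group subgroup_boundaries1])

lemma comm_group_H1: "comm_group (H1 X)"
  unfolding H1_def by (rule comm_group.abelian_FactGroup[OF comm_group_cycle_group subgroup_boundaries1])

lemma carrier_H1: "carrier (H1 X) = h1_class X ` cycles1 X"
  by (auto simp: H1_def FactGroup_def RCOSETS_def h1_class_def)

lemma mult_H1: "c \<in> cycles1 X \<Longrightarrow> d \<in> cycles1 X \<Longrightarrow> h1_class X c \<otimes>\<^bsub>H1 X\<^esub> h1_class X d = h1_class X (c + d)"
  using normal.rcos_sum[OF normal_boundaries1, of c X d] by (simp add: H1_def FactGroup_def h1_class_def)

lemma one_H1: "\<one>\<^bsub>H1 X\<^esub> = h1_class X 0"
  by (auto simp: H1_def FactGroup_def set_eq_iff mem_h1_class)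

lemma path_chain_cycle: "p \<in> loops_at X b \<Longrightarrow> path_chain p \<in> cycles1 X"
  unfolding cycles1_def using path_chain_carrier by (auto simp: loops_at_def)

lemma cycles1_sum: "(\<And>i. i \<in> I \<Longrightarrow> f i \<in> cycles1 X) \<Longrightarrow> sum f I \<in> cycles1 X"
  by (induction I rule: infinite_finite_induct)
     (use subgroup.m_closed[OF subgroup_cycles1] subgroup.one_closed[OF subgroup_cycles1] in auto)

section \<open>The Hurewicz homomorphism in degree one\<close>

lemma homologous_conj:
  assumes "pathin X \<tau>" "pathin X p" "pathin X \<upsilon>" "\<tau> 1 = p 0" "p 1 = \<upsilon> 1"
  shows "path_chain (path_conj \<tau> p \<upsilon>) - (path_chain \<tau> + path_chain p - path_chain \<upsilon>) \<in> boundaries1 X"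
proof -
  have "path_chain \<tau> + path_chain p - path_chain (path_join \<tau> p) \<in> boundaries1 X"
    by (rule path_chain_join) (use assms in auto)
  moreover have "path_chain (path_join \<tau> p) + path_chain (path_rev \<upsilon>) - path_chain (path_conj \<tau> p \<upsilon>) \<in> boundaries1 X"
    unfolding path_conj_def by (rule path_chain_join) (use assms in \<open>auto intro: pathin_join pathin_rev\<close>)
  moreover have "path_chain \<upsilon> + path_chain (path_rev \<upsilon>) \<in> boundaries1 X"
    by (rule path_chain_rev) (use assms in auto)
  ultimately have "(path_chain \<upsilon> + path_chain (path_rev \<upsilon>)) - (path_chain (path_join \<tau> p) + path_chain (path_rev \<upsilon>) - path_chain (path_conj \<tau> p \<upsilon>))
      - (path_chain \<tau> + path_chain p - path_chain (path_join \<tau> p)) \<in> boundaries1 X"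
    using boundaries1_diff by blast
  then show ?thesis by (simp add: algebra_simps)
qed

text \<open>Surjectivity of the Hurewicz map. Induction over chains passes through chains that are
  not cycles; the correction \<open>L (bd1 c)\<close>, made of chosen paths from \<open>x0\<close>
  to the ends, turns any chain into a loop modulo boundaries and vanishes for a cycle.\<close>

lemma cycle_homologous_loop:
  assumes X: "path_connected_space X" and x0: "x0 \<in> topspace X" and c: "c \<in> cycles1 X"
  obtains p where "p \<in> loops_at X x0" "c - path_chain p \<in> boundaries1 X"
proof -
  have "\<forall>x\<in>topspace X. \<exists>l. pathin X l \<and> l 0 = x0 \<and> l 1 = x"
    using X x0 unfolding path_connected_space_def by blast
  then obtain l where l: "\<And>x. x \<in> topspace X \<Longrightarrow> pathin X (l x) \<and> l x 0 = x0 \<and> l x 1 = x" by metis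
  define L where "L = frag_extend (\<lambda>x. path_chain (l x))"
  have L: "L (c - d) = L c - L d" for c d by (simp add: L_def frag_extend_diff)
  have Lf [simp]: "L (frag_of x) = path_chain (l x)" for x by (simp add: L_def)
  have "\<exists>p\<in>loops_at X x0. c - L (bd1 c) - path_chain p \<in> boundaries1 X"
  proof (rule frag_induction[of c "sing1 X"])
    show "Poly_Mapping.keys c \<subseteq> sing1 X" using c by (auto simp: cycles1_def)
    show "\<exists>p\<in>loops_at X x0. 0 - L (bd1 0) - path_chain p \<in> boundaries1 X"
      by (rule bexI[where x="\<lambda>_. x0"]) (use boundaries1_uminus[OF boundaries1_const[OF x0]] loops_at_const[OF x0] in \<open>auto simp: L_def\<close>)
    show "\<exists>p\<in>loops_at X x0. frag_of \<sigma> - L (bd1 (frag_of \<sigma>)) - path_chain p \<in> boundaries1 X"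
      if s: "\<sigma> \<in> sing1 X" for \<sigma>
    proof -
      have p: "pathin X \<sigma>" using s by (auto simp: sing1_def)
      have e: "\<sigma> 0 \<in> topspace X" "\<sigma> 1 \<in> topspace X" using p by (auto simp: path_start_in_topspace path_finish_in_topspace)
      have "path_chain (path_conj (l (\<sigma> 0)) \<sigma> (l (\<sigma> 1))) - (path_chain (l (\<sigma> 0)) + path_chain \<sigma> - path_chain (l (\<sigma> 1))) \<in> boundaries1 X"
        by (rule homologous_conj) (use l e p in auto)
      from homologous_sym[OF this] show ?thesis
        by (intro bexI[where x="path_conj (l (\<sigma> 0)) \<sigma> (l (\<sigma> 1))"])
           (use l e p in \<open>auto simp: loops_at_def sing1_eq_path_chain[OF s] L algebra_simps intro: pathin_conj\<close>)
    qed
    fix a b assume "\<exists>p\<in>loops_at X x0. a - L (bd1 a) - path_chain p \<in> boundaries1 X"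
       "\<exists>p\<in>loops_at X x0. b - L (bd1 b) - path_chain p \<in> boundaries1 X"
    then obtain p q where p: "p \<in> loops_at X x0" "a - L (bd1 a) - path_chain p \<in> boundaries1 X"
      and q: "q \<in> loops_at X x0" "b - L (bd1 b) - path_chain q \<in> boundaries1 X" by blast
    have j: "path_chain p + path_chain (path_rev q) - path_chain (path_join p (path_rev q)) \<in> boundaries1 X"
      by (rule path_chain_join) (use p q in \<open>auto simp: loops_at_def pathin_rev\<close>)
    have r: "path_chain q + path_chain (path_rev q) \<in> boundaries1 X"
      by (rule path_chain_rev) (use q in \<open>auto simp: loops_at_def\<close>)
    from boundaries1_add[OF boundaries1_diff[OF p(2) q(2)] boundaries1_diff[OF j r]]
    show "\<exists>p\<in>loops_at X x0. a - b - L (bd1 (a - b)) - path_chain p \<in> boundaries1 X"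
      by (intro bexI[where x="path_join p (path_rev q)"])
         (use p q in \<open>auto simp: L algebra_simps loops_at_join loops_at_rev\<close>)
  qed
  moreover have "bd1 c = 0" "L 0 = 0" using c by (auto simp: cycles1_def L_def)
  ultimately show ?thesis using that by auto
qed

lemma convex_std_simplex2: "convex std_simplex2"
proof -
  have "std_simplex2 = {z. (1, 0) \<bullet> z \<ge> (0::real)} \<inter> {z. (0, 1) \<bullet> z \<ge> (0::real)} \<inter> {z. (1, 1) \<bullet> z \<le> (1::real)}"
    by (auto simp: std_simplex2_def)
  moreover have "convex \<dots>" by (intro convex_Int convex_halfspace_le convex_halfspace_ge)
  ultimately show ?thesis by metis
qed

text \<open>A path is closed up with chosen paths from the base point to its ends.\<close>

lemma hom_extends_to_chains:
  assumes X: "path_connected_space X" and x0: "x0 \<in> topspace X"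
    and D: "comm_group D" and \<iota>: "\<iota> \<in> hom (fundamental_group X x0) D"
  obtains \<Omega> where "\<Omega> \<in> hom (free_Abelian_group (sing1 X)) D"
    "\<And>c. c \<in> boundaries1 X \<Longrightarrow> \<Omega> c = \<one>\<^bsub>D\<^esub>"
    "\<And>p. p \<in> loops_at X x0 \<Longrightarrow> \<Omega> (path_chain p) = \<iota> (path_class X p)"
proof -
  interpret D: comm_group D by (rule D)
  \<comment> \<open>The leg at \<open>x0\<close> is chosen constant, so that closing up a loop at
    \<open>x0\<close> gives back a homotopic loop.\<close>
  have "\<forall>x\<in>topspace X. \<exists>l. pathin X l \<and> l 0 = x0 \<and> l 1 = x \<and> (x = x0 \<longrightarrow> l = (\<lambda>_. x0))"
    using X x0 unfolding path_connected_space_def by (metis pathin_const)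
  then obtain l where l: "\<And>x. x \<in> topspace X \<Longrightarrow> pathin X (l x) \<and> l x 0 = x0 \<and> l x 1 = x \<and> (x = x0 \<longrightarrow> l x = (\<lambda>_. x0))" by metis
  define L where "L p = path_conj (l (p 0)) p (l (p 1))" for p
  have e: "p 0 \<in> topspace X" "p 1 \<in> topspace X" if "pathin X p" for p
    using that by (auto simp: path_start_in_topspace path_finish_in_topspace)
  have L: "L p \<in> loops_at X x0" if "pathin X p" for p
    using that l e[OF that] by (auto simp: L_def loops_at_def intro: pathin_conj)
  have Lj: "path_homotopic X (path_join (L p) (L q)) (L (path_join p q))" if "pathin X p" "pathin X q" "p 1 = q 0" for p q
    unfolding L_def path_join_ends that(3)
    by (rule path_homotopic_conj_join) (use that l e[OF that(1)] e[OF that(2)] in auto)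
  have Lc: "path_homotopic X (L p) (L q)" if "path_homotopic X p q" for p q
    unfolding L_def path_homotopic_imp_ends[OF that]
    by (rule path_homotopic_conj) (use that l e path_homotopic_imp_pathin[OF that] path_homotopic_imp_ends[OF that] in auto)
  have "(\<lambda>p. \<iota> (path_class X (L p))) ` sing1 X \<subseteq> carrier D"
    using L hom_in_carrier[OF \<iota>] by (auto simp: sing1_def path_class_in_carrier)
  then obtain \<Omega> where \<Omega>: "\<Omega> \<in> hom (free_Abelian_group (sing1 X)) D" "\<And>p. p \<in> sing1 X \<Longrightarrow> \<Omega> (frag_of p) = \<iota> (path_class X (L p))"
    using D.free_Abelian_group_universal[of "\<lambda>p. \<iota> (path_class X (L p))" "sing1 X"] by metis
  interpret \<Omega>: group_hom "free_Abelian_group (sing1 X)" D \<Omega>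
    using \<Omega>(1) by (simp add: group_hom_def group_hom_axioms_def)
  have \<Omega>p: "\<Omega> (path_chain p) = \<iota> (path_class X (L p))" if "pathin X p" for p
  proof -
    have "path_homotopic X (restrict p {0..1}) p" by (rule path_homotopic_sym, rule path_homotopic_eqI) (use that in auto)
    from path_class_eqI[OF Lc[OF this]] show ?thesis
      using \<Omega>(2)[OF restrict_in_sing1[OF that]] by (simp add: path_chain_def)
  qed
  have \<Omega>j: "\<Omega> (path_chain p) \<otimes>\<^bsub>D\<^esub> \<Omega> (path_chain q) = \<Omega> (path_chain r)"
    if "pathin X p" "pathin X q" "p 1 = q 0" "path_homotopic X (path_join p q) r" for p q r
  proof -
    have r: "pathin X r" using path_homotopic_imp_pathin that by blast
    have "path_class X (L r) = path_class X (path_join (L p) (L q))"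
      using path_class_eqI[OF path_homotopic_trans[OF Lj[OF that(1-3)] Lc[OF that(4)]]] by simp
    also have "\<dots> = path_class X (L p) \<otimes>\<^bsub>fundamental_group X x0\<^esub> path_class X (L q)"
      using mult_fundamental_group[OF L[OF that(1)] L[OF that(2)]] by simp
    finally show ?thesis using hom_mult[OF \<iota> path_class_in_carrier[OF L[OF that(1)]] path_class_in_carrier[OF L[OF that(2)]]]
      by (simp add: \<Omega>p that r)
  qed
  show ?thesis
  proof (rule that[OF \<Omega>(1)])
    fix p assume p: "p \<in> loops_at X x0"
    have "path_homotopic X (L p) (path_join (\<lambda>_. x0) p)"
      unfolding L_def path_conj_def using l[OF x0] p
      by (auto simp: loops_at_def path_rev_def intro!: path_homotopic_rid pathin_join)
    also have "path_homotopic X \<dots> p" by (rule path_homotopic_lid) (use p in \<open>auto simp: loops_at_def\<close>)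
    finally show "\<Omega> (path_chain p) = \<iota> (path_class X p)"
      using \<Omega>p p path_class_eqI by (metis loops_atD(1))
  next
    have bc: "bd2 a \<in> carrier (free_Abelian_group (sing1 X))" if "Poly_Mapping.keys a \<subseteq> sing2 X" for a
    proof -
      have "bd2 a \<in> boundaries1 X" using that by (auto simp: boundaries1_def)
      then show ?thesis using boundaries1_subset_cycles1[of X] unfolding cycles1_def by blast
    qed
    have main: "\<Omega> (bd2 (frag_of \<sigma>)) = \<one>\<^bsub>D\<^esub>" if "\<sigma> \<in> sing2 X" for \<sigma>
    proof -
      let ?f = "\<lambda>i. face2 i \<sigma>"
      have f: "?f i \<in> sing1 X" for i using face2_in_sing1[OF that] .
      then have p: "pathin X (?f i)" for i by (auto simp: sing1_def)
      have S: "continuous_map (top_of_set std_simplex2) X \<sigma>" using that by (simp add: sing2_def)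
      \<comment> \<open>\<open>?c\<close> runs along the edges e0 e1 and e1 e2 of the standard
        simplex. By convexity it is homotopic to the edge e0 e2, which is the relation between the
        three faces.\<close>
      let ?c = "\<lambda>t::real. if t \<le> 1/2 then (2 * t, 0) else (2 - 2 * t, 2 * t - 1)"
      have hm: "path_homotopic X (path_join (?f 2) (?f 0)) (?f 1)"
      proof (rule path_homotopic_convex[OF _ S, where \<phi>="?c" and \<psi>="\<lambda>t. (0, t)"])
        show "convex std_simplex2" by (rule convex_std_simplex2)
        show "continuous_on {0..1} ?c"
          by (rule continuous_on_subset[of UNIV], rule continuous_on_cases_le[where h="\<lambda>t. t"]) (auto intro!: continuous_intros)
      qed (auto simp: std_simplex2_def face2_def path_join_def algebra_simps intro!: continuous_intros)
      have j: "\<Omega> (path_chain (?f 2)) \<otimes>\<^bsub>D\<^esub> \<Omega> (path_chain (?f 0)) = \<Omega> (path_chain (?f 1))"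
        by (rule \<Omega>j[OF p p _ hm]) (simp add: face2_def)
      have fc: "frag_of (?f i) = path_chain (?f i)" for i using sing1_eq_path_chain[OF f] .
      have fr: "frag_of (?f i) \<in> carrier (free_Abelian_group (sing1 X))" for i using f by auto
      \<comment> \<open>Moving the face with negative sign to the left avoids inverses in
        \<open>D\<close>.\<close>
      have "bd2 (frag_of \<sigma>) + frag_of (?f 1) = frag_of (?f 2) + frag_of (?f 0)" by (simp add: bd2_def)
      then have "\<Omega> (bd2 (frag_of \<sigma>)) \<otimes>\<^bsub>D\<^esub> \<Omega> (frag_of (?f 1)) = \<Omega> (frag_of (?f 2)) \<otimes>\<^bsub>D\<^esub> \<Omega> (frag_of (?f 0))"
        using \<Omega>.hom_mult[of "bd2 (frag_of \<sigma>)" "frag_of (?f 1)"] \<Omega>.hom_mult[of "frag_of (?f 2)" "frag_of (?f 0)"]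
          fr bc[of "frag_of \<sigma>"] that by simp
      also have "\<dots> = \<Omega> (frag_of (?f 1))" unfolding fc by (rule j)
      finally show ?thesis
        using \<Omega>.hom_closed[OF fr[of 1]] \<Omega>.hom_closed[OF bc[of "frag_of \<sigma>"]] that by simp
    qed
    fix c assume "c \<in> boundaries1 X"
    then obtain d where d: "c = bd2 d" "Poly_Mapping.keys d \<subseteq> sing2 X" by (auto simp: boundaries1_def)
    have "Poly_Mapping.keys d \<subseteq> sing2 X \<and> \<Omega> (bd2 d) = \<one>\<^bsub>D\<^esub>"
    proof (rule frag_induction[OF d(2)])
      fix a b assume a: "Poly_Mapping.keys a \<subseteq> sing2 X \<and> \<Omega> (bd2 a) = \<one>\<^bsub>D\<^esub>" and b: "Poly_Mapping.keys b \<subseteq> sing2 X \<and> \<Omega> (bd2 b) = \<one>\<^bsub>D\<^esub>"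
      have ab: "Poly_Mapping.keys (a - b) \<subseteq> sing2 X" using keys_diff[of a b] a b by blast
      have "\<Omega> (bd2 (a - b)) \<otimes>\<^bsub>D\<^esub> \<Omega> (bd2 b) = \<Omega> (bd2 a)"
        using \<Omega>.hom_mult[of "bd2 (a - b)" "bd2 b"] bc[OF ab] bc[of b] b by simp
      then show "Poly_Mapping.keys (a - b) \<subseteq> sing2 X \<and> \<Omega> (bd2 (a - b)) = \<one>\<^bsub>D\<^esub>"
        using ab a b \<Omega>.hom_closed[OF bc[OF ab]] by simp
    qed (use main \<Omega>.hom_one in auto)
    then show "\<Omega> c = \<one>\<^bsub>D\<^esub>" using d by simp
  qed
qed

section \<open>Integration of local potentials\<close>

text \<open>Values matter only modulo the subgroup \<open>N\<close>.\<close>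

locale local_potentials =
  fixes Y :: "'y topology" and P :: "('y set \<times> ('y \<Rightarrow> 'c::ab_group_add)) set" and N :: "'c set"
  assumes N_zero: "0 \<in> N" and N_diff: "c \<in> N \<Longrightarrow> d \<in> N \<Longrightarrow> c - d \<in> N"
    and open_pot: "(V, F) \<in> P \<Longrightarrow> openin Y V"
    and cover: "y \<in> topspace Y \<Longrightarrow> \<exists>V F. (V, F) \<in> P \<and> y \<in> V"
    and compat: "(V, F) \<in> P \<Longrightarrow> (W, G) \<in> P \<Longrightarrow> y \<in> V \<Longrightarrow> y \<in> W \<Longrightarrow>
       \<exists>U. openin Y U \<and> y \<in> U \<and> (\<forall>z\<in>U. (F z - F y) - (G z - G y) \<in> N)"
begin

lemma N_uminus: "c \<in> N \<Longrightarrow> - c \<in> N"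
  using N_diff[OF N_zero] by fastforce

lemma N_add: "c \<in> N \<Longrightarrow> d \<in> N \<Longrightarrow> c + d \<in> N"
  using N_diff[OF _ N_uminus] by fastforce

text \<open>The potentials stand for a closed 1-form given by local primitives, of which only
  increments matter; \<open>\<Phi>\<close> is a primitive of its pull-back along \<open>h\<close>.
  Since everything is an identity modulo \<open>N\<close> near each point, the group of values needs
  no topology.\<close>

definition primitive :: "'t::topological_space set \<Rightarrow> ('t \<Rightarrow> 'y) \<Rightarrow> ('t \<Rightarrow> 'c) \<Rightarrow> bool" where
  "primitive S h \<Phi> \<longleftrightarrow> (\<forall>s\<in>S. \<forall>V F. (V, F) \<in> P \<and> h s \<in> V \<longrightarrow>
     (\<forall>\<^sub>F t in nhds s. t \<in> S \<longrightarrow> (\<Phi> t - \<Phi> s) - (F (h t) - F (h s)) \<in> N))"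

lemma primitiveD:
  "primitive S h \<Phi> \<Longrightarrow> s \<in> S \<Longrightarrow> (V, F) \<in> P \<Longrightarrow> h s \<in> V \<Longrightarrow>
     \<forall>\<^sub>F t in nhds s. t \<in> S \<longrightarrow> (\<Phi> t - \<Phi> s) - (F (h t) - F (h s)) \<in> N"
  by (simp add: primitive_def)

lemma primitive_compose:
  assumes "primitive S h \<Phi>" "continuous_on T g" "g \<in> T \<rightarrow> S"
  shows "primitive T (\<lambda>t. h (g t)) (\<lambda>t. \<Phi> (g t))"
  unfolding primitive_def
proof clarify
  fix s V F assume s: "s \<in> T" "(V, F) \<in> P" "h (g s) \<in> V"
  have "g s \<in> S" using assms s by auto
  from primitiveD[OF assms(1) this s(2,3)] obtain B where B: "open B" "g s \<in> B"
     "\<And>t. t \<in> B \<Longrightarrow> t \<in> S \<Longrightarrow> (\<Phi> t - \<Phi> (g s)) - (F (h t) - F (h (g s))) \<in> N"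
    unfolding eventually_nhds by blast
  obtain A where "open A" "s \<in> A" "\<And>y. y \<in> T \<Longrightarrow> y \<in> A \<Longrightarrow> g y \<in> B"
    using assms(2)[unfolded continuous_on_topological, rule_format, OF s(1) B(1,2)] by auto
  then show "\<forall>\<^sub>F t in nhds s. t \<in> T \<longrightarrow> (\<Phi> (g t) - \<Phi> (g s)) - (F (h (g t)) - F (h (g s))) \<in> N"
    unfolding eventually_nhds
  proof (intro exI conjI ballI impI)
    fix t assume "t \<in> A" "t \<in> T"
    moreover have "g t \<in> B" "g t \<in> S" using \<open>\<And>y. y \<in> T \<Longrightarrow> y \<in> A \<Longrightarrow> g y \<in> B\<close> calculation assms(3) by auto
    ultimately show "(\<Phi> (g t) - \<Phi> (g s)) - (F (h (g t)) - F (h (g s))) \<in> N" using B(3) by blast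
  qed
qed

lemma primitive_cong:
  assumes "primitive S h \<Phi>" "\<And>s. s \<in> S \<Longrightarrow> h s = h' s" "\<And>s. s \<in> S \<Longrightarrow> \<Phi> s = \<Phi>' s"
  shows "primitive S h' \<Phi>'"
  unfolding primitive_def
proof clarify
  fix s V F assume s: "s \<in> S" "(V, F) \<in> P" "h' s \<in> V"
  from primitiveD[OF assms(1) s(1,2)] have "\<forall>\<^sub>F t in nhds s. t \<in> S \<longrightarrow> \<Phi> t - \<Phi> s - (F (h t) - F (h s)) \<in> N"
    using s assms by auto
  then show "\<forall>\<^sub>F t in nhds s. t \<in> S \<longrightarrow> \<Phi>' t - \<Phi>' s - (F (h' t) - F (h' s)) \<in> N"
    by (rule eventually_mono) (use assms s in auto)
qed

lemma primitive_subset: "primitive S h \<Phi> \<Longrightarrow> T \<subseteq> S \<Longrightarrow> primitive T h \<Phi>"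
  using primitive_compose[of S h \<Phi> T "\<lambda>x. x"] by auto

lemma primitive_shift: "primitive S h \<Phi> \<Longrightarrow> primitive S h (\<lambda>s. \<Phi> s + c)"
  by (simp add: primitive_def)

lemma primitive_const: "primitive S (\<lambda>_. y) (\<lambda>_. 0)"
  by (simp add: primitive_def N_zero)

text \<open>Near each point both primitives have the increments of one and the same potential, so
  their difference is locally constant modulo \<open>N\<close>.\<close>

lemma primitive_unique:
  assumes "primitive S h \<Phi>" "primitive S h \<Psi>" "connected S" "a \<in> S" "b \<in> S" "h \<in> S \<rightarrow> topspace Y"
  shows "(\<Phi> b - \<Phi> a) - (\<Psi> b - \<Psi> a) \<in> N"
proof -
  let ?f = "\<lambda>s. (\<Phi> s - \<Psi> s) - (\<Phi> a - \<Psi> a) \<in> N"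
  have "?f a = ?f b"
  proof (rule connected_local_const[OF assms(3-5)], intro ballI)
    fix s assume s: "s \<in> S"
    then have "h s \<in> topspace Y" using assms by auto
    from cover[OF this] obtain V F where V: "(V, F) \<in> P" "h s \<in> V" by blast
    have "\<forall>\<^sub>F t in nhds s. t \<in> S \<longrightarrow> ?f s = ?f t"
      using primitiveD[OF assms(1) s V] primitiveD[OF assms(2) s V]
    proof eventually_elim
      case (elim t)
      show ?case
      proof
        assume "t \<in> S"
        with elim have d: "(\<Phi> t - \<Phi> s) - (\<Psi> t - \<Psi> s) \<in> N" using N_diff by fastforce
        show "?f s = ?f t"
        proof
          assume "?f s" from N_add[OF this d] show "?f t" by (simp add: algebra_simps)
        next
          assume "?f t" from N_diff[OF this d] show "?f s" by (simp add: algebra_simps)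
        qed
      qed
    qed
    then show "\<forall>\<^sub>F t in at s within S. ?f s = ?f t"
      unfolding eventually_at_filter by eventually_elim auto
  qed
  then show ?thesis using N_zero by (simp add: algebra_simps)
qed

text \<open>A primitive must match every potential around each point; \<open>compat\<close>
  transfers this from the single \<open>F\<close> to all others.\<close>

lemma primitive_local:
  assumes h: "continuous_map (top_of_set S) Y h" and V: "(V, F) \<in> P" "h ` S \<subseteq> V"
  shows "primitive S h (\<lambda>s. F (h s))"
  unfolding primitive_def
proof clarify
  fix s W G assume s: "s \<in> S" "(W, G) \<in> P" "h s \<in> W"
  then have "h s \<in> V" using V by auto
  from compat[OF V(1) s(2) this s(3)] obtain U where U: "openin Y U" "h s \<in> U"
     "\<And>z. z \<in> U \<Longrightarrow> (F z - F (h s)) - (G z - G (h s)) \<in> N" by blast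
  have "openin (top_of_set S) {t \<in> S. h t \<in> U}" using openin_continuous_map_preimage[OF h U(1)] by simp
  then obtain O' where "open O'" "{t \<in> S. h t \<in> U} = S \<inter> O'" by (auto simp: openin_open)
  then show "\<forall>\<^sub>F t in nhds s. t \<in> S \<longrightarrow> F (h t) - F (h s) - (G (h t) - G (h s)) \<in> N"
    unfolding eventually_nhds using U s by (intro exI[where x=O']) blast
qed

text \<open>On the connected intersection the two primitives differ by a constant modulo
  \<open>N\<close>, and shifting one of them removes it. Closedness is what makes the combined
  function a primitive: a point outside one of the sets has a neighbourhood missing that set, so
  only the pieces that contain the point impose a condition.\<close>

lemma primitive_glue:
  assumes S: "primitive S h \<Phi>" and T: "primitive T h \<Psi>" and "closed S" "closed T"
    and con: "connected (S \<inter> T)" and a: "a \<in> S \<inter> T" and hY: "h \<in> S \<union> T \<rightarrow> topspace Y"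
  shows "\<exists>\<Theta>. primitive (S \<union> T) h \<Theta>"
proof -
  define \<Psi>' where "\<Psi>' s = \<Psi> s + (\<Phi> a - \<Psi> a)" for s
  have T': "primitive T h \<Psi>'" unfolding \<Psi>'_def by (rule primitive_shift[OF T])
  have ST: "\<Phi> s - \<Psi>' s \<in> N" if "s \<in> S" "s \<in> T" for s
  proof -
    have "(\<Phi> s - \<Phi> a) - (\<Psi> s - \<Psi> a) \<in> N"
      by (rule primitive_unique[OF primitive_subset[OF S] primitive_subset[OF T] con a]) (use that hY in auto)
    then show ?thesis by (simp add: \<Psi>'_def algebra_simps)
  qed
  define \<Theta> where "\<Theta> s = (if s \<in> S then \<Phi> s else \<Psi>' s)" for s
  have \<Theta>S: "\<Theta> s - \<Phi> s \<in> N" if "s \<in> S" for s using that by (simp add: \<Theta>_def N_zero)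
  have \<Theta>T: "\<Theta> s - \<Psi>' s \<in> N" if "s \<in> T" for s using that ST by (simp add: \<Theta>_def N_zero)
  have part: "\<forall>\<^sub>F t in nhds s. t \<in> A \<longrightarrow> (\<Theta> t - \<Theta> s) - (F (h t) - F (h s)) \<in> N"
    if s: "s \<in> S \<union> T" and V: "(V, F) \<in> P" "h s \<in> V" and A: "primitive A h \<Upsilon>" "\<And>s. s \<in> A \<Longrightarrow> \<Theta> s - \<Upsilon> s \<in> N" "closed A"
    for s V F A \<Upsilon>
  proof (cases "s \<in> A")
    case True
    from primitiveD[OF A(1) True V] show ?thesis
    proof eventually_elim
      case (elim t)
      show ?case
      proof
        assume t: "t \<in> A"
        with elim have "\<Upsilon> t - \<Upsilon> s - (F (h t) - F (h s)) \<in> N" by simp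
        from N_diff[OF N_add[OF this A(2)[OF t]] A(2)[OF True]]
        show "(\<Theta> t - \<Theta> s) - (F (h t) - F (h s)) \<in> N" by (simp add: algebra_simps)
      qed
    qed
  next
    case False
    have "\<forall>\<^sub>F t in nhds s. t \<in> - A" by (rule eventually_nhds_in_open) (use A(3) False in auto)
    then show ?thesis by eventually_elim auto
  qed
  have "primitive (S \<union> T) h \<Theta>"
    unfolding primitive_def
  proof clarify
    fix s V F assume s: "s \<in> S \<union> T" "(V, F) \<in> P" "h s \<in> V"
    have "\<forall>\<^sub>F t in nhds s. t \<in> S \<longrightarrow> \<Theta> t - \<Theta> s - (F (h t) - F (h s)) \<in> N"
      by (rule part[OF s S _ assms(3)]) (rule \<Theta>S)
    moreover have "\<forall>\<^sub>F t in nhds s. t \<in> T \<longrightarrow> \<Theta> t - \<Theta> s - (F (h t) - F (h s)) \<in> N"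
      by (rule part[OF s T' _ assms(4)]) (rule \<Theta>T)
    ultimately show "\<forall>\<^sub>F t in nhds s. t \<in> S \<union> T \<longrightarrow> \<Theta> t - \<Theta> s - (F (h t) - F (h s)) \<in> N"
      by eventually_elim auto
  qed
  then show ?thesis by blast
qed

text \<open>Small rectangles lie in the domain of one potential; bisection in each coordinate glues
  them together along edges, which are connected. \<open>h\<close> is given on the whole plane
  because the small intervals in the bisection principle may stick out of [0,1].\<close>

lemma primitive_plane:
  fixes h :: "real \<times> real \<Rightarrow> 'y"
  assumes h: "continuous_map euclidean Y h"
  shows "\<exists>\<Phi>. primitive ({0..1} \<times> {0..1}) h \<Phi>"
proof -
  let ?R = "\<lambda>a b c d. \<exists>\<Phi>. primitive ({a..b} \<times> {c..d}) h \<Phi>"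
  have hY: "h z \<in> topspace Y" for z using h by (auto simp: continuous_map_def)
  have empty: "primitive {} h \<Phi>" for \<Phi> by (simp add: primitive_def)
  have glue: "\<exists>\<Phi>. primitive R h \<Phi>" if "\<exists>\<Phi>. primitive S h \<Phi>" "\<exists>\<Phi>. primitive T h \<Phi>" "closed S" "closed T" 
     "convex (S \<inter> T)" "S \<inter> T \<noteq> {}" "R = S \<union> T" for R S T :: "(real \<times> real) set"
    using that primitive_glue[of S h _ T] convex_connected[of "S \<inter> T"] hY by blast
  have strip: "\<exists>\<delta>>0. \<forall>a b. a \<le> x \<and> x \<le> b \<and> b - a < \<delta> \<longrightarrow> ?R a b 0 1" for x
  proof -
    \<comment> \<open>Bisection of the second coordinate, with the first confined to a thin interval
      around \<open>x\<close>. The admissible width may depend on the interval [c,d]; gluing two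
      intervals takes the minimum of their widths.\<close>
    define Q where "Q c d \<longleftrightarrow> (\<exists>\<delta>>0. \<forall>a b. a \<le> x \<and> x \<le> b \<and> b - a < \<delta> \<longrightarrow> ?R a b c d)" for c d
    have "(0::real) \<le> 1" by simp
    then have "Q 0 1"
    proof (induction rule: Bolzano)
      case (trans c d e)
      obtain \<delta> where d: "\<delta> > 0" "\<And>a b. a \<le> x \<and> x \<le> b \<and> b - a < \<delta> \<Longrightarrow> ?R a b c d"
        using trans(1) unfolding Q_def by (elim exE conjE) (rule that, auto)
      obtain \<epsilon> where e: "\<epsilon> > 0" "\<And>a b. a \<le> x \<and> x \<le> b \<and> b - a < \<epsilon> \<Longrightarrow> ?R a b d e"
        using trans(2) unfolding Q_def by (elim exE conjE) (rule that, auto)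
      have "?R a b c e" if "a \<le> x" "x \<le> b" "b - a < min \<delta> \<epsilon>" for a b
      proof (rule glue[of "{a..b} \<times> {c..d}" "{a..b} \<times> {d..e}"])
        have *: "({a..b} \<times> {c..d}) \<inter> ({a..b} \<times> {d..e}) = {a..b} \<times> {d}" using trans by auto
        show "convex (({a..b} \<times> {c..d}) \<inter> ({a..b} \<times> {d..e}))" unfolding * by (intro convex_Times) auto
        show "({a..b} \<times> {c..d}) \<inter> ({a..b} \<times> {d..e}) \<noteq> {}" unfolding * using that by auto
      qed (use d e that trans in \<open>auto intro!: closed_Times\<close>)
      then show ?case unfolding Q_def using d(1) e(1) by (intro exI[where x="min \<delta> \<epsilon>"]) auto
    next
      case (local y)
      obtain V F where V: "(V, F) \<in> P" "h (x, y) \<in> V" using cover hY by blast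
      have "open {z. h z \<in> V}" using openin_continuous_map_preimage[OF h open_pot[OF V(1)]] by simp
      then obtain e where e: "e > 0" "\<And>z. dist z (x, y) < e \<Longrightarrow> h z \<in> V"
        using V(2) unfolding open_dist by blast
      have "?R a b c d" if "a \<le> x" "x \<le> b" "b - a < e / 2" "c \<le> y" "y \<le> d" "d - c < e / 2" for a b c d
      proof -
        have "h ` ({a..b} \<times> {c..d}) \<subseteq> V"
        proof clarify
          fix s t assume "s \<in> {a..b}" "t \<in> {c..d}"
          then have "\<bar>s - x\<bar> < e / 2" "\<bar>t - y\<bar> < e / 2" using that unfolding atLeastAtMost_iff by linarith+
          then have "dist (s, t) (x, y) < e"
            using sqrt_sum_squares_le_sum_abs[of "s - x" "t - y"] by (simp add: dist_prod_def dist_real_def)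
          then show "h (s, t) \<in> V" using e by auto
        qed
        then show ?thesis using primitive_local[OF continuous_map_from_subtopology[OF h] V(1)] by blast
      qed
      then have "\<exists>d>0. \<forall>c b. c \<le> y \<and> y \<le> b \<and> b - c < d \<longrightarrow> (\<exists>\<delta>>0. \<forall>a a'. a \<le> x \<and> x \<le> a' \<and> a' - a < \<delta> \<longrightarrow> ?R a a' c b)"
        using e(1) by (intro exI[where x="e/2"] conjI allI impI) auto
      then show ?case unfolding Q_def .
    qed
    then show ?thesis unfolding Q_def .
  qed
  define Q where "Q a b \<longleftrightarrow> ?R a b 0 1" for a b
  have "(0::real) \<le> 1" by simp
  then have "Q 0 1"
  proof (induction rule: Bolzano)
    case (trans a b c)
    show ?case unfolding Q_def
    proof (rule glue[of "{a..b} \<times> {0..1}" "{b..c} \<times> {0..1}"])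
      have *: "({a..b} \<times> {0..1}) \<inter> ({b..c} \<times> {0..1}) = {b} \<times> {0..1::real}" using trans by auto
      show "convex (({a..b} \<times> {0..1}) \<inter> ({b..c} \<times> {0..1::real}))" unfolding * by (intro convex_Times) auto
      show "({a..b} \<times> {0..1}) \<inter> ({b..c} \<times> {0..1::real}) \<noteq> {}" unfolding * by auto
    qed (use trans in \<open>auto simp: Q_def intro!: closed_Times\<close>)
  next
    case (local x)
    then show ?case unfolding Q_def using strip by blast
  qed
  then show ?thesis unfolding Q_def .
qed

text \<open>Stokes on the square: a primitive of the pulled-back form has total increment zero
  around the boundary, and the two edges on which the homotopy is constant contribute
  nothing.\<close>

theorem integral_path_homotopic:
  assumes "path_homotopic Y p q" "primitive {0..1} p \<phi>" "primitive {0..1} q \<psi>"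
  shows "(\<phi> 1 - \<phi> 0) - (\<psi> 1 - \<psi> 0) \<in> N"
proof -
  obtain h where h: "continuous_map unit_square Y h"
    and e: "\<forall>s\<in>{0..1}. h (0, s) = p s \<and> h (1, s) = q s" "\<forall>t\<in>{0..1}. h (t, 0) = p 0 \<and> h (t, 1) = p 1"
    using assms(1) unfolding path_homotopic_def by blast
  \<comment> \<open>Clamping both coordinates to [0,1] extends the homotopy continuously to the
    plane.\<close>
  let ?cl = "\<lambda>t::real. min 1 (max 0 t)"
  have "continuous_map (top_of_set UNIV) Y (\<lambda>z. h (?cl (fst z), ?cl (snd z)))"
    by (rule continuous_map_compose_on[OF h[unfolded prod_top_of_set]]) (auto intro!: continuous_intros)
  then obtain \<Phi> where "primitive ({0..1} \<times> {0..1}) (\<lambda>z. h (?cl (fst z), ?cl (snd z))) \<Phi>"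
    using primitive_plane by auto
  then have \<Phi>: "primitive ({0..1} \<times> {0..1}) h \<Phi>"
    by (rule primitive_cong) (auto simp: min_def max_def)
  have hY: "h z \<in> topspace Y" if "z \<in> {0..1} \<times> {0..1}" for z
    using h that unfolding prod_top_of_set by (auto simp: continuous_map_def Pi_iff)
  \<comment> \<open>Along an edge the restriction of \<open>\<Phi>\<close> and the given
    \<open>\<theta>\<close> are primitives for the same path, so their total increments agree modulo
    \<open>N\<close>.\<close>
  have edge: "(\<Phi> (g 1) - \<Phi> (g 0)) - (\<theta> 1 - \<theta> 0) \<in> N"
    if "continuous_on {0..1} g" "g \<in> {0..1::real} \<rightarrow> {0..1} \<times> {0..1}" "primitive {0..1} r \<theta>" "\<And>t. t \<in> {0..1} \<Longrightarrow> h (g t) = r t"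
    for g r \<theta>
  proof (rule primitive_unique[OF _ that(3), where \<Phi>="\<lambda>t. \<Phi> (g t)"])
    show "primitive {0..1} r (\<lambda>t. \<Phi> (g t))"
      by (rule primitive_cong[OF primitive_compose[OF \<Phi> that(1,2)]]) (use that in auto)
    show "r \<in> {0..1} \<rightarrow> topspace Y" using that(4) hY that(2) by (metis Pi_iff)
  qed auto
  have 1: "(\<Phi> (0, 1) - \<Phi> (0, 0)) - (\<phi> 1 - \<phi> 0) \<in> N"
    by (rule edge[OF _ _ assms(2)]) (use e in \<open>auto intro!: continuous_intros\<close>)
  have 2: "(\<Phi> (1, 1) - \<Phi> (1, 0)) - (\<psi> 1 - \<psi> 0) \<in> N"
    by (rule edge[OF _ _ assms(3)]) (use e in \<open>auto intro!: continuous_intros\<close>)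
  have 3: "(\<Phi> (1, 0) - \<Phi> (0, 0)) - (0 - 0) \<in> N"
    by (rule edge[OF _ _ primitive_const[where y="p 0"]]) (use e in \<open>auto intro!: continuous_intros\<close>)
  have 4: "(\<Phi> (1, 1) - \<Phi> (0, 1)) - (0 - 0) \<in> N"
    by (rule edge[OF _ _ primitive_const[where y="p 1"]]) (use e in \<open>auto intro!: continuous_intros\<close>)
  from N_diff[OF N_diff[OF 2 1] N_diff[OF 4 3]] have "- ((\<psi> 1 - \<psi> 0) - (\<phi> 1 - \<phi> 0)) \<in> N"
    by (simp add: algebra_simps)
  then show ?thesis by (simp add: algebra_simps)
qed

end

section \<open>Contractible covers\<close>

text \<open>Local constancy is demanded only at points in the image of \<open>p\<close>, since
  \<open>K_1\<close> provides it only within \<open>U\<close>.\<close>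

lemma locally_const_along_connected:
  assumes p: "continuous_map (top_of_set S) Z p" and S: "connected S" "a \<in> S" "b \<in> S"
    and loc: "\<And>s. s \<in> S \<Longrightarrow> \<exists>V. openin Z V \<and> p s \<in> V \<and> (\<forall>t\<in>S. p t \<in> V \<longrightarrow> f (p t) = f (p s))"
  shows "f (p a) = f (p b)"
proof (rule connected_local_const[OF S], intro ballI)
  fix s assume s: "s \<in> S"
  obtain V where V: "openin Z V" "p s \<in> V" "\<forall>t\<in>S. p t \<in> V \<longrightarrow> f (p t) = f (p s)"
    using loc[OF s] by blast
  have "openin (top_of_set S) {t \<in> S. p t \<in> V}" using openin_continuous_map_preimage[OF p V(1)] by simp
  then obtain O' where O': "open O'" "{t \<in> S. p t \<in> V} = S \<inter> O'" by (auto simp: openin_open)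
  have "s \<in> O'" using O' s V(2) by blast
  moreover have "f (p s) = f (p t)" if "t \<in> O'" "t \<in> S" for t
  proof -
    have "p t \<in> V" using that O'(2) by blast
    then show ?thesis using V(3) that(2) by simp
  qed
  ultimately show "\<forall>\<^sub>F b in at s within S. f (p s) = f (p b)"
    unfolding eventually_at_topological using O'(1) by blast
qed

text \<open>One member has to contain all coordinates of a point of \<open>X\<^sup>n\<close>, hence arbitrary finite sets. The last
  axiom makes the tracks of the deformations local potentials modulo boundaries.\<close>

locale contractible_cover =
  fixes X :: "'a topology" and \<K> :: "('a set \<times> (real \<times> 'a \<Rightarrow> 'a)) set"
  assumes K_open: "(U, k) \<in> \<K> \<Longrightarrow> openin X U"
    and K_cont: "(U, k) \<in> \<K> \<Longrightarrow> continuous_map (prod_topology unit_interval (subtopology X U)) X k"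
    and K_0: "(U, k) \<in> \<K> \<Longrightarrow> u \<in> U \<Longrightarrow> k (0, u) = u"
    and K_1: "(U, k) \<in> \<K> \<Longrightarrow> u \<in> U \<Longrightarrow> \<exists>V. openin X V \<and> u \<in> V \<and> (\<forall>v\<in>V \<inter> U. k (1, v) = k (1, u))"
    and K_cover: "finite F \<Longrightarrow> F \<subseteq> topspace X \<Longrightarrow> \<exists>U k. (U, k) \<in> \<K> \<and> F \<subseteq> U"
    and K_compat: "(U, k) \<in> \<K> \<Longrightarrow> (W, l) \<in> \<K> \<Longrightarrow> y \<in> U \<Longrightarrow> y \<in> W \<Longrightarrow>
      \<exists>V. openin X V \<and> y \<in> V \<and> (\<forall>z\<in>V \<inter> U \<inter> W.
         (path_chain (\<lambda>t. k (t, z)) - path_chain (\<lambda>t. k (t, y)))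
       - (path_chain (\<lambda>t. l (t, z)) - path_chain (\<lambda>t. l (t, y))) \<in> boundaries1 X)"
begin

lemma K_track: "(U, k) \<in> \<K> \<Longrightarrow> u \<in> U \<Longrightarrow> pathin X (\<lambda>t. k (t, u))"
proof -
  assume k: "(U, k) \<in> \<K>" and u: "u \<in> U"
  have "continuous_map unit_interval (prod_topology unit_interval (subtopology X U)) (\<lambda>t. (t, u))"
    using openin_subset[OF K_open[OF k]] u by (auto simp: continuous_map_pairwise o_def continuous_map_in_subtopology)
  from continuous_map_compose[OF this K_cont[OF k]] show ?thesis by (simp add: pathin_def o_def)
qed

lemma K_1_const:
  assumes k: "(U, k) \<in> \<K>" and p: "continuous_map (top_of_set S) X p" "p ` S \<subseteq> U" and S: "connected S" "a \<in> S" "b \<in> S"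
  shows "k (1, p a) = k (1, p b)"
proof (rule locally_const_along_connected[OF p(1) S, where f="\<lambda>u. k (1, u)"])
  fix s assume "s \<in> S"
  then obtain V where "openin X V" "p s \<in> V" "\<forall>v\<in>V \<inter> U. k (1, v) = k (1, p s)"
    using K_1[OF k, of "p s"] p by blast
  then show "\<exists>V. openin X V \<and> p s \<in> V \<and> (\<forall>t\<in>S. p t \<in> V \<longrightarrow> k (1, p t) = k (1, p s))"
    using p(2) by (intro exI[where x=V]) auto
qed

text \<open>The deformation sweeps \<open>p\<close> across a square: one side is \<open>p\<close>,
  the opposite one is constant because the final map is locally constant, and the other two are the
  tracks of the ends. Hence minus the track is a local potential for the class of a path modulo
  boundaries.\<close>

lemma path_chain_in_cover:
  assumes k: "(U, k) \<in> \<K>" and p: "pathin X p" and pU: "p \<in> {0..1} \<rightarrow> U"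
  shows "path_chain p - (path_chain (\<lambda>t. k (t, p 0)) - path_chain (\<lambda>t. k (t, p 1))) \<in> boundaries1 X"
proof -
  have "continuous_map unit_square (prod_topology unit_interval (subtopology X U)) (\<lambda>z. (snd z, p (fst z)))"
    unfolding continuous_map_pairwise o_def fst_conv snd_conv
  proof
    show "continuous_map unit_square unit_interval snd"
      by (rule continuous_map_snd)
    show "continuous_map unit_square (subtopology X U) (\<lambda>x. p (fst x))"
      using continuous_map_compose[OF continuous_map_fst p[unfolded pathin_def], of unit_interval] pU
      by (auto simp: continuous_map_in_subtopology o_def Pi_iff)
  qed
  from continuous_map_compose[OF this K_cont[OF k]]
  have "continuous_map unit_square X (\<lambda>z. k (snd z, p (fst z)))" by (simp add: o_def)
  from boundaries1_square[OF this]
  have sq: "path_chain (\<lambda>t. k (0, p t)) + path_chain (\<lambda>t. k (t, p 1)) - path_chain (\<lambda>t. k (t, p 0)) - path_chain (\<lambda>t. k (1, p t)) \<in> boundaries1 X"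
    by simp
  have "path_chain (\<lambda>t. k (0, p t)) = path_chain p"
    by (rule path_chain_cong, rule K_0[OF k]) (use pU in auto)
  moreover have "path_chain (\<lambda>t. k (1, p t)) = path_chain (\<lambda>_. k (1, p 0))"
    by (rule path_chain_cong, rule K_1_const[OF k p[unfolded pathin_def]]) (use pU in auto)
  moreover have "path_chain (\<lambda>_. k (1, p 0)) \<in> boundaries1 X"
  proof -
    have "p 0 \<in> U" using pU by auto
    from path_finish_in_topspace[OF K_track[OF k this]] show ?thesis by (rule boundaries1_const)
  qed
  ultimately have "path_chain p + path_chain (\<lambda>t. k (t, p 1)) - path_chain (\<lambda>t. k (t, p 0)) \<in> boundaries1 X"
    using boundaries1_add[OF sq, of "path_chain (\<lambda>_. k (1, p 0))"] by simp
  then show ?thesis by (simp add: algebra_simps)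
qed

text \<open>The initial segment of \<open>p\<close> up to time \<open>t\<close> is, as a function of
  \<open>t\<close>, a primitive of the potential that sends a point to minus its track. The
  statement is left in this raw form because it is summed over the coordinates in an invariant set
  before it becomes a primitive on the quotient.\<close>

lemma path_chain_initial_primitive:
  assumes p: "pathin X p" and k: "(U, k) \<in> \<K>" and s: "s \<in> {0..1}" "p s \<in> U"
  shows "\<forall>\<^sub>F t in nhds s. t \<in> {0..1} \<longrightarrow>
     (path_chain (\<lambda>x. p (t * x)) - path_chain (\<lambda>x. p (s * x)))
     - (- path_chain (\<lambda>x. k (x, p t)) - - path_chain (\<lambda>x. k (x, p s))) \<in> boundaries1 X \<and> p t \<in> U"
proof -
  have "openin unit_interval {t \<in> {0..1}. p t \<in> U}"
    using openin_continuous_map_preimage[OF p[unfolded pathin_def] K_open[OF k]] by simp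
  then obtain e where e: "e > 0" "\<And>t. t \<in> {0..1} \<Longrightarrow> dist t s < e \<Longrightarrow> t \<in> {t \<in> {0..1}. p t \<in> U}"
    using s unfolding openin_euclidean_subtopology_iff by (metis (no_types, lifting) mem_Collect_eq)
  then have e: "e > 0" "\<And>t. t \<in> {0..1} \<Longrightarrow> \<bar>t - s\<bar> < e \<Longrightarrow> p t \<in> U"
    by (auto simp: dist_real_def)
  have "\<forall>\<^sub>F t in nhds s. dist t s < e" using e(1) eventually_nhds_metric by blast
  then show ?thesis
  proof eventually_elim
    case (elim t)
    show ?case
    proof
      assume t: "t \<in> {0..1}"
      have lp: "linepath s t \<in> {0..1} \<rightarrow> {0..1}"
        using s t convexD_alt[of "{0..1::real}" s t] by (auto simp: linepath_def)
      have "\<bar>linepath s t x - s\<bar> < e" if "x \<in> {0..1}" for x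
      proof -
        have "linepath s t x - s = x * (t - s)" by (simp add: linepath_def algebra_simps)
        also have "\<bar>x * (t - s)\<bar> \<le> \<bar>t - s\<bar>" using that by (simp add: abs_mult mult_left_le_one_le)
        also have "\<dots> < e" using elim by (simp add: dist_real_def)
        finally show ?thesis .
      qed
      then have pU: "(\<lambda>x. p (linepath s t x)) \<in> {0..1} \<rightarrow> U" using e(2) lp by blast
      have 1: "path_chain (\<lambda>x. p (linepath s t x)) - (path_chain (\<lambda>x. k (x, p s)) - path_chain (\<lambda>x. k (x, p t))) \<in> boundaries1 X"
        using path_chain_in_cover[OF k pathin_subpath[OF p _ lp] pU] by (simp add: linepath_def continuous_intros)
      have 2: "path_chain (\<lambda>x. p (linepath 0 s x)) + path_chain (\<lambda>x. p (linepath s t x)) - path_chain (\<lambda>x. p (linepath 0 t x)) \<in> boundaries1 X"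
        by (rule boundaries1_triangle[OF p[unfolded pathin_def]]) (use s t in auto)
      have "(path_chain (\<lambda>x. p (t * x)) - path_chain (\<lambda>x. p (s * x)))
         - (- path_chain (\<lambda>x. k (x, p t)) - - path_chain (\<lambda>x. k (x, p s))) \<in> boundaries1 X"
        using boundaries1_diff[OF 1 2] by (simp add: linepath_def algebra_simps)
      then show "(path_chain (\<lambda>x. p (t * x)) - path_chain (\<lambda>x. p (s * x)))
         - (- path_chain (\<lambda>x. k (x, p t)) - - path_chain (\<lambda>x. k (x, p s))) \<in> boundaries1 X \<and> p t \<in> U"
        using e(2)[OF t] elim by (simp add: dist_real_def)
    qed
  qed
qed

end

section \<open>Permutation products\<close>

locale permutation_product =
  fixes X :: "'a topology" and I :: "'i set" and \<Gamma> :: "('i \<Rightarrow> 'i) set" and Q :: "'q topology" and q :: "('i \<Rightarrow> 'a) \<Rightarrow> 'q"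
  assumes finite_I: "finite I"
    and \<Gamma>_permutes: "\<sigma> \<in> \<Gamma> \<Longrightarrow> \<sigma> permutes I"
    and \<Gamma>_id: "id \<in> \<Gamma>"
    and \<Gamma>_comp: "\<sigma> \<in> \<Gamma> \<Longrightarrow> \<tau> \<in> \<Gamma> \<Longrightarrow> \<sigma> \<circ> \<tau> \<in> \<Gamma>"
    and \<Gamma>_inv: "\<sigma> \<in> \<Gamma> \<Longrightarrow> inv' \<sigma> \<in> \<Gamma>"
    and q_quotient: "quotient_map (product_topology (\<lambda>i. X) I) Q q"
    and q_eq: "x \<in> topspace (product_topology (\<lambda>i. X) I) \<Longrightarrow> y \<in> topspace (product_topology (\<lambda>i. X) I)
       \<Longrightarrow> q x = q y \<longleftrightarrow> (\<exists>\<sigma>\<in>\<Gamma>. y = x \<circ> \<sigma>)"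
begin

declare topspace_product_topology [simp del]

abbreviation "Xn \<equiv> product_topology (\<lambda>i. X) I"

lemma topspace_Xn: "x \<in> topspace Xn \<longleftrightarrow> (\<forall>i\<in>I. x i \<in> topspace X) \<and> x \<in> extensional I"
  by (auto simp: PiE_iff topspace_product_topology)

lemma \<Gamma>_in: "\<sigma> \<in> \<Gamma> \<Longrightarrow> \<sigma> i \<in> I \<longleftrightarrow> i \<in> I"
  using permutes_in_image[OF \<Gamma>_permutes] by blast

lemma Xn_comp: "x \<in> topspace Xn \<Longrightarrow> \<sigma> \<in> \<Gamma> \<Longrightarrow> x \<circ> \<sigma> \<in> topspace Xn"
  unfolding topspace_Xn using \<Gamma>_in by (auto simp: extensional_def)

lemma q_comp: "x \<in> topspace Xn \<Longrightarrow> \<sigma> \<in> \<Gamma> \<Longrightarrow> q (x \<circ> \<sigma>) = q x"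
  using q_eq Xn_comp by metis

lemma q_cont: "continuous_map Xn Q q"
  using q_quotient by (simp add: quotient_imp_continuous_map)

lemma q_surj: "y \<in> topspace Q \<Longrightarrow> \<exists>x\<in>topspace Xn. q x = y"
  using quotient_imp_surjective_map[OF q_quotient] by (metis imageE)

lemma continuous_map_comp: "\<sigma> \<in> \<Gamma> \<Longrightarrow> continuous_map Xn Xn (\<lambda>x. x \<circ> \<sigma>)"
proof -
  assume \<sigma>: "\<sigma> \<in> \<Gamma>"
  have "continuous_map Xn X (\<lambda>x. (x \<circ> \<sigma>) i)" if "i \<in> I" for i
    using continuous_map_product_projection[of "\<sigma> i" "I" "\<lambda>_. X"] \<Gamma>_in[OF \<sigma>] that by simp
  then show ?thesis unfolding continuous_map_componentwise using Xn_comp[OF _ \<sigma>] topspace_Xn by blast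
qed

text \<open>The saturation of \<open>W\<close> is the union of its translates, and each permutation
  acts continuously. Openness of \<open>q\<close> replaces any finer knowledge of the quotient
  topology.\<close>

lemma openin_q_image:
  assumes "openin Xn W" shows "openin Q (q ` W)"
proof -
  have W: "W \<subseteq> topspace Xn" using openin_subset[OF assms] .
  have "{x \<in> topspace Xn. q x \<in> q ` W} = (\<Union>\<sigma>\<in>\<Gamma>. {x \<in> topspace Xn. x \<circ> \<sigma> \<in> W})" (is "?L = ?R")
  proof
    show "?L \<subseteq> ?R"
    proof clarify
      fix x w assume x: "x \<in> topspace Xn" "q x = q w" "w \<in> W"
      then obtain \<sigma> where "\<sigma> \<in> \<Gamma>" "w = x \<circ> \<sigma>" using q_eq[of x w] W by blast
      then show "x \<in> ?R" using x by blast
    qed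
    show "?R \<subseteq> ?L"
    proof clarify
      fix x \<sigma> assume x: "x \<in> topspace Xn" "\<sigma> \<in> \<Gamma>" "x \<circ> \<sigma> \<in> W"
      have "q x = q (x \<circ> \<sigma>)" using q_comp x by metis
      then show "q x \<in> q ` W" using x(3) by blast
    qed
  qed
  moreover have "openin Xn \<dots>"
    using openin_continuous_map_preimage[OF continuous_map_comp assms] by blast
  moreover have "q ` W \<subseteq> topspace Q" using W quotient_imp_surjective_map[OF q_quotient] by blast
  then have "openin Xn {x \<in> topspace Xn. q x \<in> q ` W} \<longleftrightarrow> openin Q (q ` W)"
    using q_quotient unfolding quotient_map_def by blast
  ultimately show ?thesis by simp
qed

text \<open>The same \<open>U\<close> is used in all coordinates, so the box is invariant under
  \<Gamma> and membership can be tested on any lift.\<close>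

definition nbhd :: "'a set \<Rightarrow> 'q set" where
  "nbhd U = q ` {x \<in> topspace Xn. \<forall>i\<in>I. x i \<in> U}"

lemma q_in_nbhd: "x \<in> topspace Xn \<Longrightarrow> q x \<in> nbhd U \<longleftrightarrow> (\<forall>i\<in>I. x i \<in> U)"
proof
  assume x: "x \<in> topspace Xn" "q x \<in> nbhd U"
  then obtain y where y: "y \<in> topspace Xn" "\<forall>i\<in>I. y i \<in> U" "q y = q x" by (auto simp: nbhd_def)
  then obtain \<sigma> where "\<sigma> \<in> \<Gamma>" "x = y \<circ> \<sigma>" using q_eq x by blast
  then show "\<forall>i\<in>I. x i \<in> U" using y \<Gamma>_in by auto
qed (auto simp: nbhd_def)

lemma open_box:
  assumes "\<And>i. i \<in> I \<Longrightarrow> openin X (W i)"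
  shows "openin Xn {x \<in> topspace Xn. \<forall>i\<in>I. x i \<in> W i}"
proof -
  have "{x \<in> topspace Xn. \<forall>i\<in>I. x i \<in> W i} = (\<Pi>\<^sub>E i\<in>I. W i)"
    using openin_subset[OF assms] by (auto simp: topspace_Xn PiE_iff extensional_def)
  then show ?thesis using assms by (simp add: openin_PiE finite_I)
qed

lemma openin_nbhd: "openin X U \<Longrightarrow> openin Q (nbhd U)"
  unfolding nbhd_def by (intro openin_q_image open_box)

text \<open>A set-theoretic section without any continuity. Functions built from it are independent
  of the choice: sums over invariant index sets, images under \<open>q\<close>, and coordinates
  fixed by \<Gamma>.\<close>

definition lift :: "'q \<Rightarrow> 'i \<Rightarrow> 'a" where "lift y = (SOME x. x \<in> topspace Xn \<and> q x = y)"

lemma lift: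
  assumes "y \<in> topspace Q" shows "lift y \<in> topspace Xn \<and> q (lift y) = y"
proof -
  obtain x where "x \<in> topspace Xn \<and> q x = y" using q_surj[OF assms] by blast
  then show ?thesis unfolding lift_def by (rule someI[where P="\<lambda>x. x \<in> topspace Xn \<and> q x = y"])
qed

lemma q_in_topspace: "x \<in> topspace Xn \<Longrightarrow> q x \<in> topspace Q"
  using quotient_imp_surjective_map[OF q_quotient] by blast

end

locale covered_permutation_product = permutation_product X I \<Gamma> Q q + contractible_cover X \<K>
  for X :: "'a topology" and I :: "'i set" and \<Gamma> and Q :: "'q topology" and q \<K>
begin

text \<open>The minus sign comes from \<open>path_chain_in_cover\<close>: a path inside
  \<open>U\<close> is homologous to the track of its start minus the track of its end. If
  \<open>B\<close> is invariant, another lift only permutes the summands.\<close>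

definition potential :: "'i set \<Rightarrow> (real \<times> 'a \<Rightarrow> 'a) \<Rightarrow> 'q \<Rightarrow> (real \<Rightarrow> 'a) \<Rightarrow>\<^sub>0 int" where
  "potential B k y = (\<Sum>i\<in>B. - path_chain (\<lambda>t. k (t, lift y i)))"

lemma potential_q:
  assumes B: "\<And>\<sigma>. \<sigma> \<in> \<Gamma> \<Longrightarrow> \<sigma> ` B = B" and x: "x \<in> topspace Xn"
  shows "potential B k (q x) = (\<Sum>i\<in>B. - path_chain (\<lambda>t. k (t, x i)))"
proof -
  have "lift (q x) \<in> topspace Xn" "q (lift (q x)) = q x" using lift[OF q_in_topspace[OF x]] by auto
  then obtain \<sigma> where \<sigma>: "\<sigma> \<in> \<Gamma>" "lift (q x) = x \<circ> \<sigma>" using q_eq x by metis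
  have "bij_betw \<sigma> B B" using B[OF \<sigma>(1)] permutes_inj_on[OF \<Gamma>_permutes[OF \<sigma>(1)]] by (auto simp: bij_betw_def)
  from sum.reindex_bij_betw[OF this, of "\<lambda>i. - path_chain (\<lambda>t. k (t, x i))"] show ?thesis
    by (simp add: potential_def \<sigma>(2))
qed

text \<open>Compatibility is obtained in each coordinate of a lift from \<open>K_compat\<close>; the
  box of the resulting neighbourhoods is pushed down by the open map \<open>q\<close>.\<close>

lemma local_potentials:
  assumes B: "\<And>\<sigma>. \<sigma> \<in> \<Gamma> \<Longrightarrow> \<sigma> ` B = B" "B \<subseteq> I"
  shows "local_potentials Q {(nbhd U, potential B k) | U k. (U, k) \<in> \<K>} (boundaries1 X)"
proof
  fix V F assume "(V, F) \<in> {(nbhd U, potential B k) | U k. (U, k) \<in> \<K>}"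
  then show "openin Q V" using K_open openin_nbhd by auto
next
  fix y assume "y \<in> topspace Q"
  then obtain x where x: "x \<in> topspace Xn" "q x = y" using q_surj by blast
  have "finite (x ` I)" "x ` I \<subseteq> topspace X" using x finite_I by (auto simp: topspace_Xn)
  from K_cover[OF this] obtain U k where "(U, k) \<in> \<K>" "x ` I \<subseteq> U" by blast
  moreover have "y \<in> nbhd U" using q_in_nbhd[OF x(1), of U] x(2) calculation(2) by auto
  ultimately show "\<exists>V F. (V, F) \<in> {(nbhd U, potential B k) | U k. (U, k) \<in> \<K>} \<and> y \<in> V" by blast
next
  fix V F W G y assume "(V, F) \<in> {(nbhd U, potential B k) | U k. (U, k) \<in> \<K>}" "(W, G) \<in> {(nbhd U, potential B k) | U k. (U, k) \<in> \<K>}"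
    and y: "y \<in> V" "y \<in> W"
  then obtain U k U' l where k: "(U, k) \<in> \<K>" "V = nbhd U" "F = potential B k" and l: "(U', l) \<in> \<K>" "W = nbhd U'" "G = potential B l"
    by blast
  have "y \<in> topspace Q" using y openin_subset[OF openin_nbhd[OF K_open[OF k(1)]]] k by blast
  then obtain x where x: "x \<in> topspace Xn" "q x = y" using q_surj by blast
  have xU: "x i \<in> U" "x i \<in> U'" if "i \<in> I" for i using y q_in_nbhd[OF x(1)] x(2) k l that by auto
  have "\<forall>i\<in>I. \<exists>V. openin X V \<and> x i \<in> V \<and> (\<forall>z\<in>V \<inter> U \<inter> U'.
         (path_chain (\<lambda>t. k (t, z)) - path_chain (\<lambda>t. k (t, x i)))
       - (path_chain (\<lambda>t. l (t, z)) - path_chain (\<lambda>t. l (t, x i))) \<in> boundaries1 X)"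
    by (intro ballI K_compat[OF k(1) l(1)] xU)
  then obtain N where N: "\<And>i. i \<in> I \<Longrightarrow> openin X (N i)" "\<And>i. i \<in> I \<Longrightarrow> x i \<in> N i"
      "\<And>i z. i \<in> I \<Longrightarrow> z \<in> N i \<inter> U \<inter> U' \<Longrightarrow> (path_chain (\<lambda>t. k (t, z)) - path_chain (\<lambda>t. k (t, x i)))
       - (path_chain (\<lambda>t. l (t, z)) - path_chain (\<lambda>t. l (t, x i))) \<in> boundaries1 X"
    by metis
  let ?W = "{x \<in> topspace Xn. \<forall>i\<in>I. x i \<in> N i \<inter> U \<inter> U'}"
  show "\<exists>O'. openin Q O' \<and> y \<in> O' \<and> (\<forall>z\<in>O'. (F z - F y) - (G z - G y) \<in> boundaries1 X)"
  proof (intro exI conjI ballI)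
    show "openin Q (q ` ?W)" by (intro openin_q_image open_box openin_Int N K_open[OF k(1)] K_open[OF l(1)])
    have "x \<in> ?W" using x(1) N(2) xU by simp
    then show "y \<in> q ` ?W" unfolding x(2)[symmetric] by (rule imageI)
    fix z assume "z \<in> q ` ?W"
    then obtain w where w: "z = q w" "w \<in> topspace Xn" "\<And>i. i \<in> I \<Longrightarrow> w i \<in> N i \<inter> U \<inter> U'" by blast
    have "(\<Sum>i\<in>B. - ((path_chain (\<lambda>t. k (t, w i)) - path_chain (\<lambda>t. k (t, x i)))
       - (path_chain (\<lambda>t. l (t, w i)) - path_chain (\<lambda>t. l (t, x i))))) \<in> boundaries1 X"
      by (intro boundaries1_sum boundaries1_uminus N w) (use B(2) in auto)
    then show "(F z - F y) - (G z - G y) \<in> boundaries1 X"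
      by (simp add: k(3) l(3) w(1) x(2)[symmetric] potential_q[OF B(1) w(2)] potential_q[OF B(1) x(1)]
           algebra_simps sum.distrib sum_subtractf sum_negf)
  qed
qed (auto intro: boundaries1_diff)

text \<open>The homotopy in \<open>Q\<close> is never lifted. The sum over \<open>B\<close> of the
  initial segments of the coordinates of \<open>p\<close> is a primitive along the path
  \<open>q \<circ> p\<close>, so its total increment is the integral of the potentials along a path
  in \<open>Q\<close>, and such integrals are homotopy invariant.\<close>

lemma homologous_if_q_homotopic:
  assumes B: "\<And>\<sigma>. \<sigma> \<in> \<Gamma> \<Longrightarrow> \<sigma> ` B = B" "B \<subseteq> I"
    and p: "pathin Xn p" "pathin Xn p'" and h: "path_homotopic Q (\<lambda>t. q (p t)) (\<lambda>t. q (p' t))"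
  shows "(\<Sum>i\<in>B. path_chain (\<lambda>t. p t i)) - (\<Sum>i\<in>B. path_chain (\<lambda>t. p' t i)) \<in> boundaries1 X"
proof -
  interpret L: local_potentials Q "{(nbhd U, potential B k) | U k. (U, k) \<in> \<K>}" "boundaries1 X"
    by (rule local_potentials[OF B])
  have fB: "finite B" by (rule finite_subset[OF B(2) finite_I])
  have comp: "pathin X (\<lambda>t. p t i)" if "pathin Xn p" "i \<in> B" for p i
    using that B(2) unfolding pathin_def continuous_map_componentwise by auto
  define \<phi> where "\<phi> p t = (\<Sum>i\<in>B. path_chain (\<lambda>x. p (t * x) i))" for p :: "real \<Rightarrow> 'i \<Rightarrow> 'a" and t
  have prim: "L.primitive {0..1} (\<lambda>t. q (p t)) (\<phi> p)" if p: "pathin Xn p" for p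
    unfolding L.primitive_def
  proof clarify
    fix s :: real and V F U k assume s: "s \<in> {0..1}" and k: "(U, k) \<in> \<K>" and qs: "q (p s) \<in> nbhd U"
    have pt: "p t \<in> topspace Xn" if "t \<in> {0..1}" for t using p that unfolding pathin_def by (auto simp: continuous_map_def)
    have "\<forall>\<^sub>F t in nhds s. \<forall>i\<in>B. t \<in> {0..1} \<longrightarrow>
     (path_chain (\<lambda>x. p (t * x) i) - path_chain (\<lambda>x. p (s * x) i))
     - (- path_chain (\<lambda>x. k (x, p t i)) - - path_chain (\<lambda>x. k (x, p s i))) \<in> boundaries1 X \<and> p t i \<in> U"
    proof (rule eventually_ball_finite[OF fB], rule)
      fix i assume i: "i \<in> B"
      have "p s i \<in> U" using qs q_in_nbhd[OF pt[OF s]] i B(2) by blast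
      from path_chain_initial_primitive[OF comp[OF p i] k s this]
      show "\<forall>\<^sub>F t in nhds s. t \<in> {0..1} \<longrightarrow>
         (path_chain (\<lambda>x. p (t * x) i) - path_chain (\<lambda>x. p (s * x) i))
         - (- path_chain (\<lambda>x. k (x, p t i)) - - path_chain (\<lambda>x. k (x, p s i))) \<in> boundaries1 X \<and> p t i \<in> U" .
    qed
    then show "\<forall>\<^sub>F t in nhds s. t \<in> {0..1} \<longrightarrow> \<phi> p t - \<phi> p s - (potential B k (q (p t)) - potential B k (q (p s))) \<in> boundaries1 X"
    proof eventually_elim
      case (elim t)
      show ?case
      proof
        assume t: "t \<in> {0..1}"
        have "(\<Sum>i\<in>B. (path_chain (\<lambda>x. p (t * x) i) - path_chain (\<lambda>x. p (s * x) i))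
         - (- path_chain (\<lambda>x. k (x, p t i)) - - path_chain (\<lambda>x. k (x, p s i)))) \<in> boundaries1 X"
          by (intro boundaries1_sum) (use elim t in auto)
        then show "\<phi> p t - \<phi> p s - (potential B k (q (p t)) - potential B k (q (p s))) \<in> boundaries1 X"
          by (simp add: potential_q[OF B(1) pt[OF t]] potential_q[OF B(1) pt[OF s]] \<phi>_def sum_subtractf sum.distrib sum_negf algebra_simps)
      qed
    qed
  qed
  \<comment> \<open>At time 0 the initial segments are constant simplices, which are boundaries but
    not zero.\<close>
  have 0: "\<phi> p 0 \<in> boundaries1 X" if "pathin Xn p" for p
    unfolding \<phi>_def using path_start_in_topspace[OF comp[OF that]] by (auto intro!: boundaries1_sum boundaries1_const)
  have 1: "\<phi> p 1 = (\<Sum>i\<in>B. path_chain (\<lambda>t. p t i))" for p by (simp add: \<phi>_def)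
  have "(\<phi> p 1 - \<phi> p 0) - (\<phi> p' 1 - \<phi> p' 0) \<in> boundaries1 X"
    by (rule L.integral_path_homotopic[OF h prim[OF p(1)] prim[OF p(2)]])
  from boundaries1_add[OF boundaries1_diff[OF this 0[OF p(2)]] 0[OF p(1)]]
  show ?thesis by (simp add: 1)
qed

end

section \<open>Lifting paths from the quotient up to homotopy\<close>

lemma path_join_comp: "(\<lambda>t. f (path_join p q t)) = path_join (\<lambda>t. f (p t)) (\<lambda>t. f (q t))"
  by (auto simp: path_join_def)

text \<open>The square is convex, so one of its sides is homotopic to the path along the other
  three. For a deformation of a path, two of these are tracks of the ends and the third is the final
  map.\<close>

lemma path_homotopic_around_square:
  assumes h: "continuous_map unit_square X h"
  shows "path_homotopic X (\<lambda>s. h (0, s)) (path_join (\<lambda>t. h (t, 0)) (path_join (\<lambda>s. h (1, s)) (path_rev (\<lambda>t. h (t, 1)))))"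
proof -
  let ?S = "{0..1} \<times> {0..1} :: (real \<times> real) set"
  let ?\<psi> = "path_join (\<lambda>t. (t, 0)) (path_join (\<lambda>s. (1, s)) (path_rev (\<lambda>t. (t, 1)))) :: real \<Rightarrow> real \<times> real"
  have side: "pathin (top_of_set ?S) f" if "continuous_on {0..1} f" "f \<in> {0..1} \<rightarrow> ?S" for f
    using that by (simp add: pathin_def continuous_map_in_subtopology)
  have "pathin (top_of_set ?S) ?\<psi>"
    by (intro pathin_join pathin_rev side) (auto intro!: continuous_intros)
  then have \<psi>: "continuous_on {0..1} ?\<psi>" "?\<psi> \<in> {0..1} \<rightarrow> ?S"
    by (auto simp: pathin_def continuous_map_in_subtopology)
  have "path_homotopic X (\<lambda>s. h (0, s)) (\<lambda>t. h (?\<psi> t))"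
    by (rule path_homotopic_convex[OF _ h[unfolded prod_top_of_set], where \<phi>="\<lambda>s. (0, s)" and \<psi>="?\<psi>"])
       (use \<psi> in \<open>auto intro!: continuous_intros convex_Times\<close>)
  then show ?thesis unfolding path_join_comp by (simp add: path_rev_def)
qed

context covered_permutation_product
begin

definition deform :: "(real \<times> 'a \<Rightarrow> 'a) \<Rightarrow> real \<times> 'q \<Rightarrow> 'q" where
  "deform k z = q (\<lambda>i\<in>I. k (fst z, lift (snd z) i))"

lemma k_in_topspace: "(U, k) \<in> \<K> \<Longrightarrow> u \<in> U \<Longrightarrow> t \<in> {0..1} \<Longrightarrow> k (t, u) \<in> topspace X"
  using K_track[of U k u] by (auto simp: pathin_def continuous_map_def)

lemma deform_q:
  assumes k: "(U, k) \<in> \<K>" and x: "x \<in> topspace Xn" "\<And>i. i \<in> I \<Longrightarrow> x i \<in> U" and t: "t \<in> {0..1}"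
  shows "deform k (t, q x) = q (\<lambda>i\<in>I. k (t, x i))"
proof -
  have "lift (q x) \<in> topspace Xn" "q (lift (q x)) = q x" using lift[OF q_in_topspace[OF x(1)]] by auto
  then obtain \<sigma> where \<sigma>: "\<sigma> \<in> \<Gamma>" "lift (q x) = x \<circ> \<sigma>" using q_eq x(1) by metis
  have "(\<lambda>i\<in>I. k (t, lift (q x) i)) = (\<lambda>i\<in>I. k (t, x i)) \<circ> \<sigma>"
    using \<Gamma>_in[OF \<sigma>(1)] by (auto simp: \<sigma>(2))
  moreover have "(\<lambda>i\<in>I. k (t, x i)) \<in> topspace Xn"
    using k_in_topspace[OF k x(2) t] by (auto simp: topspace_Xn)
  ultimately show ?thesis using q_comp[OF _ \<sigma>(1)] by (simp add: deform_def)
qed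

text \<open>\<open>deform\<close> is built from the discontinuous \<open>lift\<close>, so continuity
  is tested after composition with the identity times \<open>q\<close> over \<open>nbhd U\<close>.
  That map is a quotient map because it is continuous, open and onto; upstairs the deformation is
  coordinatewise.\<close>

lemma continuous_deform:
  assumes k: "(U, k) \<in> \<K>"
  shows "continuous_map (prod_topology unit_interval (subtopology Q (nbhd U))) Q (deform k)"
proof -
  let ?U = "{x \<in> topspace Xn. \<forall>i\<in>I. x i \<in> U}"
  let ?A = "prod_topology unit_interval (subtopology Xn ?U)" and ?B = "prod_topology unit_interval (subtopology Q (nbhd U))"
  let ?m = "\<lambda>z. (fst z, q (snd z))"
  have oU: "openin Xn ?U" by (intro open_box K_open[OF k])
  have tA: "z \<in> topspace ?A \<longleftrightarrow> fst z \<in> {0..1} \<and> snd z \<in> ?U" for z by (cases z) auto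
  have tB: "z \<in> topspace ?B \<longleftrightarrow> fst z \<in> {0..1} \<and> snd z \<in> nbhd U" for z
    using openin_subset[OF openin_nbhd[OF K_open[OF k]]] by (cases z) auto
  have s1: "continuous_map ?A unit_interval fst" and s2: "continuous_map ?A (subtopology Xn ?U) snd"
    by (auto intro: continuous_map_fst continuous_map_snd)
  have s3: "continuous_map ?A Xn snd" using s2 continuous_map_in_subtopology by blast
  have "quotient_map ?A ?B ?m"
  proof (rule continuous_open_imp_quotient_map)
    show "continuous_map ?A ?B ?m"
      unfolding continuous_map_pairwise o_def fst_conv snd_conv continuous_map_in_subtopology
      using s1 continuous_map_compose[OF s3 q_cont] by (auto simp: o_def tA nbhd_def continuous_map_in_subtopology q_in_topspace)
    show "open_map ?A ?B ?m"
      unfolding open_map_def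
    proof (intro allI impI)
      fix W assume W: "openin ?A W"
      show "openin ?B (?m ` W)"
        unfolding openin_prod_topology_alt
      proof (intro allI impI)
        fix t y assume "(t, y) \<in> ?m ` W"
        then obtain x where x: "(t, x) \<in> W" "y = q x" by auto
        then obtain S V where SV: "openin unit_interval S" "openin (subtopology Xn ?U) V" "t \<in> S" "x \<in> V" "S \<times> V \<subseteq> W"
          using W unfolding openin_prod_topology_alt by meson
        have V: "openin Xn V" "V \<subseteq> ?U" using SV(2) oU openin_open_subtopology by blast+
        have "openin (subtopology Q (nbhd U)) (q ` V)"
          using openin_q_image[OF V(1)] V(2) unfolding nbhd_def
          by (auto simp: openin_open_subtopology[OF openin_nbhd[OF K_open[OF k], unfolded nbhd_def]])
        moreover have "S \<times> q ` V \<subseteq> ?m ` W" using SV(5) by force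
        ultimately show "\<exists>S V. openin unit_interval S \<and> openin (subtopology Q (nbhd U)) V \<and> t \<in> S \<and> y \<in> V \<and> S \<times> V \<subseteq> ?m ` W"
          using SV x(2) by blast
      qed
    qed
    show "?m ` topspace ?A = topspace ?B"
    proof
      show "?m ` topspace ?A \<subseteq> topspace ?B" using tA tB by (auto simp: nbhd_def q_in_topspace)
      show "topspace ?B \<subseteq> ?m ` topspace ?A"
      proof
        fix z assume "z \<in> topspace ?B"
        then have "fst z \<in> {0..1} \<and> snd z \<in> nbhd U" unfolding tB .
        then obtain x where "x \<in> ?U" "snd z = q x" "fst z \<in> {0..1}" unfolding nbhd_def by blast
        then have "(fst z, x) \<in> topspace ?A" "z = ?m (fst z, x)" unfolding tA by (auto simp: prod_eq_iff)
        then show "z \<in> ?m ` topspace ?A" by (intro image_eqI)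
      qed
    qed
  qed
  moreover have "continuous_map ?A Q (deform k \<circ> ?m)"
  proof (rule continuous_map_cong)
    have "continuous_map ?A Xn (\<lambda>z. \<lambda>i\<in>I. k (fst z, snd z i))"
      unfolding continuous_map_componentwise
    proof (intro conjI ballI)
      fix i assume i: "i \<in> I"
      have "continuous_map ?A X (\<lambda>z. snd z i)"
        using continuous_map_compose[OF s3 continuous_map_product_projection[OF i]] by (simp add: o_def)
      then have "continuous_map ?A (prod_topology unit_interval (subtopology X U)) (\<lambda>z. (fst z, snd z i))"
        using s1 i by (auto simp: continuous_map_pairwise o_def continuous_map_in_subtopology tA)
      from continuous_map_compose[OF this K_cont[OF k]]
      show "continuous_map ?A X (\<lambda>z. (\<lambda>i\<in>I. k (fst z, snd z i)) i)" using i by (simp add: o_def)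
    qed auto
    from continuous_map_compose[OF this q_cont]
    show "continuous_map ?A Q (\<lambda>z. q (\<lambda>i\<in>I. k (fst z, snd z i)))" by (simp add: o_def)
    show "q (\<lambda>i\<in>I. k (fst z, snd z i)) = (deform k \<circ> ?m) z" if "z \<in> topspace ?A" for z
      using that deform_q[OF k, of "snd z" "fst z"] unfolding tA by auto
  qed
  ultimately show ?thesis by (rule continuous_compose_quotient_map)
qed

lemma deform_0: "(U, k) \<in> \<K> \<Longrightarrow> y \<in> nbhd U \<Longrightarrow> deform k (0, y) = y"
proof -
  assume k: "(U, k) \<in> \<K>" and "y \<in> nbhd U"
  then obtain x where x: "x \<in> topspace Xn" "\<And>i. i \<in> I \<Longrightarrow> x i \<in> U" "y = q x" by (auto simp: nbhd_def)
  have "(\<lambda>i\<in>I. k (0, x i)) = x" using x K_0[OF k x(2)] by (auto simp: topspace_Xn extensional_def)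
  then show ?thesis using deform_q[OF k x(1,2), of 0] x(3) by simp
qed

lemma deform_1_locally_const:
  assumes k: "(U, k) \<in> \<K>" and y: "y \<in> nbhd U"
  shows "\<exists>W. openin Q W \<and> y \<in> W \<and> (\<forall>z\<in>W. deform k (1, z) = deform k (1, y))"
proof -
  obtain x where x: "x \<in> topspace Xn" "\<And>i. i \<in> I \<Longrightarrow> x i \<in> U" "y = q x" using y by (auto simp: nbhd_def)
  have "\<forall>i\<in>I. \<exists>V. openin X V \<and> x i \<in> V \<and> (\<forall>v\<in>V \<inter> U. k (1, v) = k (1, x i))"
    by (intro ballI K_1[OF k] x)
  then obtain V where V: "\<And>i. i \<in> I \<Longrightarrow> openin X (V i)" "\<And>i. i \<in> I \<Longrightarrow> x i \<in> V i"
    "\<And>i v. i \<in> I \<Longrightarrow> v \<in> V i \<inter> U \<Longrightarrow> k (1, v) = k (1, x i)" by metis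
  let ?W = "{x \<in> topspace Xn. \<forall>i\<in>I. x i \<in> V i \<inter> U}"
  show ?thesis
  proof (intro exI conjI ballI)
    show "openin Q (q ` ?W)" by (intro openin_q_image open_box openin_Int V K_open[OF k])
    have "x \<in> ?W" using x V(2) by simp
    then show "y \<in> q ` ?W" unfolding x(3) by (rule imageI)
    fix z assume "z \<in> q ` ?W"
    then obtain w where w: "w \<in> topspace Xn" "\<And>i. i \<in> I \<Longrightarrow> w i \<in> V i \<inter> U" "z = q w" by blast
    have "(\<lambda>i\<in>I. k (1, w i)) = (\<lambda>i\<in>I. k (1, x i))" using V(3) w(2) by (auto intro!: restrict_ext)
    then show "deform k (1, z) = deform k (1, y)"
      using deform_q[OF k w(1), of 1] deform_q[OF k x(1,2), of 1] w x(3) by simp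
  qed
qed

lemma deform_1_const:
  assumes k: "(U, k) \<in> \<K>" and p: "continuous_map (top_of_set S) Q p" "p ` S \<subseteq> nbhd U" and S: "connected S" "a \<in> S" "b \<in> S"
  shows "deform k (1, p a) = deform k (1, p b)"
proof (rule locally_const_along_connected[OF p(1) S, where f="\<lambda>y. deform k (1, y)"])
  fix s assume "s \<in> S"
  then have "p s \<in> nbhd U" using p(2) by blast
  from deform_1_locally_const[OF k this]
  show "\<exists>V. openin Q V \<and> p s \<in> V \<and> (\<forall>t\<in>S. p t \<in> V \<longrightarrow> deform k (1, p t) = deform k (1, p s))" by blast
qed

lemma pathin_Xn:
  assumes "\<And>i. i \<in> I \<Longrightarrow> pathin X (\<lambda>t. p t i)" "\<And>t. p t \<in> extensional I"
  shows "pathin Xn p"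
  using assms unfolding pathin_def continuous_map_componentwise by auto

text \<open>Inside \<open>nbhd U\<close> a path is homotopic, with fixed ends, to the track of its
  start followed by the reversed track of its end. Tracks lift to X^n because the deformation is
  coordinatewise; it remains to make the two lifted tracks meet.\<close>

lemma lift_path_in_nbhd:
  assumes k: "(U, k) \<in> \<K>" and p: "pathin Q p" "p \<in> {0..1} \<rightarrow> nbhd U" and x: "x \<in> topspace Xn" "q x = p 0"
  shows "\<exists>r. pathin Xn r \<and> r 0 = x \<and> path_homotopic Q p (\<lambda>t. q (r t))"
proof -
  have pU: "p 0 \<in> nbhd U" "p 1 \<in> nbhd U" using p(2) by auto
  then obtain y where y: "y \<in> topspace Xn" "\<And>i. i \<in> I \<Longrightarrow> y i \<in> U" "p 1 = q y" by (auto simp: nbhd_def)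
  have xU: "x i \<in> U" if "i \<in> I" for i using pU q_in_nbhd[OF x(1)] x(2) that by metis
  have top: "(\<lambda>i\<in>I. k (1, x i)) \<in> topspace Xn" "(\<lambda>i\<in>I. k (1, y i)) \<in> topspace Xn"
    using k_in_topspace[OF k, of _ 1] xU y(2) by (auto simp: topspace_Xn)
  have "deform k (1, p 0) = deform k (1, p 1)"
    by (rule deform_1_const[OF k p(1)[unfolded pathin_def]]) (use p(2) in auto)
  then have "q (\<lambda>i\<in>I. k (1, y i)) = q (\<lambda>i\<in>I. k (1, x i))"
    using deform_q[OF k x(1) xU, of 1] deform_q[OF k y(1,2), of 1] x(2) y(3) by simp
  \<comment> \<open>The lifted tracks end over the same point of \<open>Q\<close>, hence differ by
    some \<sigma>. Replacing the lift \<open>y\<close> of the end point by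
    \<open>y \<circ> \<sigma>\<close> makes them end at the same point of X^n; this is where the end
    of the lift is no longer free to choose.\<close>
  then obtain \<sigma> where \<sigma>: "\<sigma> \<in> \<Gamma>" "(\<lambda>i\<in>I. k (1, x i)) = (\<lambda>i\<in>I. k (1, y i)) \<circ> \<sigma>"
    using q_eq top by metis
  have ys: "y \<circ> \<sigma> \<in> topspace Xn" "q (y \<circ> \<sigma>) = p 1" "\<And>i. i \<in> I \<Longrightarrow> (y \<circ> \<sigma>) i \<in> U"
    using Xn_comp[OF y(1) \<sigma>(1)] q_comp[OF y(1) \<sigma>(1)] y(2,3) \<Gamma>_in[OF \<sigma>(1)] by auto
  define T where "T z t = (\<lambda>i\<in>I. k (t, z i))" for z :: "'i \<Rightarrow> 'a" and t
  have T: "pathin Xn (T z)" if "\<And>i. i \<in> I \<Longrightarrow> z i \<in> U" for z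
    unfolding T_def by (rule pathin_Xn) (use K_track[OF k that] in auto)
  have eq: "T x 1 = T (y \<circ> \<sigma>) 1" using \<sigma>(2) \<Gamma>_in[OF \<sigma>(1)] by (auto simp: T_def fun_eq_iff)
  let ?r = "path_join (T x) (path_rev (T (y \<circ> \<sigma>)))"
  have r: "pathin Xn ?r" by (intro pathin_join pathin_rev T xU ys) (auto simp: eq)
  have r0: "?r 0 = x" using x(1) K_0[OF k xU] by (auto simp: T_def topspace_Xn extensional_def)
  have qT: "q (T z t) = deform k (t, q z)" if "z \<in> topspace Xn" "\<And>i. i \<in> I \<Longrightarrow> z i \<in> U" "t \<in> {0..1}" for z t
    using deform_q[OF k that] by (simp add: T_def)
  let ?h = "\<lambda>z. deform k (fst z, p (snd z))"
  have "continuous_map unit_square (prod_topology unit_interval (subtopology Q (nbhd U))) (\<lambda>z. (fst z, p (snd z)))"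
    unfolding continuous_map_pairwise o_def fst_conv snd_conv
  proof
    show "continuous_map unit_square unit_interval fst"
      by (rule continuous_map_fst)
    show "continuous_map unit_square (subtopology Q (nbhd U)) (\<lambda>x. p (snd x))"
      using continuous_map_compose[OF continuous_map_snd p(1)[unfolded pathin_def], of unit_interval] p(2)
      by (auto simp: continuous_map_in_subtopology o_def Pi_iff)
  qed
  from continuous_map_compose[OF this continuous_deform[OF k]]
  have h: "continuous_map unit_square Q ?h" by (simp add: o_def)
  have "path_homotopic Q p (\<lambda>s. ?h (0, s))"
    by (rule path_homotopic_eqI[OF p(1)]) (use deform_0[OF k] p(2) in \<open>auto simp: Pi_iff\<close>)
  also have "path_homotopic Q \<dots> (path_join (\<lambda>t. ?h (t, 0)) (path_join (\<lambda>s. ?h (1, s)) (path_rev (\<lambda>t. ?h (t, 1)))))"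
    by (rule path_homotopic_around_square[OF h])
  also have "path_homotopic Q \<dots> (path_join (\<lambda>t. q (T x t)) (path_rev (\<lambda>t. q (T (y \<circ> \<sigma>) t))))"
  proof (rule path_homotopic_join)
    have side: "path_homotopic Q (\<lambda>t. ?h (t, c)) (\<lambda>t. q (T z t))"
      if "z \<in> topspace Xn" "\<And>i. i \<in> I \<Longrightarrow> z i \<in> U" "p c = q z" for z c
      by (rule path_homotopic_sym, rule path_homotopic_eqI)
         (use pathin_compose[OF T[OF that(2)] q_cont] qT[OF that(1,2)] that(3) in \<open>auto simp: o_def\<close>)
    show s1: "path_homotopic Q (\<lambda>t. ?h (t, 0)) (\<lambda>t. q (T x t))" by (rule side) (use x xU in auto)
    have s2: "path_homotopic Q (\<lambda>t. ?h (t, 1)) (\<lambda>t. q (T (y \<circ> \<sigma>) t))" by (rule side) (use ys in auto)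
    let ?c = "deform k (1, p 1)"
    have top: "path_homotopic Q (\<lambda>s. ?h (1, s)) (\<lambda>_. ?c)"
    proof (rule path_homotopic_sym, rule path_homotopic_eqI)
      show "pathin Q (\<lambda>_. ?c)" using path_finish_in_topspace[OF path_homotopic_imp_pathin(1)[OF s2]] by simp
      show "?c = ?h (1, t)" if "0 \<le> t" "t \<le> 1" for t
        using deform_1_const[OF k p(1)[unfolded pathin_def], of 1 t] p(2) that by auto
    qed
    have s3: "path_homotopic Q (path_rev (\<lambda>t. ?h (t, 1))) (path_rev (\<lambda>t. q (T (y \<circ> \<sigma>) t)))"
      by (rule path_homotopic_rev[OF s2])
    have "path_homotopic Q (path_join (\<lambda>s. ?h (1, s)) (path_rev (\<lambda>t. ?h (t, 1)))) (path_join (\<lambda>_. ?c) (path_rev (\<lambda>t. q (T (y \<circ> \<sigma>) t))))"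
      by (rule path_homotopic_join[OF top s3]) simp
    also have "path_homotopic Q \<dots> (path_rev (\<lambda>t. q (T (y \<circ> \<sigma>) t)))"
      by (rule path_homotopic_lid[OF path_homotopic_imp_pathin(2)[OF s3]])
         (use path_homotopic_imp_ends(2)[OF s2] in simp)
    finally show "path_homotopic Q (path_join (\<lambda>s. ?h (1, s)) (path_rev (\<lambda>t. ?h (t, 1)))) (path_rev (\<lambda>t. q (T (y \<circ> \<sigma>) t)))" .
    show "?h (1, 0) = path_join (\<lambda>s. ?h (1, s)) (path_rev (\<lambda>t. ?h (t, 1))) 0" by simp
  qed
  also have "path_join (\<lambda>t. q (T x t)) (path_rev (\<lambda>t. q (T (y \<circ> \<sigma>) t))) = (\<lambda>t. q (?r t))"
    unfolding path_join_comp by (simp add: path_rev_def)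
  finally show ?thesis using r r0 by blast
qed

theorem lift_path:
  assumes p: "pathin Q p" and x: "x \<in> topspace Xn" "q x = p 0"
  obtains r where "pathin Xn r" "r 0 = x" "path_homotopic Q p (\<lambda>t. q (r t))"
proof -
  \<comment> \<open>Extended by constants to the whole line, as the intervals around a point in the
    bisection principle may leave [0,1].\<close>
  define p' where "p' t = p (min 1 (max 0 t))" for t
  have p'c: "continuous_map euclidean Q p'"
  proof -
    have "continuous_on UNIV (\<lambda>t::real. min 1 (max 0 t))" by (intro continuous_intros)
    from continuous_map_compose_on[OF p[unfolded pathin_def] this] show ?thesis
      unfolding p'_def by auto
  qed
  define R where "R a b \<longleftrightarrow> (\<forall>x\<in>topspace Xn. q x = p' a \<longrightarrow> (\<exists>r. pathin Xn r \<and> r 0 = x \<and>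
     path_homotopic Q (\<lambda>t. p' (linepath a b t)) (\<lambda>t. q (r t))))" for a b
  have pl: "pathin Q (\<lambda>t. p' (linepath a b t))" for a b
    using continuous_map_compose_on[of UNIV Q p' "{0..1}" "linepath a b"] p'c by (simp add: pathin_def continuous_on_linepath)
  have "(0::real) \<le> 1" by simp
  then have "R 0 1"
  proof (induction rule: Bolzano)
    case (trans a b c)
    show ?case unfolding R_def
    proof (intro ballI impI)
      fix x assume x: "x \<in> topspace Xn" "q x = p' a"
      obtain r where r: "pathin Xn r" "r 0 = x" "path_homotopic Q (\<lambda>t. p' (linepath a b t)) (\<lambda>t. q (r t))"
        using trans(1) x unfolding R_def by blast
      have "q (r 1) = p' b" using path_homotopic_imp_ends(2)[OF r(3)] by (simp add: linepath_def)
      then obtain s where s: "pathin Xn s" "s 0 = r 1" "path_homotopic Q (\<lambda>t. p' (linepath b c t)) (\<lambda>t. q (s t))"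
        using trans(2) path_finish_in_topspace[OF r(1)] unfolding R_def by blast
      let ?\<psi> = "path_join (linepath a b) (linepath b c)"
      have "path_homotopic Q (\<lambda>t. p' (linepath a c t)) (\<lambda>t. p' (?\<psi> t))"
      proof (rule path_homotopic_convex[where S=UNIV and P=p' and \<phi>="linepath a c" and \<psi>="?\<psi>"])
        have "pathin euclideanreal ?\<psi>" by (rule pathin_join) (auto simp: pathin_def linepath_def intro!: continuous_intros)
        then show "continuous_on {0..1} ?\<psi>" by (simp add: pathin_def)
      qed (use p'c in \<open>auto simp: linepath_def intro!: continuous_intros\<close>)
      also have "(\<lambda>t. p' (?\<psi> t)) = path_join (\<lambda>t. p' (linepath a b t)) (\<lambda>t. p' (linepath b c t))"
        by (rule path_join_comp)
      also have "path_homotopic Q \<dots> (path_join (\<lambda>t. q (r t)) (\<lambda>t. q (s t)))"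
        by (rule path_homotopic_join[OF r(3) s(3)]) (simp add: linepath_def)
      also have "\<dots> = (\<lambda>t. q (path_join r s t))" by (rule path_join_comp[of q r s, symmetric])
      finally show "\<exists>r. pathin Xn r \<and> r 0 = x \<and> path_homotopic Q (\<lambda>t. p' (linepath a c t)) (\<lambda>t. q (r t))"
        using pathin_join[OF r(1) s(1)] s(2) r(2) by (intro exI[where x="path_join r s"]) auto
    qed
  next
    case (local c)
    have "p' c \<in> topspace Q" using p'c by (auto simp: continuous_map_def)
    then obtain z where z: "z \<in> topspace Xn" "q z = p' c" using q_surj by blast
    have "finite (z ` I)" "z ` I \<subseteq> topspace X" using z finite_I by (auto simp: topspace_Xn)
    from K_cover[OF this] obtain U k where k: "(U, k) \<in> \<K>" "z ` I \<subseteq> U" by blast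
    have "p' c \<in> nbhd U" using q_in_nbhd[OF z(1), of U] z(2) k(2) by auto
    moreover have "open {t. p' t \<in> nbhd U}" using openin_continuous_map_preimage[OF p'c openin_nbhd[OF K_open[OF k(1)]]] by simp
    ultimately obtain d where d: "d > 0" "\<And>t. dist t c < d \<Longrightarrow> p' t \<in> nbhd U" unfolding open_dist by blast
    have "R a b" if "a \<le> c" "c \<le> b" "b - a < d" for a b
      unfolding R_def
    proof (intro ballI impI lift_path_in_nbhd[OF k(1) pl])
      show "(\<lambda>t. p' (linepath a b t)) \<in> {0..1} \<rightarrow> nbhd U"
      proof
        fix t :: real assume "t \<in> {0..1}"
        then have "linepath a b t \<in> {a..b}"
          using linepath_in_path[of t a b] that by (auto simp: closed_segment_eq_real_ivl)
        then show "p' (linepath a b t) \<in> nbhd U" using that by (intro d(2)) (auto simp: dist_real_def)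
      qed
    qed (auto simp: linepath_def)
    then show ?case using d(1) by blast
  qed
  then obtain r where r: "pathin Xn r" "r 0 = x" "path_homotopic Q (\<lambda>t. p' (linepath 0 1 t)) (\<lambda>t. q (r t))"
    using x unfolding R_def by (auto simp: p'_def)
  have "path_homotopic Q p (\<lambda>t. p' (linepath 0 1 t))"
    by (rule path_homotopic_eqI[OF p]) (auto simp: p'_def linepath_def)
  from path_homotopic_trans[OF this r(3)] that r show ?thesis by blast
qed

end

section \<open>Simplicial complexes\<close>

abbreviation "function_space \<equiv> powertop_real UNIV"

definition support :: "('v \<Rightarrow> real) \<Rightarrow> 'v set" where "support z = {v. z v \<noteq> 0}"

definition segment_point :: "('v \<Rightarrow> real) \<Rightarrow> ('v \<Rightarrow> real) \<Rightarrow> real \<Rightarrow> 'v \<Rightarrow> real" where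
  "segment_point x y t = (\<lambda>v. (1 - t) * x v + t * y v)"

locale simplicial_realization =
  fixes K :: "'v set set" and T :: "('v \<Rightarrow> real) topology"
  assumes complex: "abs_simplicial_complex K" and realization: "is_realization_topology K T"
begin

lemma simplex_finite: "\<sigma> \<in> K \<Longrightarrow> finite \<sigma>"
  using complex by (auto simp: abs_simplicial_complex_def)

lemma openin_T: "openin T U \<longleftrightarrow> U \<subseteq> geom_realization K \<and>
        (\<forall>\<sigma>\<in>K. openin (subtopology function_space (geom_simplex \<sigma>)) (U \<inter> geom_simplex \<sigma>))"
  using realization unfolding is_realization_topology_def by blast

lemma topspace_T: "topspace T = geom_realization K"
proof
  show "topspace T \<subseteq> geom_realization K" using openin_T[of "topspace T"] by auto
  have "geom_realization K \<inter> geom_simplex \<sigma> = geom_simplex \<sigma>" if "\<sigma> \<in> K" for \<sigma>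
    using that by (auto simp: geom_realization_def)
  moreover have "openin (subtopology function_space S) S" for S :: "('v \<Rightarrow> real) set"
    using openin_topspace[of "subtopology function_space S"] by simp
  ultimately have "openin T (geom_realization K)" unfolding openin_T by auto
  then show "geom_realization K \<subseteq> topspace T" by (rule openin_subset)
qed

lemma simplex_subset: "\<sigma> \<in> K \<Longrightarrow> geom_simplex \<sigma> \<subseteq> topspace T"
  by (auto simp: topspace_T geom_realization_def)

text \<open>On a single simplex the product topology maps continuously into the weak topology, so
  continuity into it may be checked on coordinates.\<close>

lemma continuous_into_simplex:
  assumes "\<sigma> \<in> K" "continuous_map Z function_space f" "f ` topspace Z \<subseteq> geom_simplex \<sigma>"
  shows "continuous_map Z T f"
proof -
  have id: "continuous_map (subtopology function_space (geom_simplex \<sigma>)) T (\<lambda>x. x)"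
    unfolding continuous_map_openin_preimage_eq
  proof (intro conjI allI impI)
    show "(\<lambda>x. x) \<in> topspace (subtopology function_space (geom_simplex \<sigma>)) \<rightarrow> topspace T"
      using simplex_subset[OF assms(1)] by auto
    fix U assume "openin T U"
    then have "openin (subtopology function_space (geom_simplex \<sigma>)) (U \<inter> geom_simplex \<sigma>)"
      using openin_T assms(1) by blast
    then show "openin (subtopology function_space (geom_simplex \<sigma>)) (topspace (subtopology function_space (geom_simplex \<sigma>)) \<inter> (\<lambda>x. x) -` U)"
      by (simp add: Int_commute)
  qed
  have "continuous_map Z (subtopology function_space (geom_simplex \<sigma>)) f"
    using assms by (simp add: continuous_map_in_subtopology image_subset_iff_funcset)
  from continuous_map_compose[OF this id] show ?thesis by (simp add: o_def)
qed

text \<open>This holds for the weak topology by the tube lemma, since the interval is compact.\<close>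

lemma continuous_homotopy_from_T:
  assumes U: "openin T U"
    and h: "\<And>\<sigma>. \<sigma> \<in> K \<Longrightarrow> continuous_map (prod_topology unit_interval (subtopology function_space (U \<inter> geom_simplex \<sigma>))) Y h"
  shows "continuous_map (prod_topology unit_interval (subtopology T U)) Y h"
proof -
  let ?P = "prod_topology unit_interval (subtopology T U)"
  let ?\<sigma> = "\<lambda>\<sigma>. prod_topology unit_interval (subtopology function_space (U \<inter> geom_simplex \<sigma>))"
  have UT: "U \<subseteq> topspace T" using U openin_subset by blast
  have inU: "\<exists>\<sigma>\<in>K. x \<in> geom_simplex \<sigma>" if "x \<in> U" for x
    using that UT unfolding topspace_T geom_realization_def by blast
  have topP: "topspace ?P = {0..1} \<times> U" using UT by (simp add: Int_absorb1)
  have hin: "h (t, x) \<in> topspace Y" if tx: "t \<in> {0..1}" "x \<in> U" for t x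
  proof -
    obtain \<sigma> where "\<sigma> \<in> K" "x \<in> geom_simplex \<sigma>" using inU[OF tx(2)] by blast
    then show ?thesis using h[of \<sigma>] tx by (auto simp: continuous_map_def Pi_iff)
  qed
  have "openin ?P {z \<in> topspace ?P. h z \<in> W}" if W: "openin Y W" for W
    unfolding openin_prod_topology_alt
  proof (intro allI impI)
    fix t0 x0 assume "(t0, x0) \<in> {z \<in> topspace ?P. h z \<in> W}"
    then have tx: "t0 \<in> {0..1}" "x0 \<in> U" "h (t0, x0) \<in> W" unfolding topP by auto
    obtain \<sigma>0 where \<sigma>0: "\<sigma>0 \<in> K" "x0 \<in> geom_simplex \<sigma>0" using inU tx by blast
    have op\<sigma>: "openin (?\<sigma> \<sigma>) {z \<in> topspace (?\<sigma> \<sigma>). h z \<in> W}" if "\<sigma> \<in> K" for \<sigma>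
      using openin_continuous_map_preimage[OF h[OF that] W] .
    have "(t0, x0) \<in> {z \<in> topspace (?\<sigma> \<sigma>0). h z \<in> W}" using tx \<sigma>0 by auto
    then obtain A B where AB: "openin unit_interval A" "openin (subtopology function_space (U \<inter> geom_simplex \<sigma>0)) B"
      "t0 \<in> A" "x0 \<in> B" "A \<times> B \<subseteq> {z \<in> topspace (?\<sigma> \<sigma>0). h z \<in> W}"
      using op\<sigma>[OF \<sigma>0(1)] unfolding openin_prod_topology_alt by meson
    obtain e where e: "e > 0" "\<And>t. t \<in> {0..1} \<Longrightarrow> dist t t0 < e \<Longrightarrow> t \<in> A"
      using AB(1,3) unfolding openin_euclidean_subtopology_iff by metis
    \<comment> \<open>Half the radius gives a compact neighbourhood of \<open>t0\<close> that still
      lies in \<open>A\<close>.\<close>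
    define J where "J = {0..1} \<inter> cball t0 (e / 2)"
    have J: "compact J" "J \<subseteq> A" "J \<subseteq> {0..1}" unfolding J_def using e by (auto simp: dist_commute)
    have JI: "compactin unit_interval J" using J by (simp add: compactin_subtopology)
    \<comment> \<open>This description mentions no particular simplex, so openness of
      \<open>V\<close> in the weak topology can be verified on each simplex separately, where the
      tube lemma applies to the compact \<open>J\<close>.\<close>
    define V where "V = {x \<in> U. \<forall>t\<in>J. h (t, x) \<in> W}"
    have x0V: "x0 \<in> V" using AB J(2) tx unfolding V_def by auto
    have "openin T V"
      unfolding openin_T
    proof (intro conjI ballI)
      show "V \<subseteq> geom_realization K" using UT by (auto simp: V_def topspace_T)
      fix \<sigma> assume \<sigma>: "\<sigma> \<in> K"
      have oU: "openin (subtopology function_space (geom_simplex \<sigma>)) (U \<inter> geom_simplex \<sigma>)"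
        using U \<sigma> unfolding openin_T by blast
      have "openin (subtopology function_space (U \<inter> geom_simplex \<sigma>)) (V \<inter> geom_simplex \<sigma>)"
      proof (subst openin_subopen, intro ballI)
        fix x assume x: "x \<in> V \<inter> geom_simplex \<sigma>"
        then have xU: "x \<in> U" by (simp add: V_def)
        have sub: "J \<times> {x} \<subseteq> {z \<in> topspace (?\<sigma> \<sigma>). h z \<in> W}" using x J(3) by (auto simp: V_def)
        obtain A' B' where *: "openin (subtopology function_space (U \<inter> geom_simplex \<sigma>)) B'" "J \<subseteq> A'" "x \<in> B'" "A' \<times> B' \<subseteq> {z \<in> topspace (?\<sigma> \<sigma>). h z \<in> W}"
          using tube_lemma_left[OF op\<sigma>[OF \<sigma>] JI _ sub] x xU by auto
        have "B' \<subseteq> V \<inter> geom_simplex \<sigma>"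
        proof
          fix y assume y: "y \<in> B'"
          then have "y \<in> U \<inter> geom_simplex \<sigma>" using openin_subset[OF *(1)] by auto
          moreover have "h (t, y) \<in> W" if "t \<in> J" for t using that y * by blast
          ultimately show "y \<in> V \<inter> geom_simplex \<sigma>" by (auto simp: V_def)
        qed
        then show "\<exists>T. openin (subtopology function_space (U \<inter> geom_simplex \<sigma>)) T \<and> x \<in> T \<and> T \<subseteq> V \<inter> geom_simplex \<sigma>"
          using * by blast
      qed
      then have "openin (subtopology (subtopology function_space (geom_simplex \<sigma>)) (U \<inter> geom_simplex \<sigma>)) (V \<inter> geom_simplex \<sigma>)"
        by (simp add: subtopology_subtopology Int_absorb1)
      then show "openin (subtopology function_space (geom_simplex \<sigma>)) (V \<inter> geom_simplex \<sigma>)"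
        using openin_trans_full oU by blast
    qed
    then have "openin (subtopology T U) V" using V_def by (auto simp: openin_open_subtopology[OF U])
    moreover have "openin unit_interval ({0..1} \<inter> ball t0 (e / 2))" by (auto simp: openin_open)
    moreover have "({0..1} \<inter> ball t0 (e / 2)) \<times> V \<subseteq> {z \<in> topspace ?P. h z \<in> W}"
      unfolding topP by (auto simp: V_def J_def)
    ultimately show "\<exists>A B. openin unit_interval A \<and> openin (subtopology T U) B \<and> t0 \<in> A \<and> x0 \<in> B \<and> A \<times> B \<subseteq> {z \<in> topspace ?P. h z \<in> W}"
      using tx(1) x0V e(1) by (intro exI[where x="{0..1} \<inter> ball t0 (e / 2)"] exI[where x=V]) auto
  qed
  then show ?thesis unfolding continuous_map_def topP using hin by (auto simp: Pi_iff)
qed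

section \<open>Open stars and their linear contractions\<close>

lemma geom_simplexD:
  assumes "x \<in> geom_simplex \<sigma>"
  shows "\<And>v. 0 \<le> x v" "support x \<subseteq> \<sigma>" "sum x \<sigma> = 1"
  using assms by (auto simp: geom_simplex_def support_def)

lemma sum_support:
  assumes "x \<in> geom_simplex \<sigma>" "\<sigma> \<in> K" "support x \<subseteq> A" "finite A" shows "sum x A = 1"
proof -
  have "sum x (support x) = sum x \<sigma>"
    by (rule sum.mono_neutral_left) (use geom_simplexD[OF assms(1)] simplex_finite[OF assms(2)] in \<open>auto simp: support_def\<close>)
  moreover have "sum x (support x) = sum x A"
    by (rule sum.mono_neutral_left) (use assms in \<open>auto simp: support_def\<close>)
  ultimately show ?thesis using geom_simplexD(3)[OF assms(1)] by simp
qed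

lemma geom_simplex_support_iff:
  assumes "z \<in> topspace T" "\<sigma> \<in> K" "support z \<subseteq> \<sigma>" shows "z \<in> geom_simplex \<sigma>"
proof -
  obtain \<tau> where \<tau>: "\<tau> \<in> K" "z \<in> geom_simplex \<tau>" using assms(1) by (auto simp: topspace_T geom_realization_def)
  have "sum z \<sigma> = 1" by (rule sum_support[OF \<tau>(2,1) assms(3) simplex_finite[OF assms(2)]])
  moreover have "z v = 0" if "v \<notin> \<sigma>" for v using that assms(3) by (auto simp: support_def)
  ultimately show ?thesis using geom_simplexD(1)[OF \<tau>(2)] by (simp add: geom_simplex_def)
qed

lemma support_finite: "z \<in> topspace T \<Longrightarrow> finite (support z)"
  unfolding topspace_T geom_realization_def using geom_simplexD(2) simplex_finite finite_subset by (metis UN_E)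

lemma T_nonneg: "z \<in> topspace T \<Longrightarrow> 0 \<le> z v"
  unfolding topspace_T geom_realization_def by (auto simp: geom_simplex_def)

text \<open>Only lower bounds on the finitely many nonzero coordinates of \<open>z\<close>. They
  suffice to control all coordinates, because barycentric coordinates are nonnegative and sum to
  1.\<close>

definition star :: "('v \<Rightarrow> real) \<Rightarrow> real \<Rightarrow> ('v \<Rightarrow> real) set" where
  "star z \<epsilon> = {x \<in> topspace T. \<forall>v\<in>support z. z v - \<epsilon> < x v}"

text \<open>With such a radius every point of the star is positive on the support of
  \<open>z\<close>. Hence each simplex containing that point also contains \<open>z\<close>, and the
  segment between the two stays in it.\<close>

definition fits :: "('v \<Rightarrow> real) \<Rightarrow> real \<Rightarrow> bool" where
  "fits z \<epsilon> \<longleftrightarrow> 0 < \<epsilon> \<and> (\<forall>v\<in>support z. \<epsilon> \<le> z v)"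

lemma openin_star: "z \<in> topspace T \<Longrightarrow> openin T (star z \<epsilon>)"
  unfolding openin_T
proof (intro conjI ballI)
  assume z: "z \<in> topspace T"
  show "star z \<epsilon> \<subseteq> geom_realization K" by (auto simp: star_def topspace_T)
  fix \<sigma> assume \<sigma>: "\<sigma> \<in> K"
  let ?A = "\<Inter>v\<in>support z. {x \<in> topspace function_space. x v \<in> {z v - \<epsilon><..}}"
  have "star z \<epsilon> \<inter> geom_simplex \<sigma> = (topspace function_space \<inter> ?A) \<inter> geom_simplex \<sigma>"
    using simplex_subset[OF \<sigma>] by (auto simp: star_def)
  moreover have "openin function_space (topspace function_space \<inter> ?A)"
  proof (cases "support z = {}")
    case False
    have "openin function_space {x \<in> topspace function_space. x v \<in> {z v - \<epsilon><..}}" for v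
      by (rule openin_continuous_map_preimage[OF continuous_map_product_projection]) auto
    then show ?thesis using False support_finite[OF z] by (intro openin_Int openin_INT openin_topspace) auto
  next
    case True
    then show ?thesis using openin_topspace[of function_space] by simp
  qed
  ultimately show "openin (subtopology function_space (geom_simplex \<sigma>)) (star z \<epsilon> \<inter> geom_simplex \<sigma>)"
    by (simp only: openin_subtopology_Int)
qed

lemma star_center: "z \<in> topspace T \<Longrightarrow> fits z \<epsilon> \<Longrightarrow> z \<in> star z \<epsilon>"
  by (auto simp: star_def fits_def)

lemma star_support: "x \<in> star z \<epsilon> \<Longrightarrow> fits z \<epsilon> \<Longrightarrow> support z \<subseteq> support x"
  by (fastforce simp: star_def fits_def support_def)

text \<open>The coordinates sum to 1, so the lower bounds on the others leave at most
  \<open>z v + card (support z) * \<epsilon>\<close> for coordinate \<open>v\<close>. The additional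
  1 in the constant covers the lower bound \<open>z v - \<epsilon>\<close>.\<close>

lemma star_near:
  fixes x z :: "'v \<Rightarrow> real" and \<epsilon> :: real
  assumes z: "z \<in> topspace T" and x: "x \<in> star z \<epsilon>" and e: "0 \<le> \<epsilon>"
  shows "\<bar>x v - z v\<bar> \<le> (real (card (support z)) + 1) * \<epsilon>"
proof -
  have xT: "x \<in> topspace T" using x by (simp add: star_def)
  obtain \<tau> where \<tau>: "\<tau> \<in> K" "x \<in> geom_simplex \<tau>" using xT by (auto simp: topspace_T geom_realization_def)
  obtain \<sigma> where \<sigma>: "\<sigma> \<in> K" "z \<in> geom_simplex \<sigma>" using z by (auto simp: topspace_T geom_realization_def)
  have fin: "finite (support z)" "finite (support x)" using z xT support_finite by auto
  let ?S = "support z - {v}"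
  have "sum x ?S + x v = sum x (insert v (support z))" using fin by (simp add: sum.insert_remove)
  also have "\<dots> \<le> sum x (insert v (support z \<union> support x))"
    by (rule sum_mono2) (use fin T_nonneg[OF xT] in auto)
  also have "\<dots> = 1" by (rule sum_support[OF \<tau>(2,1)]) (use fin in auto)
  finally have 1: "sum x ?S + x v \<le> 1" .
  have "sum z ?S + z v = sum z (insert v (support z))" using fin by (simp add: sum.insert_remove)
  also have "\<dots> = 1" by (rule sum_support[OF \<sigma>(2,1)]) (use fin in auto)
  finally have 2: "sum z ?S + z v = 1" .
  have "(\<Sum>u\<in>?S. z u - \<epsilon>) \<le> sum x ?S"
    by (rule sum_mono) (use x in \<open>auto simp: star_def less_imp_le\<close>)
  then have 3: "sum z ?S - card ?S * \<epsilon> \<le> sum x ?S" by (simp add: sum_subtractf)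
  have "card ?S \<le> card (support z)" by (rule card_mono) (use fin in auto)
  then have 4: "card ?S * \<epsilon> \<le> card (support z) * \<epsilon>" using e by (intro mult_right_mono) auto
  have "x v \<le> z v + card (support z) * \<epsilon>" using 1 2 3 4 by linarith
  moreover have "z v - \<epsilon> \<le> x v"
  proof (cases "v \<in> support z")
    case True then show ?thesis using x by (auto simp: star_def less_imp_le)
  next
    case False then show ?thesis using T_nonneg[OF xT, of v] e by (simp add: support_def)
  qed
  moreover have "0 \<le> card (support z) * \<epsilon>" using e by simp
  ultimately show ?thesis using e unfolding distrib_right abs_le_iff by linarith
qed

lemma eventually_fits: "z \<in> topspace T \<Longrightarrow> \<forall>\<^sub>F \<epsilon> in at_right 0. fits z \<epsilon>"
proof -
  assume z: "z \<in> topspace T"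
  have "\<forall>\<^sub>F \<epsilon> in at_right 0. \<forall>v\<in>support z. \<epsilon> \<le> z v"
  proof (rule eventually_ball_finite[OF support_finite[OF z]], rule)
    fix v assume "v \<in> support z"
    then have "0 < z v" using T_nonneg[OF z, of v] by (simp add: support_def)
    from eventually_at_right_real[OF this] show "\<forall>\<^sub>F \<epsilon> in at_right 0. \<epsilon> \<le> z v" by eventually_elim auto
  qed
  moreover have "\<forall>\<^sub>F \<epsilon> in at_right 0. (0::real) < \<epsilon>" by (rule eventually_at_right_less)
  ultimately show ?thesis unfolding fits_def by eventually_elim auto
qed

lemma eventually_stars_disjoint:
  assumes z: "z \<in> topspace T" "w \<in> topspace T" "z \<noteq> w"
  shows "\<forall>\<^sub>F \<epsilon> in at_right 0. star z \<epsilon> \<inter> star w \<epsilon> = {}"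
proof -
  obtain v where v: "z v \<noteq> w v" using z(3) by auto
  \<comment> \<open>The sum of the constants of \<open>star_near\<close> for \<open>z\<close> and
    for \<open>w\<close>: a common point of the stars would force the two values at \<open>v\<close>
    to be closer than they are.\<close>
  define M where "M = real (card (support z) + card (support w) + 2)"
  have "0 < \<bar>z v - w v\<bar> / M" using v by (auto simp: M_def)
  from eventually_at_right_real[OF this] show ?thesis
  proof eventually_elim
    case (elim \<epsilon>)
    show ?case
    proof (rule ccontr)
      assume "star z \<epsilon> \<inter> star w \<epsilon> \<noteq> {}"
      then obtain x where x: "x \<in> star z \<epsilon>" "x \<in> star w \<epsilon>" by blast
      have "\<bar>z v - w v\<bar> \<le> (real (card (support z)) + 1) * \<epsilon> + (real (card (support w)) + 1) * \<epsilon>"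
        using star_near[OF z(1) x(1), of v] star_near[OF z(2) x(2), of v] elim by simp
      also have "\<dots> = M * \<epsilon>" by (simp add: M_def algebra_simps)
      also have "\<dots> < \<bar>z v - w v\<bar>" using elim by (simp add: M_def field_simps)
      finally show False by simp
    qed
  qed
qed

definition admissible :: "('v \<Rightarrow> real) set \<Rightarrow> real \<Rightarrow> bool" where
  "admissible F \<epsilon> \<longleftrightarrow> finite F \<and> F \<subseteq> topspace T \<and> (\<forall>z\<in>F. fits z \<epsilon>) \<and>
     (\<forall>z\<in>F. \<forall>w\<in>F. z \<noteq> w \<longrightarrow> star z \<epsilon> \<inter> star w \<epsilon> = {})"

text \<open>Each requirement holds for all sufficiently small positive radii, and there are finitely
  many of them.\<close>

lemma admissible_exists:
  assumes "finite F" "F \<subseteq> topspace T" shows "\<exists>\<epsilon>. admissible F \<epsilon>"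
proof -
  have "\<forall>\<^sub>F \<epsilon> in at_right 0. \<forall>z\<in>F. fits z \<epsilon>"
    by (rule eventually_ball_finite[OF assms(1)]) (use assms eventually_fits in blast)
  moreover have "\<forall>\<^sub>F \<epsilon> in at_right 0. \<forall>z\<in>F. \<forall>w\<in>F. z \<noteq> w \<longrightarrow> star z \<epsilon> \<inter> star w \<epsilon> = {}"
  proof (rule eventually_ball_finite[OF assms(1)], rule, rule eventually_ball_finite[OF assms(1)], rule)
    fix z w assume zw: "z \<in> F" "w \<in> F"
    show "\<forall>\<^sub>F \<epsilon> in at_right 0. z \<noteq> w \<longrightarrow> star z \<epsilon> \<inter> star w \<epsilon> = {}"
      using eventually_stars_disjoint[of z w] zw assms(2) by (cases "z = w") auto
  qed
  ultimately have "\<forall>\<^sub>F \<epsilon> in at_right 0. admissible F \<epsilon>"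
    by eventually_elim (use assms in \<open>auto simp: admissible_def\<close>)
  then show ?thesis using eventually_happens' trivial_limit_at_right_real by blast
qed

definition stars :: "('v \<Rightarrow> real) set \<Rightarrow> real \<Rightarrow> ('v \<Rightarrow> real) set" where
  "stars F \<epsilon> = (\<Union>z\<in>F. star z \<epsilon>)"

definition center :: "('v \<Rightarrow> real) set \<Rightarrow> real \<Rightarrow> ('v \<Rightarrow> real) \<Rightarrow> 'v \<Rightarrow> real" where
  "center F \<epsilon> x = (SOME z. z \<in> F \<and> x \<in> star z \<epsilon>)"

lemma center_eq:
  assumes "admissible F \<epsilon>" "z \<in> F" "x \<in> star z \<epsilon>" shows "center F \<epsilon> x = z"
  unfolding center_def
proof (rule some_equality)
  fix w assume "w \<in> F \<and> x \<in> star w \<epsilon>"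
  then show "w = z" using assms unfolding admissible_def by blast
qed (use assms in auto)

lemma common_simplex:
  assumes "x \<in> topspace T" obtains \<sigma> where "\<sigma> \<in> K" "\<And>z. z \<in> topspace T \<Longrightarrow> support z \<subseteq> support x \<Longrightarrow> z \<in> geom_simplex \<sigma>"
proof -
  obtain \<sigma> where "\<sigma> \<in> K" "x \<in> geom_simplex \<sigma>" using assms by (auto simp: topspace_T geom_realization_def)
  then show ?thesis using that geom_simplex_support_iff geom_simplexD(2) by (meson subset_trans)
qed

lemma segment_in_simplex:
  assumes "x \<in> geom_simplex \<sigma>" "y \<in> geom_simplex \<sigma>" "t \<in> {0..1}"
  shows "segment_point x y t \<in> geom_simplex \<sigma>"
  using assms by (auto simp: geom_simplex_def segment_point_def sum.distrib simp flip: sum_distrib_left)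

text \<open>Checked on one simplex at a time: if it meets the star it contains \<open>z\<close>, so
  the contraction never leaves it and is given there by a formula in coordinates.\<close>

lemma continuous_segment_to_center:
  assumes z: "z \<in> topspace T" "fits z \<epsilon>"
  shows "continuous_map (prod_topology unit_interval (subtopology T (star z \<epsilon>))) T (\<lambda>p. segment_point (snd p) z (fst p))"
proof (rule continuous_homotopy_from_T[OF openin_star[OF z(1)]])
  fix \<sigma> assume \<sigma>: "\<sigma> \<in> K"
  let ?Z = "prod_topology unit_interval (subtopology function_space (star z \<epsilon> \<inter> geom_simplex \<sigma>))"
  show "continuous_map ?Z T (\<lambda>p. segment_point (snd p) z (fst p))"
  proof (rule continuous_into_simplex[OF \<sigma>])
    have f: "continuous_map ?Z euclideanreal fst"
      using continuous_map_fst continuous_map_into_fulltopology by blast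
    have "continuous_map ?Z function_space snd"
      using continuous_map_snd continuous_map_into_fulltopology by blast
    then have s: "continuous_map ?Z euclideanreal (\<lambda>p. snd p v)" for v
      unfolding continuous_map_componentwise_UNIV by blast
    show "continuous_map ?Z function_space (\<lambda>p. segment_point (snd p) z (fst p))"
      unfolding continuous_map_componentwise_UNIV segment_point_def
      by (intro allI continuous_map_add continuous_map_real_mult continuous_map_diff s f) auto
    show "(\<lambda>p. segment_point (snd p) z (fst p)) ` topspace ?Z \<subseteq> geom_simplex \<sigma>"
    proof clarify
      fix t x assume tx: "(t, x) \<in> topspace ?Z"
      then have x: "x \<in> star z \<epsilon>" "x \<in> geom_simplex \<sigma>" "t \<in> {0..1}" by auto
      have "z \<in> geom_simplex \<sigma>"
        using geom_simplex_support_iff[OF z(1) \<sigma>] star_support[OF x(1) z(2)] geom_simplexD(2)[OF x(2)] by blast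
      then show "segment_point (snd (t, x)) z (fst (t, x)) \<in> geom_simplex \<sigma>"
        using segment_in_simplex x by simp
    qed
  qed
qed

definition contraction :: "('v \<Rightarrow> real) set \<Rightarrow> real \<Rightarrow> real \<times> ('v \<Rightarrow> real) \<Rightarrow> 'v \<Rightarrow> real" where
  "contraction F \<epsilon> p = segment_point (snd p) (center F \<epsilon> (snd p)) (fst p)"

lemma openin_stars: "admissible F \<epsilon> \<Longrightarrow> openin T (stars F \<epsilon>)"
  unfolding stars_def admissible_def by (intro openin_Union) (auto intro: openin_star)

lemma continuous_contraction:
  assumes F: "admissible F \<epsilon>"
  shows "continuous_map (prod_topology unit_interval (subtopology T (stars F \<epsilon>))) T (contraction F \<epsilon>)"
proof (rule pasting_lemma[where I=F and T="\<lambda>z. {0..1} \<times> star z \<epsilon>" and f="\<lambda>z p. segment_point (snd p) z (fst p)"])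
  have zT: "z \<in> topspace T" "fits z \<epsilon>" if "z \<in> F" for z using F that by (auto simp: admissible_def)
  let ?P = "prod_topology unit_interval (subtopology T (stars F \<epsilon>))"
  fix z assume z: "z \<in> F"
  have sub: "star z \<epsilon> \<subseteq> stars F \<epsilon>" using z by (auto simp: stars_def)
  have "openin (subtopology T (stars F \<epsilon>)) (star z \<epsilon>)"
    using openin_star[OF zT(1)[OF z]] sub by (simp add: openin_open_subtopology[OF openin_stars[OF F]])
  then show "openin ?P ({0..1} \<times> star z \<epsilon>)" by (auto simp: openin_prod_Times_iff)
  have "subtopology ?P ({0..1} \<times> star z \<epsilon>) = prod_topology unit_interval (subtopology T (star z \<epsilon>))"
    using sub by (simp add: subtopology_Times subtopology_subtopology Int_absorb1)
  then show "continuous_map (subtopology ?P ({0..1} \<times> star z \<epsilon>)) T (\<lambda>p. segment_point (snd p) z (fst p))"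
    using continuous_segment_to_center[OF zT[OF z]] by simp
  fix w x assume "w \<in> F" and "x \<in> topspace ?P \<inter> ({0..1} \<times> star z \<epsilon>) \<inter> ({0..1} \<times> star w \<epsilon>)"
  then have "z = w" using F z unfolding admissible_def by force
  then show "segment_point (snd x) z (fst x) = segment_point (snd x) w (fst x)" by simp
next
  fix x assume "x \<in> topspace (prod_topology unit_interval (subtopology T (stars F \<epsilon>)))"
  then obtain z where "fst x \<in> {0..1}" "z \<in> F" "snd x \<in> star z \<epsilon>" by (cases x) (auto simp: stars_def)
  then show "\<exists>j. j \<in> F \<and> x \<in> {0..1} \<times> star j \<epsilon> \<and> contraction F \<epsilon> x = segment_point (snd x) j (fst x)"
    using center_eq[OF F] by (intro exI[where x=z]) (auto simp: contraction_def mem_Times_iff)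
qed

text \<open>\<open>boundaries1_triangle\<close> speaks of convex sets in a normed space, so the
  triangle in the realization is first parametrised by barycentric coordinates over the standard
  2-simplex.\<close>

lemma segment_triangle:
  assumes g: "continuous_map T X g" and \<sigma>: "\<sigma> \<in> K" and abc: "a \<in> geom_simplex \<sigma>" "b \<in> geom_simplex \<sigma>" "c \<in> geom_simplex \<sigma>"
  shows "path_chain (\<lambda>t. g (segment_point a b t)) + path_chain (\<lambda>t. g (segment_point b c t))
     - path_chain (\<lambda>t. g (segment_point a c t)) \<in> boundaries1 X"
proof -
  define P where "P = (\<lambda>(z::real \<times> real) v. (1 - fst z - snd z) * a v + fst z * b v + snd z * c v)"
  have "continuous_map (top_of_set std_simplex2) T P"
  proof (rule continuous_into_simplex[OF \<sigma>])
    show "continuous_map (top_of_set std_simplex2) function_space P"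
      unfolding continuous_map_componentwise_UNIV P_def by (auto intro!: continuous_intros)
    show "P ` topspace (top_of_set std_simplex2) \<subseteq> geom_simplex \<sigma>"
      using abc by (auto simp: P_def geom_simplex_def std_simplex2_def sum.distrib simp flip: sum_distrib_left)
  qed
  from continuous_map_compose[OF this g]
  have "continuous_map (top_of_set std_simplex2) X (\<lambda>z. g (P z))" by (simp add: o_def)
  from boundaries1_triangle[OF this convex_std_simplex2, of "(0,0)" "(1,0)" "(0,1)"]
  have "path_chain (\<lambda>t. g (P (linepath (0,0) (1,0) t))) + path_chain (\<lambda>t. g (P (linepath (1,0) (0,1) t)))
     - path_chain (\<lambda>t. g (P (linepath (0,0) (0,1) t))) \<in> boundaries1 X"
    by (simp add: std_simplex2_def)
  moreover have "P (linepath (0,0) (1,0) t) = segment_point a b t" "P (linepath (1,0) (0,1) t) = segment_point b c t"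
    "P (linepath (0,0) (0,1) t) = segment_point a c t" for t
    by (auto simp: P_def linepath_def segment_point_def)
  ultimately show ?thesis by simp
qed

end

text \<open>The contraction takes place in the complex. A point \<open>x\<close> first moves along
  the homotopy \<open>H\<close> to \<open>g (f x)\<close> and then along the image under
  \<open>g\<close> of the segment from \<open>f x\<close> to the center of its star, so the track
  lies in \<open>X\<close> but in general not in \<open>U\<close>.\<close>

theorem contractible_cover_of_homotopy_type:
  assumes "has_simplicial_homotopy_type X TYPE('v)"
  obtains \<K> where "contractible_cover X \<K>"
proof -
  obtain K :: "'v set set" and T where K: "abs_simplicial_complex K" "is_realization_topology K T" and XT: "X homotopy_equivalent_space T"
    using assms unfolding has_simplicial_homotopy_type_def by blast
  interpret simplicial_realization K T using K by unfold_locales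
  obtain f g where f: "continuous_map X T f" and g: "continuous_map T X g" and gf: "homotopic_with (\<lambda>_. True) X X (g \<circ> f) id"
    using XT unfolding homotopy_equivalent_space_def by blast
  then obtain H' where H': "continuous_map (prod_topology unit_interval X) X H'" "\<And>x. H' (0, x) = g (f x)" "\<And>x. H' (1, x) = x"
    unfolding homotopic_with_def by auto
  \<comment> \<open>\<open>H'\<close> runs from \<open>g \<circ> f\<close> to the identity; a
    deformation has to start at the identity.\<close>
  define H where "H z = H' (1 - fst z, snd z)" for z
  have H: "continuous_map (prod_topology unit_interval X) X H"
  proof -
    have 1: "continuous_map (prod_topology unit_interval X) unit_interval fst" by (rule continuous_map_fst)
    have "continuous_map unit_interval unit_interval (\<lambda>t. 1 - t)" by (auto intro!: continuous_intros)
    from continuous_map_compose[OF 1 this]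
    have "continuous_map (prod_topology unit_interval X) (prod_topology unit_interval X) (\<lambda>z. (1 - fst z, snd z))"
      unfolding continuous_map_pairwise by (simp add: o_def continuous_map_snd)
    from continuous_map_compose[OF this H'(1)] show ?thesis by (simp add: H_def[abs_def] o_def)
  qed
  have H01: "H (0, x) = x" "H (1, x) = g (f x)" for x using H' by (auto simp: H_def)
  define U where "U F \<epsilon> = {x \<in> topspace X. f x \<in> stars F \<epsilon>}" for F \<epsilon>
  define k where "k F \<epsilon> z = (if fst z \<le> 1/2 then H (2 * fst z, snd z) else g (contraction F \<epsilon> (2 * fst z - 1, f (snd z))))" for F \<epsilon> and z :: "real \<times> 'a"
  define \<K> where "\<K> = {(U F \<epsilon>, k F \<epsilon>) | F \<epsilon>. admissible F \<epsilon>}"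
  have fT: "f x \<in> topspace T" if "x \<in> topspace X" for x using f that by (auto simp: continuous_map_def)
  have oU: "openin X (U F \<epsilon>)" if "admissible F \<epsilon>" for F \<epsilon>
    unfolding U_def using openin_continuous_map_preimage[OF f openin_stars[OF that]] .
  have k0: "k F \<epsilon> (0, x) = x" for F \<epsilon> x by (simp add: k_def H01)
  have cU: "\<exists>c\<in>F. center F \<epsilon> (f x) = c \<and> f x \<in> star c \<epsilon> \<and> c \<in> topspace T \<and> fits c \<epsilon>" if "admissible F \<epsilon>" "x \<in> U F \<epsilon>" for F \<epsilon> x
    using that center_eq[OF that(1)] unfolding U_def stars_def admissible_def by blast
  have k1: "k F \<epsilon> (1, x) = g (center F \<epsilon> (f x))" for F \<epsilon> x
    by (simp add: k_def contraction_def segment_point_def)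
  have gk: "continuous_map (prod_topology unit_interval (subtopology X (U F \<epsilon>))) X (\<lambda>z. g (contraction F \<epsilon> (fst z, f (snd z))))"
    if F: "admissible F \<epsilon>" for F \<epsilon>
  proof -
    let ?P = "prod_topology unit_interval (subtopology X (U F \<epsilon>))"
    have "continuous_map (subtopology X (U F \<epsilon>)) (subtopology T (stars F \<epsilon>)) f"
      using f by (auto simp: continuous_map_in_subtopology U_def intro: continuous_map_from_subtopology)
    then have "continuous_map ?P (subtopology T (stars F \<epsilon>)) (\<lambda>z. f (snd z))"
      using continuous_map_compose[OF continuous_map_snd] by (fastforce simp: o_def)
    then have "continuous_map ?P (prod_topology unit_interval (subtopology T (stars F \<epsilon>))) (\<lambda>z. (fst z, f (snd z)))"
      unfolding continuous_map_pairwise by (simp add: o_def continuous_map_fst)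
    from continuous_map_compose[OF continuous_map_compose[OF this continuous_contraction[OF F]] g]
    show ?thesis by (simp add: o_def)
  qed
  have kc: "continuous_map (prod_topology unit_interval (subtopology X (U F \<epsilon>))) X (k F \<epsilon>)" if F: "admissible F \<epsilon>" for F \<epsilon>
  proof -
    have HU: "continuous_map (prod_topology unit_interval (subtopology X (U F \<epsilon>))) X H"
      using continuous_map_from_subtopology[OF H, of "UNIV \<times> U F \<epsilon>"] by (simp add: subtopology_Times)
    from continuous_map_join_homotopy[OF HU gk[OF F]] show ?thesis
      by (simp add: k_def[abs_def] H01 contraction_def segment_point_def cong: if_cong)
  qed
  have chain_k: "path_chain (\<lambda>t. H (t, x)) + path_chain (\<lambda>t. g (contraction F \<epsilon> (t, f x))) - path_chain (\<lambda>t. k F \<epsilon> (t, x)) \<in> boundaries1 X"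
    if F: "admissible F \<epsilon>" and x: "x \<in> U F \<epsilon>" for F \<epsilon> x
  proof -
    have sec: "pathin X (\<lambda>t. h (t, x))" if "continuous_map (prod_topology unit_interval (subtopology X (U F \<epsilon>))) X h" for h
    proof -
      have "continuous_map unit_interval (prod_topology unit_interval (subtopology X (U F \<epsilon>))) (\<lambda>t. (t, x))"
        using x by (auto simp: continuous_map_pairwise o_def U_def)
      from continuous_map_compose[OF this that] show ?thesis by (simp add: pathin_def o_def)
    qed
    have HU: "continuous_map (prod_topology unit_interval (subtopology X (U F \<epsilon>))) X H"
      using continuous_map_from_subtopology[OF H, of "UNIV \<times> U F \<epsilon>"] by (simp add: subtopology_Times)
    have "path_join (\<lambda>t. H (t, x)) (\<lambda>t. g (contraction F \<epsilon> (t, f x))) = (\<lambda>t. k F \<epsilon> (t, x))"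
      by (auto simp: path_join_def k_def)
    moreover have "H (1, x) = g (contraction F \<epsilon> (0, f x))" by (simp add: H01 contraction_def segment_point_def)
    ultimately show ?thesis
      using path_chain_join[OF sec[OF HU] sec[OF gk[OF F]]] by simp
  qed
  have "contractible_cover X \<K>"
  proof
    fix V l assume "(V, l) \<in> \<K>"
    then obtain F \<epsilon> where F: "V = U F \<epsilon>" "l = k F \<epsilon>" "admissible F \<epsilon>" by (auto simp: \<K>_def)
    show "openin X V" using oU F by simp
    show "continuous_map (prod_topology unit_interval (subtopology X V)) X l" using kc F by simp
    show "l (0, u) = u" for u using k0 F by simp
    fix u assume u: "u \<in> V"
    obtain c where c: "c \<in> F" "center F \<epsilon> (f u) = c" "f u \<in> star c \<epsilon>" "c \<in> topspace T" using cU[OF F(3)] u F(1) by blast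
    show "\<exists>W. openin X W \<and> u \<in> W \<and> (\<forall>v\<in>W \<inter> V. l (1, v) = l (1, u))"
    proof (intro exI conjI ballI)
      show "openin X {x \<in> topspace X. f x \<in> star c \<epsilon>}" by (rule openin_continuous_map_preimage[OF f openin_star[OF c(4)]])
      show "u \<in> {x \<in> topspace X. f x \<in> star c \<epsilon>}" using u F(1) c by (auto simp: U_def)
      show "l (1, v) = l (1, u)" if "v \<in> {x \<in> topspace X. f x \<in> star c \<epsilon>} \<inter> V" for v
        using center_eq[OF F(3) c(1), of "f v"] that c(2) by (simp add: F(2) k1)
    qed
  next
    fix F assume "finite F" "F \<subseteq> topspace X"
    then have "finite (f ` F)" "f ` F \<subseteq> topspace T" using fT by auto
    from admissible_exists[OF this] obtain \<epsilon> where a: "admissible (f ` F) \<epsilon>" by blast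
    have "F \<subseteq> U (f ` F) \<epsilon>"
    proof
      fix x assume x: "x \<in> F"
      then have "f x \<in> star (f x) \<epsilon>" using a by (intro star_center) (auto simp: admissible_def)
      then show "x \<in> U (f ` F) \<epsilon>" using x \<open>F \<subseteq> topspace X\<close> by (auto simp: U_def stars_def)
    qed
    then show "\<exists>U k. (U, k) \<in> \<K> \<and> F \<subseteq> U" using a unfolding \<K>_def by blast
  next
    fix V l V' l' y assume "(V, l) \<in> \<K>" "(V', l') \<in> \<K>" and y: "y \<in> V" "y \<in> V'"
    then obtain F \<epsilon> F' \<epsilon>' where F: "V = U F \<epsilon>" "l = k F \<epsilon>" "admissible F \<epsilon>" and F': "V' = U F' \<epsilon>'" "l' = k F' \<epsilon>'" "admissible F' \<epsilon>'"
      by (auto simp: \<K>_def)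
    have yT: "f y \<in> topspace T" using y(1) F(1) fT by (auto simp: U_def)
    \<comment> \<open>A further star, around \<open>f y\<close> itself, guarantees that the segment
      from a nearby \<open>f z\<close> to \<open>f y\<close> lies in the complex.\<close>
    obtain \<eta> where \<eta>: "fits (f y) \<eta>"
      using eventually_happens'[OF trivial_limit_at_right_real eventually_fits[OF yT]] by blast
    define N where "N F \<epsilon> = {x \<in> topspace X. f x \<in> star (center F \<epsilon> (f y)) \<epsilon>} \<inter> {x \<in> topspace X. f x \<in> star (f y) \<eta>}" for F \<epsilon>
    \<comment> \<open>Modulo boundaries, the change of the track from \<open>y\<close> to
      \<open>z\<close> equals an expression in which neither \<open>F\<close> nor
      \<open>\<epsilon>\<close> occurs. Comparing two members of the cover through this common value
      gives the last axiom.\<close>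
    have N: "openin X (N F \<epsilon>) \<and> y \<in> N F \<epsilon> \<and> (\<forall>z\<in>N F \<epsilon>. (path_chain (\<lambda>t. k F \<epsilon> (t, z)) - path_chain (\<lambda>t. k F \<epsilon> (t, y)))
       - (path_chain (\<lambda>t. g (segment_point (f z) (f y) t)) + path_chain (\<lambda>t. H (t, z)) - path_chain (\<lambda>t. H (t, y))) \<in> boundaries1 X)"
      if F: "admissible F \<epsilon>" and y: "y \<in> U F \<epsilon>" for F \<epsilon>
    proof (intro conjI ballI)
      obtain c where c: "c \<in> F" "center F \<epsilon> (f y) = c" "f y \<in> star c \<epsilon>" "c \<in> topspace T" "fits c \<epsilon>" using cU[OF F y] by blast
      show "openin X (N F \<epsilon>)" unfolding N_def c(2)
        by (intro openin_Int openin_continuous_map_preimage[OF f] openin_star c yT)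
      show "y \<in> N F \<epsilon>" using y c star_center[OF yT \<eta>] by (auto simp: N_def U_def)
      fix z assume z: "z \<in> N F \<epsilon>"
      have zT: "z \<in> topspace X" "f z \<in> topspace T" "f z \<in> star c \<epsilon>" "f z \<in> star (f y) \<eta>" using z fT by (auto simp: N_def c(2))
      have zU: "z \<in> U F \<epsilon>" using zT c(1) by (auto simp: U_def stars_def)
      have cz: "center F \<epsilon> (f z) = c" using center_eq[OF F c(1) zT(3)] .
      \<comment> \<open>A simplex containing \<open>f z\<close> contains \<open>f y\<close> and
        \<open>c\<close> as well, because \<open>f z\<close> lies in the stars of both; thus the
        triangle on these three points is available.\<close>
      obtain \<sigma> where \<sigma>: "\<sigma> \<in> K" "\<And>w. w \<in> topspace T \<Longrightarrow> support w \<subseteq> support (f z) \<Longrightarrow> w \<in> geom_simplex \<sigma>"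
        using common_simplex[OF zT(2)] by blast
      have "path_chain (\<lambda>t. g (segment_point (f z) (f y) t)) + path_chain (\<lambda>t. g (segment_point (f y) c t))
          - path_chain (\<lambda>t. g (segment_point (f z) c t)) \<in> boundaries1 X"
        by (rule segment_triangle[OF g \<sigma>(1)]; rule \<sigma>(2))
           (use zT yT c star_support[OF zT(3) c(5)] star_support[OF zT(4) \<eta>] in auto)
      then have tri: "path_chain (\<lambda>t. g (segment_point (f z) (f y) t)) + path_chain (\<lambda>t. g (contraction F \<epsilon> (t, f y)))
          - path_chain (\<lambda>t. g (contraction F \<epsilon> (t, f z))) \<in> boundaries1 X"
        by (simp add: contraction_def cz c(2))
      from boundaries1_diff[OF boundaries1_diff[OF chain_k[OF F y] chain_k[OF F zU]] tri]
      show "(path_chain (\<lambda>t. k F \<epsilon> (t, z)) - path_chain (\<lambda>t. k F \<epsilon> (t, y)))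
       - (path_chain (\<lambda>t. g (segment_point (f z) (f y) t)) + path_chain (\<lambda>t. H (t, z)) - path_chain (\<lambda>t. H (t, y))) \<in> boundaries1 X"
        by (simp add: algebra_simps)
    qed
    have n1: "openin X (N F \<epsilon>)" "y \<in> N F \<epsilon>" and n1': "\<And>z. z \<in> N F \<epsilon> \<Longrightarrow> (path_chain (\<lambda>t. k F \<epsilon> (t, z)) - path_chain (\<lambda>t. k F \<epsilon> (t, y)))
       - (path_chain (\<lambda>t. g (segment_point (f z) (f y) t)) + path_chain (\<lambda>t. H (t, z)) - path_chain (\<lambda>t. H (t, y))) \<in> boundaries1 X"
      using N[OF F(3)] y(1) F(1) by auto
    have n2: "openin X (N F' \<epsilon>')" "y \<in> N F' \<epsilon>'" and n2': "\<And>z. z \<in> N F' \<epsilon>' \<Longrightarrow> (path_chain (\<lambda>t. k F' \<epsilon>' (t, z)) - path_chain (\<lambda>t. k F' \<epsilon>' (t, y)))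
       - (path_chain (\<lambda>t. g (segment_point (f z) (f y) t)) + path_chain (\<lambda>t. H (t, z)) - path_chain (\<lambda>t. H (t, y))) \<in> boundaries1 X"
      using N[OF F'(3)] y(2) F'(1) by auto
    show "\<exists>W. openin X W \<and> y \<in> W \<and> (\<forall>z\<in>W \<inter> V \<inter> V'.
         (path_chain (\<lambda>t. l (t, z)) - path_chain (\<lambda>t. l (t, y)))
       - (path_chain (\<lambda>t. l' (t, z)) - path_chain (\<lambda>t. l' (t, y))) \<in> boundaries1 X)"
    proof (intro exI conjI ballI)
      show "openin X (N F \<epsilon> \<inter> N F' \<epsilon>')" "y \<in> N F \<epsilon> \<inter> N F' \<epsilon>'" using n1 n2 by auto
      fix z assume z: "z \<in> N F \<epsilon> \<inter> N F' \<epsilon>' \<inter> V \<inter> V'"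
      show "(path_chain (\<lambda>t. l (t, z)) - path_chain (\<lambda>t. l (t, y))) - (path_chain (\<lambda>t. l' (t, z)) - path_chain (\<lambda>t. l' (t, y))) \<in> boundaries1 X"
        unfolding F(2) F'(2) using boundaries1_diff[OF n1' n2', of z z] z by (simp add: algebra_simps)
    qed
  qed
  then show ?thesis using that by blast
qed

section \<open>The homomorphism induced by the projection\<close>

lemma iso_of_same_kernel:
  assumes f: "group_hom G H f" "f ` carrier G = carrier H" and g: "group_hom G H' g" "g ` carrier G = carrier H'"
    and ker: "\<And>x. x \<in> carrier G \<Longrightarrow> f x = \<one>\<^bsub>H\<^esub> \<longleftrightarrow> g x = \<one>\<^bsub>H'\<^esub>"
  shows "H \<cong> H'"
proof -
  have "kernel G H f = kernel G H' g" using ker by (auto simp: kernel_def)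
  then have 1: "G Mod kernel G H f \<cong> H" and 2: "G Mod kernel G H f \<cong> H'"
    using group_hom.FactGroup_iso[OF f] group_hom.FactGroup_iso[OF g] by auto
  have "group (G Mod kernel G H f)"
    using group_hom.normal_kernel[OF f(1)] normal.factorgroup_is_group by blast
  then show ?thesis using group.iso_sym[OF _ 1] 2 iso_trans by blast
qed

lemma restrict_eq_iff: "restrict f A = restrict g A \<longleftrightarrow> (\<forall>x\<in>A. f x = g x)"
  by (metis restrict_apply' restrict_ext)

locale based_permutation_product = covered_permutation_product X I \<Gamma> Q q \<K>
  for X :: "'a topology" and I :: "nat set" and \<Gamma> and Q :: "'q topology" and q \<K> +
  fixes x0 :: 'a
  assumes connected_X: "path_connected_space X" and x0: "x0 \<in> topspace X"
begin

abbreviation "\<pi> \<equiv> fundamental_group X x0"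
abbreviation "G \<equiv> product_group I (\<lambda>_. \<pi>)"
text \<open>The fibre over the image of a diagonal point is a single point, since permuting equal
  coordinates changes nothing. Hence a lift of a loop at \<open>b0\<close> is a loop.\<close>

definition b0 :: 'q where "b0 = q (\<lambda>i\<in>I. x0)"
abbreviation "\<pi>Q \<equiv> fundamental_group Q b0"

lemma group_\<pi>: "group \<pi>"
  by (rule group_fundamental_group[OF x0])

lemma group_G: "group G"
  using group_\<pi> by simp

lemma base_in: "(\<lambda>i\<in>I. x0) \<in> topspace Xn"
  using x0 by (auto simp: topspace_Xn)

lemma group_\<pi>Q: "group \<pi>Q"
  unfolding b0_def by (rule group_fundamental_group[OF q_in_topspace[OF base_in]])

definition rep :: "(real \<Rightarrow> 'a) set \<Rightarrow> real \<Rightarrow> 'a" where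
  "rep A = (SOME p. p \<in> loops_at X x0 \<and> A = path_class X p)"

lemma rep: assumes "A \<in> carrier \<pi>" shows "rep A \<in> loops_at X x0" "path_class X (rep A) = A"
proof -
  obtain p where "p \<in> loops_at X x0 \<and> A = path_class X p" using fundamental_group_carrierE[OF assms] by metis
  then have "rep A \<in> loops_at X x0 \<and> A = path_class X (rep A)"
    unfolding rep_def by (rule someI[where P="\<lambda>p. p \<in> loops_at X x0 \<and> A = path_class X p"])
  then show "rep A \<in> loops_at X x0" "path_class X (rep A) = A" by auto
qed

lemma rep_homotopic:
  assumes "p \<in> loops_at X x0" shows "path_homotopic X (rep (path_class X p)) p"
  using rep[OF path_class_in_carrier[OF assms]] path_class_eq_iff loops_atD(1) by metis

definition tuple_loop :: "(nat \<Rightarrow> real \<Rightarrow> 'a) \<Rightarrow> real \<Rightarrow> 'q" where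
  "tuple_loop ps t = q (\<lambda>i\<in>I. ps i t)"

text \<open>The map on fundamental groups induced by \<open>q\<close>, with the fundamental group of
  X^n written as a power of \<open>\<pi>\<close> by means of representatives.\<close>

definition \<Theta> :: "(nat \<Rightarrow> (real \<Rightarrow> 'a) set) \<Rightarrow> (real \<Rightarrow> 'q) set" where
  "\<Theta> g = path_class Q (tuple_loop (\<lambda>i. rep (g i)))"

lemma rep_family:
  assumes "g \<in> carrier G"
  shows "\<And>i. i \<in> I \<Longrightarrow> rep (g i) \<in> loops_at X x0" "g = (\<lambda>i\<in>I. path_class X (rep (g i)))"
proof -
  have g: "g \<in> (\<Pi>\<^sub>E i\<in>I. carrier \<pi>)" using assms by simp
  show "rep (g i) \<in> loops_at X x0" if "i \<in> I" for i using rep(1)[OF PiE_mem[OF g that]] .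
  show "g = (\<lambda>i\<in>I. path_class X (rep (g i)))"
  proof
    fix i show "g i = (\<lambda>i\<in>I. path_class X (rep (g i))) i"
    proof (cases "i \<in> I")
      case True
      then show ?thesis using rep(2)[OF PiE_mem[OF g True]] by simp
    next
      case False
      then show ?thesis using PiE_arb[OF g False] by simp
    qed
  qed
qed

lemma G_loops:
  assumes "g \<in> carrier G"
  obtains ps where "\<And>i. i \<in> I \<Longrightarrow> ps i \<in> loops_at X x0" "g = (\<lambda>i\<in>I. path_class X (ps i))"
  by (rule that, erule rep_family(1)[OF assms], rule rep_family(2)[OF assms])

lemma in_carrier_G: "(\<And>i. i \<in> I \<Longrightarrow> ps i \<in> loops_at X x0) \<Longrightarrow> (\<lambda>i\<in>I. path_class X (ps i)) \<in> carrier G"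
  by (auto intro: path_class_in_carrier)

lemma pathin_tuple:
  assumes "\<And>i. i \<in> I \<Longrightarrow> ps i \<in> loops_at X x0"
  shows "pathin Xn (\<lambda>t. \<lambda>i\<in>I. ps i t)"
  by (rule pathin_Xn) (use assms in \<open>auto dest: loops_atD\<close>)

lemma tuple_loop:
  assumes "\<And>i. i \<in> I \<Longrightarrow> ps i \<in> loops_at X x0"
  shows "tuple_loop ps \<in> loops_at Q b0"
proof -
  have "pathin Q (tuple_loop ps)"
    using pathin_compose[OF pathin_tuple[OF assms] q_cont] by (simp add: o_def tuple_loop_def[abs_def])
  moreover have "(\<lambda>i\<in>I. ps i 0) = (\<lambda>i\<in>I. x0)" "(\<lambda>i\<in>I. ps i 1) = (\<lambda>i\<in>I. x0)"
    using assms by (auto intro!: restrict_ext dest: loops_atD)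
  ultimately show ?thesis by (simp add: loops_at_def tuple_loop_def b0_def)
qed

lemma \<Theta>_eq:
  assumes "\<And>i. i \<in> I \<Longrightarrow> ps i \<in> loops_at X x0"
  shows "\<Theta> (\<lambda>i\<in>I. path_class X (ps i)) = path_class Q (tuple_loop ps)"
  unfolding \<Theta>_def
proof (rule path_class_eqI)
  have "path_homotopic Xn (\<lambda>t. \<lambda>i\<in>I. rep ((\<lambda>i\<in>I. path_class X (ps i)) i) t) (\<lambda>t. \<lambda>i\<in>I. ps i t)"
    by (rule path_homotopic_product) (use rep_homotopic[OF assms] in auto)
  from path_homotopic_compose[OF this q_cont]
  show "path_homotopic Q (tuple_loop (\<lambda>i. rep ((\<lambda>i\<in>I. path_class X (ps i)) i))) (tuple_loop ps)"
    by (simp only: tuple_loop_def[abs_def])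
qed

lemma \<Theta>_hom: "\<Theta> \<in> hom G \<pi>Q"
proof (rule homI)
  fix g assume "g \<in> carrier G"
  then obtain ps where ps: "\<And>i. i \<in> I \<Longrightarrow> ps i \<in> loops_at X x0" "g = (\<lambda>i\<in>I. path_class X (ps i))" by (rule G_loops) (rule that, auto)
  then show "\<Theta> g \<in> carrier \<pi>Q" using path_class_in_carrier[OF tuple_loop[OF ps(1)]] by (simp add: \<Theta>_eq)
next
  fix g h assume "g \<in> carrier G" "h \<in> carrier G"
  then obtain ps rs where ps: "\<And>i. i \<in> I \<Longrightarrow> ps i \<in> loops_at X x0" "g = (\<lambda>i\<in>I. path_class X (ps i))"
     and rs: "\<And>i. i \<in> I \<Longrightarrow> rs i \<in> loops_at X x0" "h = (\<lambda>i\<in>I. path_class X (rs i))" by (elim G_loops) (rule that, auto)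
  have "g \<otimes>\<^bsub>G\<^esub> h = (\<lambda>i\<in>I. path_class X (path_join (ps i) (rs i)))"
    unfolding ps(2) rs(2) mult_product_group by (rule restrict_ext) (simp add: mult_fundamental_group ps(1) rs(1))
  moreover have "tuple_loop (\<lambda>i. path_join (ps i) (rs i)) = path_join (tuple_loop ps) (tuple_loop rs)"
    by (auto simp: tuple_loop_def path_join_def fun_eq_iff)
  ultimately show "\<Theta> (g \<otimes>\<^bsub>G\<^esub> h) = \<Theta> g \<otimes>\<^bsub>\<pi>Q\<^esub> \<Theta> h"
    using \<Theta>_eq[of "\<lambda>i. path_join (ps i) (rs i)"] \<Theta>_eq[OF ps(1)] \<Theta>_eq[OF rs(1)] loops_at_join[OF ps(1) rs(1)]
      mult_fundamental_group[OF tuple_loop[OF ps(1)] tuple_loop[OF rs(1)]] by (simp add: ps(2) rs(2))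
qed

sublocale \<Theta>: group_hom G \<pi>Q \<Theta>
  using group_G group_\<pi>Q \<Theta>_hom by (simp add: group_hom_def group_hom_axioms_def)

lemma \<Theta>_surj: "\<Theta> ` carrier G = carrier \<pi>Q"
proof
  show "\<Theta> ` carrier G \<subseteq> carrier \<pi>Q" using \<Theta>.hom_closed by blast
  show "carrier \<pi>Q \<subseteq> \<Theta> ` carrier G"
  proof
    fix A assume "A \<in> carrier \<pi>Q"
    then obtain p where p: "p \<in> loops_at Q b0" "A = path_class Q p" by (rule fundamental_group_carrierE)
    have p': "pathin Q p" "p 0 = b0" "p 1 = b0" using p(1) by (auto simp: loops_at_def)
    obtain r where r: "pathin Xn r" "r 0 = (\<lambda>i\<in>I. x0)" "path_homotopic Q p (\<lambda>t. q (r t))"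
      by (rule lift_path[OF p'(1) base_in]) (auto simp: p' b0_def)
    have "q (\<lambda>i\<in>I. x0) = q (r 1)" using path_homotopic_imp_ends(2)[OF r(3)] p'(3) by (simp add: b0_def)
    then obtain \<sigma> where "\<sigma> \<in> \<Gamma>" "r 1 = (\<lambda>i\<in>I. x0) \<circ> \<sigma>" using q_eq[OF base_in path_finish_in_topspace[OF r(1)]] by blast
    then have r1: "r 1 = (\<lambda>i\<in>I. x0)" using \<Gamma>_in by (auto simp: fun_eq_iff)
    define ps where "ps i t = r t i" for i t
    have ps: "ps i \<in> loops_at X x0" if "i \<in> I" for i
      using r(1) that unfolding pathin_def continuous_map_componentwise
      by (auto simp: loops_at_def ps_def[abs_def] r(2) r1 pathin_def)
    have "path_homotopic Q (\<lambda>t. q (r t)) (tuple_loop ps)"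
    proof (rule path_homotopic_eqI[OF path_homotopic_imp_pathin(2)[OF r(3)]])
      fix t :: real assume "0 \<le> t" "t \<le> 1"
      then have "r t \<in> extensional I" using r(1) unfolding pathin_def continuous_map_componentwise by auto
      then show "q (r t) = tuple_loop ps t" by (simp add: tuple_loop_def ps_def extensional_restrict)
    qed
    from path_class_eqI[OF path_homotopic_trans[OF r(3) this]] have "A = \<Theta> (\<lambda>i\<in>I. path_class X (ps i))"
      using \<Theta>_eq[OF ps] p(2) by simp
    then show "A \<in> \<Theta> ` carrier G" using imageI[OF in_carrier_G[OF ps], of "\<lambda>i. i" \<Theta>] by (simp only:)
  qed
qed

lemma \<Theta>_one_imp:
  assumes ps: "\<And>i. i \<in> I \<Longrightarrow> ps i \<in> loops_at X x0" and 1: "\<Theta> (\<lambda>i\<in>I. path_class X (ps i)) = \<one>\<^bsub>\<pi>Q\<^esub>"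
  shows "path_homotopic Q (tuple_loop ps) (tuple_loop (\<lambda>i t. x0))"
proof -
  have "path_class Q (tuple_loop ps) = path_class Q (tuple_loop (\<lambda>i t. x0))"
    using 1 \<Theta>_eq[OF ps] by (simp add: one_fundamental_group tuple_loop_def[abs_def] b0_def)
  moreover have "pathin Q (tuple_loop ps)" by (rule loops_atD(1)[OF tuple_loop[OF ps]])
  ultimately show ?thesis using path_class_eq_iff by blast
qed

lemma \<Theta>_one_imp_boundary:
  assumes ps: "\<And>i. i \<in> I \<Longrightarrow> ps i \<in> loops_at X x0" and 1: "\<Theta> (\<lambda>i\<in>I. path_class X (ps i)) = \<one>\<^bsub>\<pi>Q\<^esub>"
    and B: "\<And>\<sigma>. \<sigma> \<in> \<Gamma> \<Longrightarrow> \<sigma> ` B = B" "B \<subseteq> I"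
  shows "(\<Sum>i\<in>B. path_chain (ps i)) \<in> boundaries1 X"
proof -
  have c: "pathin Xn (\<lambda>t. \<lambda>i\<in>I. x0)" using base_in by simp
  have "(\<Sum>i\<in>B. path_chain (\<lambda>t. (\<lambda>i\<in>I. ps i t) i)) - (\<Sum>i\<in>B. path_chain (\<lambda>t. (\<lambda>i\<in>I. x0) i)) \<in> boundaries1 X"
    by (rule homologous_if_q_homotopic[OF B pathin_tuple[OF ps] c])
       (use \<Theta>_one_imp[OF ps 1] in \<open>simp_all add: tuple_loop_def[abs_def]\<close>)
  moreover have "(\<Sum>i\<in>B. path_chain (\<lambda>t. (\<lambda>i\<in>I. ps i t) i)) = (\<Sum>i\<in>B. path_chain (ps i))"
    using B(2) by (intro sum.cong) auto
  moreover have "(\<Sum>i\<in>B. path_chain (\<lambda>t. (\<lambda>i\<in>I. x0) i)) \<in> boundaries1 X"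
    by (intro boundaries1_sum) (use B(2) boundaries1_const[OF x0] in auto)
  ultimately show ?thesis using boundaries1_add by fastforce
qed

text \<open>For a fixed coordinate the projection X^n \<rightarrow> X is constant on the fibres of
  \<open>q\<close> and so descends to a continuous map on \<open>Q\<close>. Integrating potentials
  would only show that the homology class vanishes, which is too weak here.\<close>

lemma \<Theta>_one_imp_fixed:
  assumes ps: "\<And>i. i \<in> I \<Longrightarrow> ps i \<in> loops_at X x0" and 1: "\<Theta> (\<lambda>i\<in>I. path_class X (ps i)) = \<one>\<^bsub>\<pi>Q\<^esub>"
    and i: "i \<in> I" "\<And>\<sigma>. \<sigma> \<in> \<Gamma> \<Longrightarrow> \<sigma> i = i"
  shows "path_class X (ps i) = \<one>\<^bsub>\<pi>\<^esub>"
proof -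
  have pr: "lift (q x) i = x i" if x: "x \<in> topspace Xn" for x
  proof -
    have "lift (q x) \<in> topspace Xn" "q (lift (q x)) = q x" using lift[OF q_in_topspace[OF x]] by auto
    then obtain \<sigma> where "\<sigma> \<in> \<Gamma>" "lift (q x) = x \<circ> \<sigma>" using q_eq x by metis
    then show ?thesis using i(2)[OF \<open>\<sigma> \<in> \<Gamma>\<close>] by simp
  qed
  have "continuous_map Xn X ((\<lambda>y. lift y i) \<circ> q)"
    by (rule continuous_map_cong[OF continuous_map_product_projection[OF i(1)]]) (simp add: pr)
  then have "continuous_map Q X (\<lambda>y. lift y i)" by (rule continuous_compose_quotient_map[OF q_quotient])
  from path_homotopic_compose[OF \<Theta>_one_imp[OF ps 1] this]
  have h: "path_homotopic X (\<lambda>t. lift (tuple_loop ps t) i) (\<lambda>t. lift (tuple_loop (\<lambda>i t. x0) t) i)" by simp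
  have "path_homotopic X (ps i) (\<lambda>t. lift (tuple_loop ps t) i)"
  proof (rule path_homotopic_eqI)
    show "pathin X (ps i)" using loops_atD(1)[OF ps[OF i(1)]] .
    fix t :: real assume "0 \<le> t" "t \<le> 1"
    then have "(\<lambda>i\<in>I. ps i t) \<in> topspace Xn" using pathin_tuple[OF ps] by (auto simp: pathin_def continuous_map_def Pi_iff)
    from pr[OF this] show "ps i t = lift (tuple_loop ps t) i" using i(1) by (simp add: tuple_loop_def)
  qed
  from path_homotopic_trans[OF this h] have "path_homotopic X (ps i) (\<lambda>_. x0)"
    using pr[OF base_in] i(1) by (simp add: tuple_loop_def)
  then show ?thesis by (simp add: one_fundamental_group path_class_eqI)
qed

definition part :: "nat set \<Rightarrow> (nat \<Rightarrow> (real \<Rightarrow> 'a) set) \<Rightarrow> nat \<Rightarrow> (real \<Rightarrow> 'a) set" where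
  "part S g = (\<lambda>i\<in>I. if i \<in> S then g i else \<one>\<^bsub>\<pi>\<^esub>)"

abbreviation single :: "nat \<Rightarrow> (real \<Rightarrow> 'a) set \<Rightarrow> nat \<Rightarrow> (real \<Rightarrow> 'a) set" where
  "single i A \<equiv> part {i} (\<lambda>_. A)"

lemma \<pi>_one: "\<one>\<^bsub>\<pi>\<^esub> \<in> carrier \<pi>" and \<pi>_l_one: "A \<in> carrier \<pi> \<Longrightarrow> \<one>\<^bsub>\<pi>\<^esub> \<otimes>\<^bsub>\<pi>\<^esub> A = A" and \<pi>_r_one: "A \<in> carrier \<pi> \<Longrightarrow> A \<otimes>\<^bsub>\<pi>\<^esub> \<one>\<^bsub>\<pi>\<^esub> = A"
  using group_\<pi> group.is_monoid monoid.one_closed monoid.l_one monoid.r_one by metis+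

lemma part_carrier: "(\<And>i. i \<in> S \<inter> I \<Longrightarrow> g i \<in> carrier \<pi>) \<Longrightarrow> part S g \<in> carrier G"
  using \<pi>_one by (auto simp: part_def)

lemma part_Un:
  assumes "S \<inter> S' = {}" "\<And>i. i \<in> (S \<union> S') \<inter> I \<Longrightarrow> g i \<in> carrier \<pi>"
  shows "part (S \<union> S') g = part S g \<otimes>\<^bsub>G\<^esub> part S' g"
  using assms by (auto simp: part_def fun_eq_iff \<pi>_l_one \<pi>_r_one \<pi>_one)

lemma \<Theta>_single:
  assumes p: "p \<in> loops_at X x0"
  shows "\<Theta> (single i (path_class X p)) = path_class Q (tuple_loop (\<lambda>j. if j = i then p else (\<lambda>_. x0)))"
proof -
  have "single i (path_class X p) = (\<lambda>j\<in>I. path_class X (if j = i then p else (\<lambda>_. x0)))"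
    by (auto simp: part_def one_fundamental_group fun_eq_iff)
  then show ?thesis using \<Theta>_eq[of "\<lambda>j. if j = i then p else (\<lambda>_. x0)"] p loops_at_const[OF x0] by simp
qed

text \<open>The two tuples of loops are translates of each other by \<sigma>, so on the interval
  \<open>q\<close> maps them to the very same path.\<close>

lemma \<Theta>_single_orbit:
  assumes A: "A \<in> carrier \<pi>" and \<sigma>: "\<sigma> \<in> \<Gamma>" and i: "i \<in> I"
  shows "\<Theta> (single (\<sigma> i) A) = \<Theta> (single i A)"
proof -
  obtain p where p: "p \<in> loops_at X x0" "A = path_class X p" using A by (rule fundamental_group_carrierE)
  have inj: "\<sigma> j = \<sigma> i \<longleftrightarrow> j = i" for j using permutes_inj[OF \<Gamma>_permutes[OF \<sigma>]] by (auto simp: inj_def)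
  have "path_homotopic Q (tuple_loop (\<lambda>j. if j = \<sigma> i then p else (\<lambda>_. x0))) (tuple_loop (\<lambda>j. if j = i then p else (\<lambda>_. x0)))"
  proof (rule path_homotopic_eqI)
    let ?ps = "\<lambda>j. if j = \<sigma> i then p else (\<lambda>_. x0)"
    have ps: "\<And>j. j \<in> I \<Longrightarrow> ?ps j \<in> loops_at X x0" using p(1) loops_at_const[OF x0] by simp
    show "pathin Q (tuple_loop ?ps)" using loops_atD(1)[OF tuple_loop[OF ps]] .
    fix t :: real assume "0 \<le> t" "t \<le> 1"
    then have "(\<lambda>j\<in>I. ?ps j t) \<in> topspace Xn" using pathin_tuple[OF ps] by (auto simp: pathin_def continuous_map_def Pi_iff)
    from q_comp[OF this \<sigma>] have "q (\<lambda>j\<in>I. ?ps j t) = q ((\<lambda>j\<in>I. ?ps j t) \<circ> \<sigma>)" by simp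
    also have "(\<lambda>j\<in>I. ?ps j t) \<circ> \<sigma> = (\<lambda>j\<in>I. (if j = i then p else (\<lambda>_. x0)) t)"
      using inj \<Gamma>_in[OF \<sigma>] by (auto simp: fun_eq_iff)
    finally show "tuple_loop ?ps t = tuple_loop (\<lambda>j. if j = i then p else (\<lambda>_. x0)) t" by (simp only: tuple_loop_def)
  qed
  then show ?thesis using p by (simp add: \<Theta>_single path_class_eqI)
qed

lemma single_mult:
  "A \<in> carrier \<pi> \<Longrightarrow> B \<in> carrier \<pi> \<Longrightarrow> single i (A \<otimes>\<^bsub>\<pi>\<^esub> B) = single i A \<otimes>\<^bsub>G\<^esub> single i B"
  by (auto simp: part_def fun_eq_iff \<pi>_l_one \<pi>_one)

lemma single_commute:
  "A \<in> carrier \<pi> \<Longrightarrow> B \<in> carrier \<pi> \<Longrightarrow> i \<noteq> j \<Longrightarrow> single i A \<otimes>\<^bsub>G\<^esub> single j B = single j B \<otimes>\<^bsub>G\<^esub> single i A"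
  by (auto simp: part_def fun_eq_iff \<pi>_l_one \<pi>_r_one \<pi>_one)

text \<open>Two different coordinates of the same orbit give the same homomorphism into the fundamental group of
  the quotient, and their images commute; hence this homomorphism factors through homology.\<close>

lemma \<Theta>_part_orbit:
  assumes ps: "\<And>i. i \<in> I \<Longrightarrow> ps i \<in> loops_at X x0" and i: "i \<in> I" and two: "2 \<le> card (perm_orbit \<Gamma> i)"
    and bd: "(\<Sum>j\<in>perm_orbit \<Gamma> i. path_chain (ps j)) \<in> boundaries1 X"
  shows "\<Theta> (part (perm_orbit \<Gamma> i) (\<lambda>j. path_class X (ps j))) = \<one>\<^bsub>\<pi>Q\<^esub>"
proof -
  let ?O = "perm_orbit \<Gamma> i"
  have OI: "?O \<subseteq> I" using i \<Gamma>_in by (auto simp: perm_orbit_def)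
  then have fO: "finite ?O" using finite_I finite_subset by blast
  have "?O \<noteq> {i}" using two by auto
  moreover have "i \<in> ?O" using \<Gamma>_id by (auto simp: perm_orbit_def intro: image_eqI[where x=id])
  ultimately obtain j where j: "j \<in> ?O" "j \<noteq> i" by blast
  define \<iota> where "\<iota> A = \<Theta> (single i A)" for A
  have \<iota>O: "\<Theta> (single l A) = \<iota> A" if l: "l \<in> ?O" and A: "A \<in> carrier \<pi>" for l A
    using l \<Theta>_single_orbit[OF A _ i] by (auto simp: perm_orbit_def \<iota>_def)
  have sc: "single l A \<in> carrier G" if "A \<in> carrier \<pi>" for l A by (rule part_carrier) (use that in auto)
  have \<iota>hom: "\<iota> \<in> hom \<pi> \<pi>Q"
  proof (rule homI)
    show "\<iota> A \<in> carrier \<pi>Q" if "A \<in> carrier \<pi>" for A using \<Theta>.hom_closed[OF sc[OF that]] by (simp add: \<iota>_def)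
    show "\<iota> (A \<otimes>\<^bsub>\<pi>\<^esub> B) = \<iota> A \<otimes>\<^bsub>\<pi>Q\<^esub> \<iota> B" if "A \<in> carrier \<pi>" "B \<in> carrier \<pi>" for A B
      unfolding \<iota>_def single_mult[OF that] by (rule \<Theta>.hom_mult[OF sc sc]) (use that in auto)
  qed
  \<comment> \<open>The extension to chains needs a commutative target, and the fundamental group of
    \<open>Q\<close> need not be commutative; the image of \<open>\<iota>\<close> is.\<close>
  define D where "D = \<pi>Q\<lparr>carrier := \<iota> ` carrier \<pi>\<rparr>"
  have "group_hom \<pi> \<pi>Q \<iota>" using \<iota>hom group_\<pi> group_\<pi>Q by (simp add: group_hom_def group_hom_axioms_def)
  then have "subgroup (\<iota> ` carrier \<pi>) \<pi>Q" by (rule group_hom.img_is_subgroup)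
  then have gD: "group D" unfolding D_def by (rule subgroup.subgroup_is_group[OF _ group_\<pi>Q])
  have D: "comm_group D"
  proof (rule group.group_comm_groupI[OF gD])
    fix x y assume "x \<in> carrier D" "y \<in> carrier D"
    then obtain A B where AB: "A \<in> carrier \<pi>" "x = \<iota> A" "B \<in> carrier \<pi>" "y = \<iota> B" by (auto simp: D_def)
    \<comment> \<open>Loops in different coordinates commute in \<open>G\<close>, and the coordinate
      \<open>j\<close> carries the same homomorphism as \<open>i\<close>.\<close>
    have "\<Theta> (single i A) \<otimes>\<^bsub>\<pi>Q\<^esub> \<Theta> (single j B) = \<Theta> (single j B) \<otimes>\<^bsub>\<pi>Q\<^esub> \<Theta> (single i A)"
      unfolding \<Theta>.hom_mult[OF sc[OF AB(1)] sc[OF AB(3)], symmetric] \<Theta>.hom_mult[OF sc[OF AB(3)] sc[OF AB(1)], symmetric]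
      using single_commute[OF AB(1,3), of i j] j(2) by metis
    then show "x \<otimes>\<^bsub>D\<^esub> y = y \<otimes>\<^bsub>D\<^esub> x"
      using \<iota>O[OF j(1) AB(3)] AB by (simp add: D_def \<iota>_def)
  qed
  have "\<iota> \<in> hom \<pi> D" using \<iota>hom by (auto simp: hom_def D_def)
  then obtain \<Omega> where \<Omega>: "\<Omega> \<in> hom (free_Abelian_group (sing1 X)) D"
    "\<And>c. c \<in> boundaries1 X \<Longrightarrow> \<Omega> c = \<one>\<^bsub>D\<^esub>"
    "\<And>p. p \<in> loops_at X x0 \<Longrightarrow> \<Omega> (path_chain p) = \<iota> (path_class X p)"
    by (rule hom_extends_to_chains[OF connected_X x0 D]) (rule that, assumption, blast, blast)
  \<comment> \<open>Adding one coordinate at a time turns a product in the group into a sum of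
    chains; for the full orbit this sum is a boundary, which \<open>\<Omega>\<close> kills.\<close>
  have "\<Theta> (part S (\<lambda>j. path_class X (ps j))) = \<Omega> (\<Sum>j\<in>S. path_chain (ps j))" if "S \<subseteq> ?O" for S
    using finite_subset[OF that fO] that
  proof (induction S rule: finite_induct)
    case empty
    have "part {} (\<lambda>j. path_class X (ps j)) = \<one>\<^bsub>G\<^esub>" by (auto simp: part_def)
    then have "\<Theta> (part {} (\<lambda>j. path_class X (ps j))) = \<one>\<^bsub>\<pi>Q\<^esub>" using \<Theta>.hom_one by (simp only:)
    then show ?case using \<Omega>(2)[OF boundaries1_zero] by (simp add: D_def)
  next
    case (insert l S)
    have c: "path_class X (ps l') \<in> carrier \<pi>" if "l' \<in> I" for l' using path_class_in_carrier[OF ps[OF that]] .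
    have lI: "l \<in> I" using insert OI by auto
    have "part (insert l S) (\<lambda>j. path_class X (ps j)) = part {l} (\<lambda>j. path_class X (ps j)) \<otimes>\<^bsub>G\<^esub> part S (\<lambda>j. path_class X (ps j))"
      using part_Un[of "{l}" S] insert c by auto
    also have "part {l} (\<lambda>j. path_class X (ps j)) = single l (path_class X (ps l))"
      unfolding part_def by (rule restrict_ext) simp
    finally have P: "part (insert l S) (\<lambda>j. path_class X (ps j)) = single l (path_class X (ps l)) \<otimes>\<^bsub>G\<^esub> part S (\<lambda>j. path_class X (ps j))" .
    have "part S (\<lambda>j. path_class X (ps j)) \<in> carrier G" by (rule part_carrier) (use c in auto)
    then have "\<Theta> (part (insert l S) (\<lambda>j. path_class X (ps j))) = \<Theta> (single l (path_class X (ps l))) \<otimes>\<^bsub>\<pi>Q\<^esub> \<Theta> (part S (\<lambda>j. path_class X (ps j)))"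
      unfolding P by (rule \<Theta>.hom_mult[OF sc[OF c[OF lI]]])
    also have "\<Theta> (single l (path_class X (ps l))) = \<Omega> (path_chain (ps l))"
      using \<iota>O[OF _ c[OF lI]] insert \<Omega>(3)[OF ps[OF lI]] by simp
    also have "\<Theta> (part S (\<lambda>j. path_class X (ps j))) = \<Omega> (\<Sum>j\<in>S. path_chain (ps j))" using insert by simp
    also have "\<Omega> (path_chain (ps l)) \<otimes>\<^bsub>\<pi>Q\<^esub> \<Omega> (\<Sum>j\<in>S. path_chain (ps j)) = \<Omega> (path_chain (ps l) + (\<Sum>j\<in>S. path_chain (ps j)))"
    proof -
      have "path_chain (ps j) \<in> carrier (free_Abelian_group (sing1 X))" if "j \<in> insert l S" for j
        using path_chain_carrier loops_atD(1)[OF ps] that insert OI by blast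
      then have "path_chain (ps l) \<in> carrier (free_Abelian_group (sing1 X))" "(\<Sum>j\<in>S. path_chain (ps j)) \<in> carrier (free_Abelian_group (sing1 X))"
        using sum_closed_free_Abelian_group[of S "\<lambda>j. path_chain (ps j)" "sing1 X"] by auto
      from hom_mult[OF \<Omega>(1) this] show ?thesis by (simp add: D_def)
    qed
    finally show ?case using insert by simp
  qed
  from this[OF subset_refl] show ?thesis using \<Omega>(2)[OF bd] by (simp add: D_def)
qed

section \<open>Orbits and the kernel\<close>

lemma orbit_self: "i \<in> perm_orbit \<Gamma> i"
  using \<Gamma>_id by (auto simp: perm_orbit_def intro: image_eqI[where x=id])

lemma orbit_eq: assumes "j \<in> perm_orbit \<Gamma> i" shows "perm_orbit \<Gamma> j = perm_orbit \<Gamma> i"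
proof -
  obtain \<sigma> where \<sigma>: "\<sigma> \<in> \<Gamma>" "j = \<sigma> i" using assms by (auto simp: perm_orbit_def)
  have inv: "inv' \<sigma> j = i" using permutes_inverses(2)[OF \<Gamma>_permutes[OF \<sigma>(1)]] \<sigma>(2) by simp
  show ?thesis
  proof
    show "perm_orbit \<Gamma> j \<subseteq> perm_orbit \<Gamma> i"
    proof
      fix l assume "l \<in> perm_orbit \<Gamma> j"
      then obtain \<tau> where "\<tau> \<in> \<Gamma>" "l = \<tau> j" by (auto simp: perm_orbit_def)
      then have "\<tau> \<circ> \<sigma> \<in> \<Gamma>" "l = (\<tau> \<circ> \<sigma>) i" using \<Gamma>_comp \<sigma> by auto
      then show "l \<in> perm_orbit \<Gamma> i" unfolding perm_orbit_def by blast
    qed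
    show "perm_orbit \<Gamma> i \<subseteq> perm_orbit \<Gamma> j"
    proof
      fix l assume "l \<in> perm_orbit \<Gamma> i"
      then obtain \<tau> where "\<tau> \<in> \<Gamma>" "l = \<tau> i" by (auto simp: perm_orbit_def)
      then have "\<tau> \<circ> inv' \<sigma> \<in> \<Gamma>" "l = (\<tau> \<circ> inv' \<sigma>) j" using \<Gamma>_comp \<Gamma>_inv[OF \<sigma>(1)] inv by auto
      then show "l \<in> perm_orbit \<Gamma> j" unfolding perm_orbit_def by blast
    qed
  qed
qed

lemma orbit_subset: "i \<in> I \<Longrightarrow> perm_orbit \<Gamma> i \<subseteq> I"
  using \<Gamma>_in by (auto simp: perm_orbit_def)

lemma orbit_finite: "i \<in> I \<Longrightarrow> finite (perm_orbit \<Gamma> i)"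
  using orbit_subset finite_I finite_subset by blast

lemma orbit_invariant:
  assumes "i \<in> I" "\<sigma> \<in> \<Gamma>" shows "\<sigma> ` perm_orbit \<Gamma> i = perm_orbit \<Gamma> i"
proof (rule card_subset_eq[OF orbit_finite[OF assms(1)]])
  show "\<sigma> ` perm_orbit \<Gamma> i \<subseteq> perm_orbit \<Gamma> i"
  proof clarify
    fix l assume "l \<in> perm_orbit \<Gamma> i"
    then obtain \<tau> where "\<tau> \<in> \<Gamma>" "l = \<tau> i" by (auto simp: perm_orbit_def)
    then have "\<sigma> \<circ> \<tau> \<in> \<Gamma>" "\<sigma> l = (\<sigma> \<circ> \<tau>) i" using \<Gamma>_comp assms(2) by auto
    then show "\<sigma> l \<in> perm_orbit \<Gamma> i" unfolding perm_orbit_def by blast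
  qed
  show "card (\<sigma> ` perm_orbit \<Gamma> i) = card (perm_orbit \<Gamma> i)"
    by (rule card_image[OF permutes_inj_on[OF \<Gamma>_permutes[OF assms(2)]]])
qed

definition Fix :: "nat set" where "Fix = {i \<in> I. \<forall>\<sigma>\<in>\<Gamma>. \<sigma> i = i}"

definition Big :: "nat set set" where "Big = {B. \<exists>i\<in>I. B = perm_orbit \<Gamma> i \<and> 2 \<le> card B}"

lemma Fix_or_Big: assumes "i \<in> I" shows "i \<in> Fix \<and> perm_orbit \<Gamma> i = {i} \<or> perm_orbit \<Gamma> i \<in> Big"
proof (cases "i \<in> Fix")
  case True
  then show ?thesis using orbit_self[of i] by (auto simp: Fix_def perm_orbit_def)
next
  case False
  then obtain j where j: "j \<in> perm_orbit \<Gamma> i" "j \<noteq> i" using assms by (auto simp: Fix_def perm_orbit_def)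
  then have "card {i, j} \<le> card (perm_orbit \<Gamma> i)"
    using orbit_self by (intro card_mono orbit_finite assms) auto
  then show ?thesis using j assms by (auto simp: Big_def)
qed

lemma Fix_not_Big: "i \<in> Fix \<Longrightarrow> B \<in> Big \<Longrightarrow> i \<notin> B"
proof
  assume i: "i \<in> Fix" and "B \<in> Big" "i \<in> B"
  then have "B = perm_orbit \<Gamma> i" "2 \<le> card B" using orbit_eq by (auto simp: Big_def)
  moreover have "perm_orbit \<Gamma> i = {i}" using i orbit_self[of i] by (auto simp: Fix_def perm_orbit_def)
  ultimately show False by simp
qed

lemma Big_subset: "B \<in> Big \<Longrightarrow> B \<subseteq> I"
  using orbit_subset by (auto simp: Big_def)

lemma Big_finite: "B \<in> Big \<Longrightarrow> finite B"
  using Big_subset finite_I finite_subset by blast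

lemma Big_invariant: "B \<in> Big \<Longrightarrow> \<sigma> \<in> \<Gamma> \<Longrightarrow> \<sigma> ` B = B"
  using orbit_invariant by (auto simp: Big_def)

lemma Big_disjoint: "B \<in> Big \<Longrightarrow> C \<in> Big \<Longrightarrow> B \<noteq> C \<Longrightarrow> B \<inter> C = {}"
proof (rule ccontr)
  assume BC: "B \<in> Big" "C \<in> Big" "B \<noteq> C" and "B \<inter> C \<noteq> {}"
  then obtain l where "l \<in> B" "l \<in> C" by blast
  then have "perm_orbit \<Gamma> l = B" "perm_orbit \<Gamma> l = C" using BC orbit_eq by (auto simp: Big_def)
  then show False using BC by simp
qed

lemma finite_Big: "finite Big"
  by (rule finite_subset[of _ "Pow I"]) (use Big_subset finite_I in auto)

text \<open>The big orbits are disjoint subsets of \<open>I\<close> and \<open>Fix\<close> is the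
  complement of their union, so the subtraction of natural numbers is exact.\<close>

lemma card_Fix: "card Fix = card I - (\<Sum>B\<in>Big. card B)"
proof -
  have "Fix = I - \<Union>Big"
  proof
    show "Fix \<subseteq> I - \<Union>Big" using Fix_not_Big unfolding Fix_def by blast
    show "I - \<Union>Big \<subseteq> Fix" using Fix_or_Big orbit_self by blast
  qed
  moreover have "card (I - \<Union>Big) = card I - card (\<Union>Big)"
    by (rule card_Diff_subset) (use finite_Big Big_finite Big_subset in auto)
  moreover have "card (\<Union>Big) = (\<Sum>B\<in>Big. card B)"
    by (rule card_Union_disjoint) (use Big_disjoint Big_finite in \<open>auto simp: pairwise_def disjnt_def\<close>)
  ultimately show ?thesis by simp
qed

lemma \<Theta>_one_iff:
  assumes ps: "\<And>i. i \<in> I \<Longrightarrow> ps i \<in> loops_at X x0"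
  shows "\<Theta> (\<lambda>i\<in>I. path_class X (ps i)) = \<one>\<^bsub>\<pi>Q\<^esub> \<longleftrightarrow>
    (\<forall>i\<in>Fix. path_class X (ps i) = \<one>\<^bsub>\<pi>\<^esub>) \<and> (\<forall>B\<in>Big. (\<Sum>i\<in>B. path_chain (ps i)) \<in> boundaries1 X)"
proof
  assume 1: "\<Theta> (\<lambda>i\<in>I. path_class X (ps i)) = \<one>\<^bsub>\<pi>Q\<^esub>"
  then show "(\<forall>i\<in>Fix. path_class X (ps i) = \<one>\<^bsub>\<pi>\<^esub>) \<and> (\<forall>B\<in>Big. (\<Sum>i\<in>B. path_chain (ps i)) \<in> boundaries1 X)"
    using \<Theta>_one_imp_fixed[OF ps 1] \<Theta>_one_imp_boundary[OF ps 1] Big_invariant Big_subset by (auto simp: Fix_def)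
next
  let ?g = "\<lambda>i. path_class X (ps i)"
  assume a: "(\<forall>i\<in>Fix. path_class X (ps i) = \<one>\<^bsub>\<pi>\<^esub>) \<and> (\<forall>B\<in>Big. (\<Sum>i\<in>B. path_chain (ps i)) \<in> boundaries1 X)"
  have c: "?g i \<in> carrier \<pi>" if "i \<in> I" for i using path_class_in_carrier[OF ps[OF that]] .
  have orb: "\<Theta> (part (perm_orbit \<Gamma> i) ?g) = \<one>\<^bsub>\<pi>Q\<^esub>" if i: "i \<in> I" for i
  proof (cases "perm_orbit \<Gamma> i \<in> Big")
    case True
    then show ?thesis using \<Theta>_part_orbit[OF ps i] a by (auto simp: Big_def)
  next
    case False
    then have "i \<in> Fix" "perm_orbit \<Gamma> i = {i}" using Fix_or_Big[OF i] by auto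
    then have "part (perm_orbit \<Gamma> i) ?g = \<one>\<^bsub>G\<^esub>" using a by (auto simp: part_def fun_eq_iff)
    then show ?thesis using \<Theta>.hom_one by (simp only:)
  qed
  \<comment> \<open>The tuple is the product of its parts over the orbits, and each part is already
    known to be in the kernel.\<close>
  have "\<Theta> (part (\<Union>\<S>) ?g) = \<one>\<^bsub>\<pi>Q\<^esub>" if "\<S> \<subseteq> perm_orbit \<Gamma> ` I" for \<S>
    using finite_subset[OF that finite_imageI[OF finite_I]] that
  proof (induction \<S> rule: finite_induct)
    case empty
    have "part {} ?g = \<one>\<^bsub>G\<^esub>" by (auto simp: part_def)
    then show ?case using \<Theta>.hom_one by (simp only: Union_empty)
  next
    case (insert S \<S>)
    obtain i where i: "i \<in> I" "S = perm_orbit \<Gamma> i" using insert by auto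
    have "S \<inter> \<Union>\<S> = {}"
    proof (rule ccontr)
      assume "S \<inter> \<Union>\<S> \<noteq> {}"
      then obtain j S' where "j \<in> S" "j \<in> S'" "S' \<in> \<S>" by blast
      moreover then obtain i' where "S' = perm_orbit \<Gamma> i'" using insert by auto
      ultimately show False using orbit_eq i(2) insert(2) by metis
    qed
    then have "part (\<Union>(insert S \<S>)) ?g = part S ?g \<otimes>\<^bsub>G\<^esub> part (\<Union>\<S>) ?g"
      using part_Un[of S "\<Union>\<S>" ?g] c by auto
    then have "\<Theta> (part (\<Union>(insert S \<S>)) ?g) = \<Theta> (part S ?g) \<otimes>\<^bsub>\<pi>Q\<^esub> \<Theta> (part (\<Union>\<S>) ?g)"
      using \<Theta>.hom_mult[OF part_carrier part_carrier, of S ?g "\<Union>\<S>" ?g] c by simp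
    then show ?case using orb[OF i(1)] i(2) insert group.is_monoid[OF group_\<pi>Q] by (simp add: monoid.l_one monoid.one_closed)
  qed
  from this[OF subset_refl] have "\<Theta> (part (\<Union>(perm_orbit \<Gamma> ` I)) ?g) = \<one>\<^bsub>\<pi>Q\<^esub>" .
  moreover have "part (\<Union>(perm_orbit \<Gamma> ` I)) ?g = (\<lambda>i\<in>I. ?g i)" using orbit_self by (auto simp: part_def fun_eq_iff)
  ultimately show "\<Theta> (\<lambda>i\<in>I. path_class X (ps i)) = \<one>\<^bsub>\<pi>Q\<^esub>" by simp
qed

section \<open>The Hurewicz map on tuples and the isomorphism\<close>

definition hur :: "(real \<Rightarrow> 'a) set \<Rightarrow> (real \<Rightarrow> 'a) \<Rightarrow>\<^sub>0 int" where "hur A = path_chain (rep A)"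

lemma hur_class: "p \<in> loops_at X x0 \<Longrightarrow> hur (path_class X p) - path_chain p \<in> boundaries1 X"
  unfolding hur_def by (rule path_homotopic_imp_homologous[OF rep_homotopic])

lemma hur_cycle: "A \<in> carrier \<pi> \<Longrightarrow> hur A \<in> cycles1 X"
  unfolding hur_def by (rule path_chain_cycle[OF rep(1)])

text \<open>Additivity holds only modulo boundaries, as the representative chosen for a product need
  not be the join of those chosen for the factors.\<close>

lemma hur_mult:
  assumes "A \<in> carrier \<pi>" "B \<in> carrier \<pi>"
  shows "hur (A \<otimes>\<^bsub>\<pi>\<^esub> B) - (hur A + hur B) \<in> boundaries1 X"
proof -
  let ?p = "rep A" and ?r = "rep B"
  have l: "?p \<in> loops_at X x0" "?r \<in> loops_at X x0" using rep assms by auto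
  have "A \<otimes>\<^bsub>\<pi>\<^esub> B = path_class X (path_join ?p ?r)" using mult_fundamental_group[OF l] rep(2) assms by simp
  then have 1: "hur (A \<otimes>\<^bsub>\<pi>\<^esub> B) - path_chain (path_join ?p ?r) \<in> boundaries1 X" using hur_class[OF loops_at_join[OF l]] by simp
  have 2: "path_chain ?p + path_chain ?r - path_chain (path_join ?p ?r) \<in> boundaries1 X"
    by (rule path_chain_join) (use l in \<open>auto simp: loops_at_def\<close>)
  from boundaries1_diff[OF 1 2] show ?thesis by (simp add: hur_def)
qed

lemma hur_one: "hur \<one>\<^bsub>\<pi>\<^esub> \<in> boundaries1 X"
  using boundaries1_add[OF hur_class[OF loops_at_const[OF x0]] boundaries1_const[OF x0]]
  by (simp add: one_fundamental_group)

lemma one_iff_hur: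
  assumes g: "g \<in> carrier G"
  shows "\<Theta> g = \<one>\<^bsub>\<pi>Q\<^esub> \<longleftrightarrow> (\<forall>i\<in>Fix. g i = \<one>\<^bsub>\<pi>\<^esub>) \<and> (\<forall>B\<in>Big. (\<Sum>i\<in>B. hur (g i)) \<in> boundaries1 X)"
proof -
  note r = rep_family(1)[OF g]
  have e: "path_class X (rep (g i)) = g i" if "i \<in> I" for i using rep(2) g that by auto
  have "\<Theta> g = \<Theta> (\<lambda>i\<in>I. path_class X (rep (g i)))" by (rule arg_cong[OF rep_family(2)[OF g]])
  then show ?thesis using \<Theta>_one_iff[OF r] e by (auto simp: hur_def Fix_def)
qed

theorem fundamental_group_base:
  "\<pi>Q \<cong> product_group {..<card Fix} (\<lambda>_. \<pi>) \<times>\<times> product_group {..<card Big} (\<lambda>_. H1 X)"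
proof -
  let ?R1 = "product_group {..<card Fix} (\<lambda>_. \<pi>)" and ?R2 = "product_group {..<card Big} (\<lambda>_. H1 X)"
  have fF: "finite Fix" using finite_I by (simp add: Fix_def)
  \<comment> \<open>The target is indexed by initial segments of the natural numbers, hence the
    enumerations of fixed points and of big orbits.\<close>
  obtain e where e: "bij_betw e {..<card Fix} Fix" using ex_bij_betw_nat_finite[OF fF] by (auto simp: atLeast0LessThan)
  obtain Bs where Bs: "bij_betw Bs {..<card Big} Big" using ex_bij_betw_nat_finite[OF finite_Big] by (auto simp: atLeast0LessThan)
  have eF: "e j \<in> Fix" "e j \<in> I" if "j < card Fix" for j using e that by (auto simp: bij_betw_def Fix_def)
  have BsB: "Bs j \<in> Big" if "j < card Big" for j using Bs that by (auto simp: bij_betw_def)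
  have gH: "group (H1 X)" using comm_group_H1 comm_group.axioms(2) by blast
  have gR: "group (?R1 \<times>\<times> ?R2)" using group_\<pi> gH by (intro DirProd_group) auto
  define \<Lambda> where "\<Lambda> g = (\<lambda>j\<in>{..<card Fix}. g (e j), \<lambda>j\<in>{..<card Big}. h1_class X (\<Sum>i\<in>Bs j. hur (g i)))" for g :: "nat \<Rightarrow> (real \<Rightarrow> 'a) set"
  have gc: "g i \<in> carrier \<pi>" if "g \<in> carrier G" "i \<in> I" for g i using that by auto
  have cyc: "(\<Sum>i\<in>B. hur (g i)) \<in> cycles1 X" if "g \<in> carrier G" "B \<in> Big" for g B
    by (intro cycles1_sum hur_cycle gc that(1)) (use Big_subset that in auto)
  have \<Lambda>c: "\<Lambda> g \<in> carrier (?R1 \<times>\<times> ?R2)" if "g \<in> carrier G" for g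
    using gc[OF that] eF cyc[OF that BsB] by (auto simp: \<Lambda>_def carrier_H1)
  have hom: "\<Lambda> \<in> hom G (?R1 \<times>\<times> ?R2)"
  proof (rule homI)
    fix g h assume g: "g \<in> carrier G" and h: "h \<in> carrier G"
    have "h1_class X (\<Sum>i\<in>B. hur ((g \<otimes>\<^bsub>G\<^esub> h) i)) = h1_class X (\<Sum>i\<in>B. hur (g i)) \<otimes>\<^bsub>H1 X\<^esub> h1_class X (\<Sum>i\<in>B. hur (h i))"
      if B: "B \<in> Big" for B
    proof -
      have "(\<Sum>i\<in>B. hur ((g \<otimes>\<^bsub>G\<^esub> h) i) - (hur (g i) + hur (h i))) \<in> boundaries1 X"
      proof (rule boundaries1_sum)
        fix i assume "i \<in> B"
        then have i: "i \<in> I" using Big_subset B by blast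
        then show "hur ((g \<otimes>\<^bsub>G\<^esub> h) i) - (hur (g i) + hur (h i)) \<in> boundaries1 X"
          using hur_mult[OF gc[OF g i] gc[OF h i]] by simp
      qed
      then show ?thesis unfolding mult_H1[OF cyc[OF g B] cyc[OF h B]] h1_class_eq_iff
        by (simp only: sum_subtractf sum.distrib)
    qed
    then show "\<Lambda> (g \<otimes>\<^bsub>G\<^esub> h) = \<Lambda> g \<otimes>\<^bsub>?R1 \<times>\<times> ?R2\<^esub> \<Lambda> h"
      using BsB eF by (auto simp: \<Lambda>_def mult_DirProd intro!: restrict_ext)
  qed (rule \<Lambda>c)
  have surj: "\<Lambda> ` carrier G = carrier (?R1 \<times>\<times> ?R2)"
  proof
    show "\<Lambda> ` carrier G \<subseteq> carrier (?R1 \<times>\<times> ?R2)" using \<Lambda>c by blast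
    show "carrier (?R1 \<times>\<times> ?R2) \<subseteq> \<Lambda> ` carrier G"
    proof
      fix z assume z: "z \<in> carrier (?R1 \<times>\<times> ?R2)"
      have z1: "fst z j \<in> carrier \<pi>" if "j < card Fix" for j using z that by (auto simp: PiE_iff)
      have z2: "snd z j \<in> carrier (H1 X)" if "j < card Big" for j using z that by (auto simp: PiE_iff)
      have zx: "fst z \<in> extensional {..<card Fix}" "snd z \<in> extensional {..<card Big}" using z by (auto simp: PiE_iff)
      have "\<forall>j\<in>{..<card Big}. \<exists>p. p \<in> loops_at X x0 \<and> snd z j = h1_class X (path_chain p)"
      proof
        fix j assume "j \<in> {..<card Big}"
        then obtain c where c: "c \<in> cycles1 X" "snd z j = h1_class X c" using z2[of j] by (auto simp: carrier_H1)
        obtain p where "p \<in> loops_at X x0" "c - path_chain p \<in> boundaries1 X" by (rule cycle_homologous_loop[OF connected_X x0 c(1)])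
        then show "\<exists>p. p \<in> loops_at X x0 \<and> snd z j = h1_class X (path_chain p)" using c h1_class_eq_iff by metis
      qed
      then obtain p where p: "\<And>j. j < card Big \<Longrightarrow> p j \<in> loops_at X x0" "\<And>j. j < card Big \<Longrightarrow> snd z j = h1_class X (path_chain (p j))"
        by (metis lessThan_iff)
      define ei where "ei = the_inv_into {..<card Fix} e"
      define Bi where "Bi = the_inv_into {..<card Big} Bs"
      \<comment> \<open>One coordinate is picked in each big orbit. It alone carries the loop that
        represents the prescribed homology class, and all other coordinates of the orbit get the
        identity.\<close>
      define c where "c B = (SOME i. i \<in> B)" for B :: "nat set"
      have cB: "c B \<in> B" if "B \<in> Big" for B
      proof -
        have "B \<noteq> {}" using that orbit_self by (auto simp: Big_def)
        then show ?thesis unfolding c_def by (rule some_in_eq[THEN iffD2])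
      qed
      have ei: "ei (e j) = j" if "j < card Fix" for j
        unfolding ei_def by (rule the_inv_into_f_f[OF bij_betw_imp_inj_on[OF e]]) (use that in simp)
      have eil: "ei i < card Fix" if "i \<in> Fix" for i
        using bij_betwE[OF bij_betw_the_inv_into[OF e]] that by (auto simp: ei_def)
      have Bi: "Bi (Bs j) = j" if "j < card Big" for j
        unfolding Bi_def by (rule the_inv_into_f_f[OF bij_betw_imp_inj_on[OF Bs]]) (use that in simp)
      have Bil: "Bi B < card Big" if "B \<in> Big" for B
        using bij_betwE[OF bij_betw_the_inv_into[OF Bs]] that by (auto simp: Bi_def)
      define g where "g = (\<lambda>i\<in>I. if i \<in> Fix then fst z (ei i)
         else if i = c (perm_orbit \<Gamma> i) then path_class X (p (Bi (perm_orbit \<Gamma> i))) else \<one>\<^bsub>\<pi>\<^esub>)"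
      have "g i \<in> carrier \<pi>" if "i \<in> I" for i
        using that Fix_or_Big[OF that] z1 eil Bil p(1) \<pi>_one by (auto simp: g_def intro!: path_class_in_carrier)
      then have gG: "g \<in> carrier G" by (auto simp: g_def)
      have "h1_class X (\<Sum>i\<in>Bs j. hur (g i)) = snd z j" if j: "j < card Big" for j
      proof -
        have B: "Bs j \<in> Big" using BsB j .
        have o: "perm_orbit \<Gamma> i = Bs j" if "i \<in> Bs j" for i using B that orbit_eq by (auto simp: Big_def)
        have gi: "g i = (if i = c (Bs j) then path_class X (p j) else \<one>\<^bsub>\<pi>\<^esub>)" if "i \<in> Bs j" for i
          using that Fix_not_Big[of i "Bs j"] B Big_subset[OF B] by (auto simp: g_def o Bi[OF j])
        have "(\<Sum>i\<in>Bs j. hur (g i)) = hur (g (c (Bs j))) + (\<Sum>i\<in>Bs j - {c (Bs j)}. hur (g i))"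
          by (rule sum.remove[OF Big_finite[OF B] cB[OF B]])
        also have "hur (g (c (Bs j))) = hur (path_class X (p j))" using gi[OF cB[OF B]] by simp
        finally have s: "(\<Sum>i\<in>Bs j. hur (g i)) = hur (path_class X (p j)) + (\<Sum>i\<in>Bs j - {c (Bs j)}. hur (g i))" .
        \<comment> \<open>The Hurewicz image of the identity is a boundary rather than zero, so the
          other coordinates drop out only modulo boundaries.\<close>
        have "(\<Sum>i\<in>Bs j - {c (Bs j)}. hur (g i)) \<in> boundaries1 X"
          by (rule boundaries1_sum) (use gi hur_one in auto)
        from boundaries1_add[OF hur_class[OF p(1)[OF j]] this]
        have "(\<Sum>i\<in>Bs j. hur (g i)) - path_chain (p j) \<in> boundaries1 X" by (simp add: s algebra_simps)
        then show ?thesis using p(2)[OF j] by (simp add: h1_class_eq_iff)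
      qed
      then have "snd (\<Lambda> g) = snd z" using zx(2) by (auto simp: \<Lambda>_def fun_eq_iff extensional_def)
      moreover have "fst (\<Lambda> g) = fst z"
        using zx(1) eF ei by (auto simp: \<Lambda>_def fun_eq_iff extensional_def g_def)
      ultimately have "z = \<Lambda> g" by (simp add: prod_eq_iff)
      then show "z \<in> \<Lambda> ` carrier G" using gG by blast
    qed
  qed
  show ?thesis
  proof (rule iso_of_same_kernel[OF \<Theta>.group_hom_axioms \<Theta>_surj _ surj])
    show "group_hom G (?R1 \<times>\<times> ?R2) \<Lambda>" using hom group_G gR by (simp add: group_hom_def group_hom_axioms_def)
    fix g assume g: "g \<in> carrier G"
    have "\<Lambda> g = \<one>\<^bsub>?R1 \<times>\<times> ?R2\<^esub> \<longleftrightarrow> (\<forall>j<card Fix. g (e j) = \<one>\<^bsub>\<pi>\<^esub>) \<and> (\<forall>j<card Big. (\<Sum>i\<in>Bs j. hur (g i)) \<in> boundaries1 X)"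
      by (simp only: \<Lambda>_def one_DirProd one_product_group prod.inject restrict_eq_iff one_H1 h1_class_eq_iff
          diff_0_right lessThan_iff Ball_def)
    also have "\<dots> \<longleftrightarrow> (\<forall>i\<in>Fix. g i = \<one>\<^bsub>\<pi>\<^esub>) \<and> (\<forall>B\<in>Big. (\<Sum>i\<in>B. hur (g i)) \<in> boundaries1 X)"
      unfolding bij_betw_ball[OF e] bij_betw_ball[OF Bs] by (simp only: Ball_def lessThan_iff)
    finally show "\<Theta> g = \<one>\<^bsub>\<pi>Q\<^esub> \<longleftrightarrow> \<Lambda> g = \<one>\<^bsub>?R1 \<times>\<times> ?R2\<^esub>" using one_iff_hur[OF g] by simp
  qed
qed

text \<open>A path in X^n from the diagonal base point to a lift of \<open>b\<close> exists
  coordinate by coordinate; its image under \<open>q\<close> transports the result from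
  \<open>b0\<close> to \<open>b\<close>.\<close>

theorem fundamental_group_quotient:
  assumes b: "b \<in> topspace Q"
  shows "fundamental_group Q b \<cong> product_group {..<card Fix} (\<lambda>_. \<pi>) \<times>\<times> product_group {..<card Big} (\<lambda>_. H1 X)"
proof -
  have lb: "lift b \<in> topspace Xn" "q (lift b) = b" using lift[OF b] by auto
  have "\<forall>i\<in>I. \<exists>p. pathin X p \<and> p 0 = x0 \<and> p 1 = lift b i"
    using connected_X x0 lb(1) unfolding path_connected_space_def topspace_Xn by blast
  then obtain p where p: "\<And>i. i \<in> I \<Longrightarrow> pathin X (p i)" "\<And>i. i \<in> I \<Longrightarrow> p i 0 = x0" "\<And>i. i \<in> I \<Longrightarrow> p i 1 = lift b i" by metis
  have "pathin Xn (\<lambda>t. \<lambda>i\<in>I. p i t)" by (rule pathin_Xn) (use p in auto)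
  from pathin_compose[OF this q_cont] have "pathin Q (\<lambda>t. q (\<lambda>i\<in>I. p i t))" by (simp add: o_def)
  from fundamental_group_base_change[OF this]
  have "fundamental_group Q (q (\<lambda>i\<in>I. p i 1)) \<cong> fundamental_group Q (q (\<lambda>i\<in>I. p i 0))" .
  moreover have "(\<lambda>i\<in>I. p i 1) = lift b" using p(3) lb(1) by (auto simp: topspace_Xn extensional_def)
  moreover have "(\<lambda>i\<in>I. p i 0) = (\<lambda>i\<in>I. x0)" using p(2) by (auto intro: restrict_ext)
  ultimately have "fundamental_group Q b \<cong> \<pi>Q" using lb(2) by (simp add: b0_def)
  then show ?thesis using fundamental_group_base iso_trans by blast
qed

end

text \<open>The empty product has the single element \<open>\<lambda>_. undefined\<close>, and
  evaluation at 0 identifies the other factor with \<open>H\<close>.\<close>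

lemma DirProd_trivial_product_iso:
  "product_group ({} :: nat set) (\<lambda>_. G) \<times>\<times> product_group {..<Suc 0} (\<lambda>_. H) \<cong> H"
proof -
  let ?P = "product_group ({} :: nat set) (\<lambda>_. G) \<times>\<times> product_group {..<Suc 0} (\<lambda>_. H)"
  have c: "z \<in> carrier ?P \<longleftrightarrow> fst z = (\<lambda>_. undefined) \<and> snd z \<in> extensional {..<Suc 0} \<and> snd z 0 \<in> carrier H" for z
    by (cases z) (auto simp: DirProd_def PiE_iff lessThan_Suc)
  have "(\<lambda>z. snd z 0) \<in> iso ?P H"
  proof (rule isoI)
    show "(\<lambda>z. snd z 0) \<in> hom ?P H"
    proof (rule homI)
      show "snd (z \<otimes>\<^bsub>?P\<^esub> w) 0 = snd z 0 \<otimes>\<^bsub>H\<^esub> snd w 0" for z w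
        by (cases z; cases w) (simp add: DirProd_def)
    qed (use c in blast)
    show "bij_betw (\<lambda>z. snd z 0) (carrier ?P) (carrier H)"
    proof (rule bij_betwI[where g="\<lambda>x. (\<lambda>_. undefined, \<lambda>i\<in>{..<Suc 0}. x)"])
      show "((\<lambda>_. undefined, \<lambda>i\<in>{..<Suc 0}. snd z 0)) = z" if "z \<in> carrier ?P" for z
        using that[unfolded c] by (cases z) (simp add: restrict_def extensional_def fun_eq_iff)
      show "(\<lambda>x. ((\<lambda>_. undefined, \<lambda>i\<in>{..<Suc 0}. x))) \<in> carrier H \<rightarrow> carrier ?P"
        unfolding Pi_iff c by simp
    qed (use c in \<open>simp_all add: Pi_iff\<close>)
  qed
  then show ?thesis by (auto simp: is_iso_def)
qed

theorem theorem6p1: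
  fixes X :: "'a topology" and n :: nat and \<Gamma> :: "(nat \<Rightarrow> nat) set"
    and Q :: "'q topology" and q :: "(nat \<Rightarrow> 'a) \<Rightarrow> 'q"
    and b :: 'q and x0 :: 'a
  assumes "path_connected_space X"
    and "has_simplicial_homotopy_type X TYPE('v)"
    and "n \<ge> 1"
    and "subgroup \<Gamma> (sym_group n)"
    and "quotient_map (product_topology (\<lambda>i. X) {1..n}) Q q"
    and "\<forall>x\<in>topspace (product_topology (\<lambda>i. X) {1..n}).
           \<forall>y\<in>topspace (product_topology (\<lambda>i. X) {1..n}).
             q x = q y \<longleftrightarrow> (\<exists>\<sigma>\<in>\<Gamma>. y = x \<circ> \<sigma>)"
    and "b \<in> topspace Q" and "x0 \<in> topspace X"
  shows "(fundamental_group Q b \<cong>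
           product_group {..<n - (\<Sum>B\<in>big_orbits n \<Gamma>. card B)} (\<lambda>_. fundamental_group X x0)
           \<times>\<times> product_group {..<card (big_orbits n \<Gamma>)} (\<lambda>_. H1 X)) \<and>
         (n \<ge> 2 \<and> (\<forall>i\<in>{1..n}. \<forall>j\<in>{1..n}. \<exists>\<sigma>\<in>\<Gamma>. \<sigma> i = j) \<longrightarrow>
           fundamental_group Q b \<cong> H1 X)"
proof -
  obtain \<K> where \<K>: "contractible_cover X \<K>" using contractible_cover_of_homotopy_type[OF assms(2)] .
  have perm: "\<sigma> permutes {1..n}" if "\<sigma> \<in> \<Gamma>" for \<sigma>
    using subgroup.subset[OF assms(4)] that by (auto simp: sym_group_carrier)
  interpret contractible_cover X \<K> by (rule \<K>)
  interpret based_permutation_product X "{1..n}" \<Gamma> Q q \<K> x0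
  proof
    show "id \<in> \<Gamma>" using subgroup.one_closed[OF assms(4)] by (simp add: sym_group_one)
    show "\<sigma> \<circ> \<tau> \<in> \<Gamma>" if "\<sigma> \<in> \<Gamma>" "\<tau> \<in> \<Gamma>" for \<sigma> \<tau>
      using subgroup.m_closed[OF assms(4) that] by (simp add: sym_group_mult)
    show "inv' \<sigma> \<in> \<Gamma>" if "\<sigma> \<in> \<Gamma>" for \<sigma>
    proof -
      have "inv\<^bsub>sym_group n\<^esub> \<sigma> = inv' \<sigma>"
        by (rule group.inv_equality[OF sym_group_is_group])
           (use perm[OF that] permutes_inv[OF perm[OF that]] permutes_inv_o[OF perm[OF that]] in \<open>auto simp: sym_group_def\<close>)
      then show ?thesis using subgroup.m_inv_closed[OF assms(4) that] by simp
    qed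
  qed (use assms perm in auto)
  have Big: "Big = big_orbits n \<Gamma>" by (simp only: Big_def big_orbits_def)
  have main: "fundamental_group Q b \<cong>
           product_group {..<n - (\<Sum>B\<in>big_orbits n \<Gamma>. card B)} (\<lambda>_. fundamental_group X x0)
           \<times>\<times> product_group {..<card (big_orbits n \<Gamma>)} (\<lambda>_. H1 X)"
    using fundamental_group_quotient[OF assms(7)] unfolding card_Fix Big by simp
  moreover have "fundamental_group Q b \<cong> H1 X"
    if n: "n \<ge> 2" and tr: "\<forall>i\<in>{1..n}. \<forall>j\<in>{1..n}. \<exists>\<sigma>\<in>\<Gamma>. \<sigma> i = j"
  proof -
    have "perm_orbit \<Gamma> i = {1..n}" if i: "i \<in> {1..n}" for i
    proof
      show "perm_orbit \<Gamma> i \<subseteq> {1..n}" by (rule orbit_subset[OF i])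
      show "{1..n} \<subseteq> perm_orbit \<Gamma> i"
      proof
        fix j assume "j \<in> {1..n}"
        then obtain \<sigma> where "\<sigma> \<in> \<Gamma>" "\<sigma> i = j" using tr i by blast
        then show "j \<in> perm_orbit \<Gamma> i" unfolding perm_orbit_def by blast
      qed
    qed
    \<comment> \<open>The unique orbit has n elements and counts as big because n \<ge> 2; the
      exponents become n - n = 0 and 1.\<close>
    then have "big_orbits n \<Gamma> = {{1..n}}" using n by (auto simp: big_orbits_def)
    then have "fundamental_group Q b \<cong> product_group ({} :: nat set) (\<lambda>_. fundamental_group X x0) \<times>\<times> product_group {..<Suc 0} (\<lambda>_. H1 X)"
      using main by simp
    then show ?thesis using DirProd_trivial_product_iso iso_trans by blast
  qed
  ultimately show ?thesis by blast
qed

end
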